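(* If a.s. $\mathbb{P}_\xi(N\le1)=0$ and $\mathbb{E}_\xi N^{1+\delta}\le K$ for some constants $\delta>0$ and $K>0$, then a.s., for each measurable (Borel) subset $A$ of $\mathbb{R}$, $$-\inf_{x\in A^o}\tilde\Lambda^*(x)-\mathbb{E}\log m_0\le\liminf_{n\to\infty}\frac1n\log\mathbb{E}_\xi\frac{Z_n(nA)}{Z_n(\mathbb{R})}\le\limsup_{n\to\infty}\frac1n\log\mathbb{E}_\xi\frac{Z_n(nA)}{Z_n(\mathbb{R})}\le-\inf_{x\in\bar A}\Lambda^*(x)-\mathbb{E}\log m_0,$$ where $A^o$ denotes the interior of $A$ and $\bar A$ its closure.
   Context: Branching random walk in a random environment in time. Let $\xi=(\xi_n)_{n\ge 0}$ be a stationary and ergodic sequence of random variables with values in a measurable space $\Theta$; each realization of $\xi_n$ determines a probability distribution $\eta_n=\eta(\xi_n)$ on $\mathbb{N}\times\mathbb{R}\times\mathbb{R}\times\cdots$. Given $\xi$ (quenched law $\mathbb{P}_\xi$, expectation $\mathbb{E}_\xi$), let $X(u)=(N(u),L_1(u),L_2(u),\dots)$, indexed by finite sequences $u\in\{\emptyset\}\cup\bigcup_{n\ge1}\mathbb{N}^n$, be independent random vectors, $X(u)$ having law $\eta_n$ when the length $|u|$ equals $n$ (values $L_i(u)$ with $i>N(u)$ play no role in the process). The initial particle $\emptyset$ is at $S_\emptyset=0$; each particle $u$ of generation $n$, located at $S_u$, is replaced by $N(u)$ particles $ui$ of generation $n+1$ located at $S_{ui}=S_u+L_i(u)$, $1\le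 i\le N(u)$. Let $\mathbb{T}_n$ be the set of particles of generation $n$ and $Z_n=\sum_{u\in\mathbb{T}_n}\delta_{S_u}$ their counting measure. The annealed law $\mathbb{P}$ (expectation $\mathbb{E}$) is $\mathbb{P}_\xi$ integrated against the law of $\xi$; "a.s." refers to $\mathbb{P}$. Write $N=N(\emptyset)$, $L_i=L_i(\emptyset)$, and $m_n=\mathbb{E}_\xi N(u)$ for $|u|=n$. Standing assumptions: $\mathbb{E}\log m_0\in(0,\infty)$ and $\mathbb{E}\frac{N}{m_0}\log^+N<\infty$; and, with $m_0(t)=\mathbb{E}_\xi\sum_{i=1}^{N}e^{tL_i}$, $\mathbb{E}|L_1|<\infty$, $\mathbb{E}|\log m_0(t)|<\infty$ and $\mathbb{E}\left|\frac{m_0'(t)}{m_0(t)}\right|<\infty$ for all $t\in\mathbb{R}$. Notation: $\Lambda(t)=\mathbb{E}\log m_0(t)$, which is differentiable with $\Lambda'(t)=\mathbb{E}\frac{m_0'(t)}{m_0(t)}$; $\Lambda^*(x)=\sup_{t\in\mathbb{R}}\{xt-\Lambda(t)\}$; $t_-=\inf\{t\in\mathbb{R}:t\Lambda'(t)-\Lambda(t)\le0\}$, $t_+=\sup\{t\in\mathbb{R}:t\Lambda'(t)-\Lambda(t)\le0\}$, so $-\infty\le t_-<0<t_+\le\infty$. Define $\tilde\Lambda(t)=\Lambda(t)$ if $t\in(t_-,t_+)$, $\tilde\Lambda(t)=t\Lambda'(t_+)$ if $t\ge t_+$, $\tilde\Lambda(t)=t\Lambda'(t_-)$ if $t\le t_-$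 (for real $t$), and $\tilde\Lambda^*(x)=\sup_{t\in\mathbb{R}}\{xt-\tilde\Lambda(t)\}$. Also $nA=\{nx:x\in A\}$; $\log0=-\infty$ and $\inf\emptyset=+\infty$. *)

theory Defs
  imports "HOL-Probability.Probability"
begin

text \<open>
  A point \<open>(N, L)\<close> of \<open>offspring_space\<close> stands for the vector \<open>(N, L\<^sub>1, L\<^sub>2, \<dots>)\<close>;
  the numbering is shifted to start at 0, so that \<open>L i\<close> is \<open>L\<^sub>i\<^sub>+\<^sub>1\<close> and the children of a
  particle \<open>u\<close> are the words \<open>u @ [i]\<close> with \<open>i < N\<close>.
\<close>

type_synonym offspring = "nat \<times> (nat \<Rightarrow> real)"

definition offspring_space :: "offspring measure" where
  "offspring_space = count_space UNIV \<Otimes>\<^sub>M PiM UNIV (\<lambda>_. borel)"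

type_synonym marked_tree = "nat list \<Rightarrow> offspring"

definition tree_space :: "marked_tree measure" where
  "tree_space = PiM UNIV (\<lambda>_. offspring_space)"

definition num_children :: "marked_tree \<Rightarrow> nat list \<Rightarrow> nat" where
  "num_children \<omega> u = fst (\<omega> u)"

definition displacement :: "marked_tree \<Rightarrow> nat list \<Rightarrow> nat \<Rightarrow> real" where
  "displacement \<omega> u i = snd (\<omega> u) i"

primrec generation :: "marked_tree \<Rightarrow> nat \<Rightarrow> nat list set" where
  "generation \<omega> 0 = {[]}"
| "generation \<omega> (Suc n) = {u @ [i] | u i. u \<in> generation \<omega> n \<and> i < num_children \<omega> u}"

definition position :: "marked_tree \<Rightarrow> nat list \<Rightarrow> real" where
  "position \<omega> u = (\<Sum>k<length u. displacement \<omega> (take k u) (u ! k))"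

lemma position_Nil: "position \<omega> [] = 0"
  by (simp add: position_def)

lemma position_snoc: "position \<omega> (u @ [i]) = position \<omega> u + displacement \<omega> u i"
  by (simp add: position_def nth_append)

lemma finite_generation: "finite (generation \<omega> n)"
proof (induction n)
  case (Suc n)
  have "generation \<omega> (Suc n) =
      (\<Union>u\<in>generation \<omega> n. (\<lambda>i. u @ [i]) ` {..<num_children \<omega> u})"
    by auto
  then show ?case using Suc by simp
qed simp

definition Z :: "marked_tree \<Rightarrow> nat \<Rightarrow> real set \<Rightarrow> real" where
  "Z \<omega> n B = (\<Sum>u\<in>generation \<omega> n. indicator B (position \<omega> u))"

text \<open>
  An environment is a sequence \<open>\<xi> :: nat \<Rightarrow> 'a\<close> of points of \<open>\<Theta>\<close>, and \<open>\<tau>\<close> is the law of the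
  random environment.
\<close>

definition quenched :: "('a \<Rightarrow> offspring measure) \<Rightarrow> (nat \<Rightarrow> 'a) \<Rightarrow> marked_tree measure" where
  "quenched \<eta> \<xi> = PiM UNIV (\<lambda>u. \<eta> (\<xi> (length u)))"

definition annealed ::
  "('a \<Rightarrow> offspring measure) \<Rightarrow> (nat \<Rightarrow> 'a) measure \<Rightarrow> ((nat \<Rightarrow> 'a) \<times> marked_tree) measure" where
  "annealed \<eta> \<tau> = \<tau> \<bind> (\<lambda>\<xi>. distr (quenched \<eta> \<xi>) (\<tau> \<Otimes>\<^sub>M tree_space) (\<lambda>\<omega>. (\<xi>, \<omega>)))"

definition shift :: "(nat \<Rightarrow> 'a) \<Rightarrow> nat \<Rightarrow> 'a" where
  "shift \<xi> = (\<lambda>n. \<xi> (Suc n))"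

definition stationary :: "(nat \<Rightarrow> 'a) measure \<Rightarrow> bool" where
  "stationary \<tau> \<longleftrightarrow> distr \<tau> \<tau> shift = \<tau>"

definition ergodic :: "(nat \<Rightarrow> 'a) measure \<Rightarrow> bool" where
  "ergodic \<tau> \<longleftrightarrow>
     (\<forall>B\<in>sets \<tau>. shift -` B \<inter> space \<tau> = B \<longrightarrow> measure \<tau> B = 0 \<or> measure \<tau> B = 1)"

definition elog :: "ennreal \<Rightarrow> ereal" where
  "elog x = (if x = 0 then -\<infinity> else if x = \<infinity> then \<infinity> else ereal (ln (enn2real x)))"

text \<open>
  The quenched means \<open>m\<^sub>0\<close> and \<open>m\<^sub>0(t)\<close> are extended nonnegative integrals: integrability of
  their \<open>elog\<close> then forces them to lie in \<open>(0, \<infinity>)\<close> almost surely.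
\<close>

definition m0 :: "('a \<Rightarrow> offspring measure) \<Rightarrow> (nat \<Rightarrow> 'a) \<Rightarrow> ennreal" where
  "m0 \<eta> \<xi> = (\<integral>\<^sup>+\<omega>. of_nat (num_children \<omega> []) \<partial>quenched \<eta> \<xi>)"

definition m0_exp :: "('a \<Rightarrow> offspring measure) \<Rightarrow> (nat \<Rightarrow> 'a) \<Rightarrow> real \<Rightarrow> ennreal" where
  "m0_exp \<eta> \<xi> t =
     (\<integral>\<^sup>+\<omega>. ennreal (\<Sum>i<num_children \<omega> []. exp (t * displacement \<omega> [] i)) \<partial>quenched \<eta> \<xi>)"

definition mean_log_m0 :: "('a \<Rightarrow> offspring measure) \<Rightarrow> (nat \<Rightarrow> 'a) measure \<Rightarrow> real" where
  "mean_log_m0 \<eta> \<tau> = (\<integral>\<xi>. real_of_ereal (elog (m0 \<eta> \<xi>)) \<partial>\<tau>)"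

definition Lam :: "('a \<Rightarrow> offspring measure) \<Rightarrow> (nat \<Rightarrow> 'a) measure \<Rightarrow> real \<Rightarrow> real" where
  "Lam \<eta> \<tau> t = (\<integral>\<xi>. real_of_ereal (elog (m0_exp \<eta> \<xi> t)) \<partial>\<tau>)"

definition t_minus :: "('a \<Rightarrow> offspring measure) \<Rightarrow> (nat \<Rightarrow> 'a) measure \<Rightarrow> ereal" where
  "t_minus \<eta> \<tau> = Inf (ereal ` {t. t * deriv (Lam \<eta> \<tau>) t - Lam \<eta> \<tau> t \<le> 0})"

definition t_plus :: "('a \<Rightarrow> offspring measure) \<Rightarrow> (nat \<Rightarrow> 'a) measure \<Rightarrow> ereal" where
  "t_plus \<eta> \<tau> = Sup (ereal ` {t. t * deriv (Lam \<eta> \<tau>) t - Lam \<eta> \<tau> t \<le> 0})"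

definition Lam_tilde :: "('a \<Rightarrow> offspring measure) \<Rightarrow> (nat \<Rightarrow> 'a) measure \<Rightarrow> real \<Rightarrow> real" where
  "Lam_tilde \<eta> \<tau> t =
     (if t_minus \<eta> \<tau> < ereal t \<and> ereal t < t_plus \<eta> \<tau> then Lam \<eta> \<tau> t
      else if t_plus \<eta> \<tau> \<le> ereal t then t * deriv (Lam \<eta> \<tau>) (real_of_ereal (t_plus \<eta> \<tau>))
      else t * deriv (Lam \<eta> \<tau>) (real_of_ereal (t_minus \<eta> \<tau>)))"

definition legendre :: "(real \<Rightarrow> real) \<Rightarrow> real \<Rightarrow> ereal" where
  "legendre f x = (SUP t. ereal (x * t - f t))"

text \<open>
  The environment has law \<open>\<tau>\<close> under the annealed law, so expectations and almost sure
  statements that involve \<open>\<xi>\<close> alone are taken with respect to \<open>\<tau>\<close>.  For almost every \<open>\<xi>\<close> the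
  function \<open>m0_exp \<eta> \<xi>\<close> is finite on the whole line, hence differentiable.
\<close>

locale branching_random_walk_in_random_environment =
  fixes \<Theta> :: "'a measure"
    and \<eta> :: "'a \<Rightarrow> offspring measure"
    and \<tau> :: "(nat \<Rightarrow> 'a) measure"
  assumes prob_space_env: "prob_space \<tau>"
    and sets_env: "sets \<tau> = sets (PiM UNIV (\<lambda>_. \<Theta>))"
    and stationary_env: "stationary \<tau>"
    and ergodic_env: "ergodic \<tau>"
    and measurable_offspring_law: "\<eta> \<in> \<Theta> \<rightarrow>\<^sub>M prob_algebra offspring_space"
    and log_m0_integrable: "(\<integral>\<^sup>+\<xi>. e2ennreal \<bar>elog (m0 \<eta> \<xi>)\<bar> \<partial>\<tau>) < \<infinity>"
    and supercritical: "0 < mean_log_m0 \<eta> \<tau>"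
    and N_log_N: "(\<integral>\<^sup>+(\<xi>, \<omega>). of_nat (num_children \<omega> []) / m0 \<eta> \<xi>
                      * ennreal (max 0 (ln (real (num_children \<omega> [])))) \<partial>annealed \<eta> \<tau>) < \<infinity>"
    and L1_integrable: "(\<integral>\<^sup>+(\<xi>, \<omega>). ennreal \<bar>displacement \<omega> [] 0\<bar> \<partial>annealed \<eta> \<tau>) < \<infinity>"
    and log_m0_exp_integrable: "\<And>t. (\<integral>\<^sup>+\<xi>. e2ennreal \<bar>elog (m0_exp \<eta> \<xi> t)\<bar> \<partial>\<tau>) < \<infinity>"
    and log_deriv_integrable:
      "\<And>t. (\<integral>\<^sup>+\<xi>. ennreal \<bar>deriv (\<lambda>s. enn2real (m0_exp \<eta> \<xi> s)) t
                            / enn2real (m0_exp \<eta> \<xi> t)\<bar> \<partial>\<tau>) < \<infinity>"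

end

theory Submission
  imports Defs "HOL-Real_Asymp.Real_Asymp"
begin

text \<open>
  Write \<open>P\<^sub>n\<close> for the quenched mean of \<open>Z\<^sub>n\<close>. Since \<open>N \<ge> 2\<close>, dividing by \<open>Z\<^sub>n\<close> costs only a
  factor \<open>P\<^sub>n\<close> up to subexponential terms, for every exponential tilt, and the quenched ratio has
  the large deviations of the quenched mean measure, a convolution of independent step measures.

  Upper bound: every particle of generation 1 has a sibling whose progeny is independent of its
  own, so \<open>E (\<Sum>\<^sub>u exp (t S\<^sub>u) / Z\<^sub>n)\<close> is at most \<open>E \<Sum>\<^sub>u exp (t S\<^sub>u)\<close> times the harmonic moment of the
  population one generation shorter. A second moment bound for the process truncated at \<open>N \<le> C\<close>
  gives \<open>P(Z\<^sub>n small) \<le> 1 - c / n\<close>, and the \<open>2\<^sup>k\<close> independent subtrees present after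
  \<open>k = n div J\<close> generations turn this into a superexponentially small probability; hence the
  harmonic moment is at most \<open>exp (\<epsilon> n) / P\<^sub>n\<close>. Chernoff's inequality concludes.

  Lower bound: if \<open>Y\<close> counts only particles whose ancestors all have \<open>N \<le> C\<close>, then
  \<open>E (Y Z\<^sub>n) \<le> (1 + C n) P\<^sub>n E Y\<close>, so \<open>E (Y / Z\<^sub>n) \<ge> E Y / ((1 + C n) P\<^sub>n)\<close> by convexity, and \<open>E Y\<close> is
  estimated by tilting. Letting \<open>C\<close> grow costs nothing in the limit, because \<open>E |L\<^sub>1| < \<infinity>\<close> bounds the
  truncated logarithmic moments from below. This yields the rate \<open>\<Lambda>\<^sup>*\<close> itself, and
  \<open>\<Lambda>\<^sup>*\<close> is dominated by the conjugate of \<open>Lam_tilde\<close> because the linear pieces of the latter lie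
  below \<open>\<Lambda>\<close>.
\<close>

section \<open>Birkhoff's ergodic theorem\<close>

text \<open>One exceptional null set has to serve every Borel set A. Birkhoff's theorem is therefore
  invoked only at rational exponents and natural truncation levels, and everything that involves A
  is a deterministic statement about one sequence of laws \<open>e\<close>. Continuity of \<Lambda>,
  which follows from its differentiability, leads from rational to real exponents.

  The truncation N \<le> C is forced by the moments: with only 1 + \<delta> of them, the second
  moment of Z_n may be infinite. In a product of two population sums it is enough to cut one factor,
  which is why the lower bound can compare the cut count Y with the uncut Z_n. The cut is cheap
  because \<delta> and K are uniform: a single level C serves all generations, so a block of
  generations starting at k needs no ergodic average of its own.

  In the local lower estimate only the moment at the central tilt is truncated; the neighbouring
  tilts enter through upper bounds, where the truncation may be dropped. Hence the slopes are those
  of \<Lambda> itself and not of a truncated rate function.\<close>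

context
  fixes M :: "'b measure" and T :: "'b \<Rightarrow> 'b"
  assumes prob: "prob_space M" and T [measurable]: "T \<in> M \<rightarrow>\<^sub>M M" and preserving: "distr M M T = M"
begin

interpretation prob_space M by (rule prob)

lemma integral_preserving:
  fixes f :: "'b \<Rightarrow> real"
  assumes "f \<in> borel_measurable M"
  shows "(\<integral>x. f (T x) \<partial>M) = (\<integral>x. f x \<partial>M)"
  using integral_distr[OF T assms] preserving by simp

lemma integrable_preserving:
  fixes f :: "'b \<Rightarrow> real"
  assumes "integrable M f"
  shows "integrable M (\<lambda>x. f (T x))"
  using integrable_distr[OF T, of f] assms preserving by simp

lemma AE_preserving:
  assumes "AE x in M. P x"
  shows "AE x in M. P (T x)"
proof -
  have "AE x in distr M M T. P x" unfolding preserving by (rule assms)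
  then show ?thesis by (rule AE_distrD[OF T])
qed

lemma measurable_funpow [measurable]: "(T ^^ n) \<in> M \<rightarrow>\<^sub>M M"
proof (induction n)
  case (Suc n)
  have "T \<circ> (T ^^ n) \<in> M \<rightarrow>\<^sub>M M" using measurable_comp[OF Suc T] .
  then show ?case by (simp add: comp_def)
qed (simp add: id_def)

lemma AE_funpow_preserving:
  assumes "AE x in M. P x"
  shows "AE x in M. \<forall>n. P ((T ^^ n) x)"
proof -
  have "AE x in M. P ((T ^^ n) x)" for n
  proof (induction n)
    case (Suc n)
    from AE_preserving[OF this] show ?case by (simp add: funpow_Suc_right del: funpow.simps)
  qed (use assms in simp)
  then show ?thesis by (simp add: AE_all_countable)
qed

text \<open>This is the largest of the partial sums of orders 0 to n along the orbit. Peeling off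
  the first term rather than the last relates the value at \<open>x\<close> to the value at
  \<open>T x\<close>, as an invariance argument requires.\<close>

primrec max_sum :: "('b \<Rightarrow> real) \<Rightarrow> nat \<Rightarrow> 'b \<Rightarrow> real" where
  "max_sum f 0 x = 0"
| "max_sum f (Suc n) x = max 0 (f x + max_sum f n (T x))"

lemma max_sum_nonneg: "0 \<le> max_sum f n x"
  by (cases n) auto

lemma max_sum_mono_Suc: "max_sum f n x \<le> max_sum f (Suc n) x"
proof (induction n arbitrary: x)
  case (Suc n)
  from Suc[of "T x"] show ?case by simp
qed simp

lemma sum_le_max_sum: "(\<Sum>k<n. f ((T ^^ k) x)) \<le> max_sum f n x"
proof (induction n arbitrary: x)
  case (Suc n)
  have "(\<Sum>k<Suc n. f ((T ^^ k) x)) = f x + (\<Sum>k<n. f ((T ^^ k) (T x)))"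
    by (simp add: sum.lessThan_Suc_shift funpow_Suc_right del: funpow.simps sum.lessThan_Suc)
  with Suc[of "T x"] show ?case by simp
qed simp

lemma integrable_max_sum:
  assumes "integrable M f"
  shows "integrable M (max_sum f n)"
proof (induction n)
  case (Suc n)
  have "integrable M (\<lambda>x. max 0 (f x + max_sum f n (T x)))"
    using assms integrable_preserving[OF Suc] by (intro integrable_max) auto
  then show ?case by simp
qed simp

text \<open>
  On the invariant set where the partial sums are unbounded above,
  \<open>max_sum f (Suc n) x - max_sum f n (T x)\<close> tends to \<open>f x\<close>, while its integral is nonnegative.
\<close>

lemma AE_sums_bounded_above:
  fixes f :: "'b \<Rightarrow> real"
  assumes erg: "\<And>B. B \<in> sets M \<Longrightarrow> T -` B \<inter> space M = B \<Longrightarrow> measure M B = 0 \<or> measure M B = 1"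
    and f: "integrable M f" and neg: "(\<integral>x. f x \<partial>M) < 0"
  shows "AE x in M. \<exists>c. \<forall>n. (\<Sum>k<n. f ((T ^^ k) x)) \<le> c"
proof -
  note [measurable] = borel_measurable_integrable[OF f] borel_measurable_integrable[OF integrable_max_sum[OF f]]
  define E where "E = {x \<in> space M. \<forall>c::nat. \<exists>n. real c < max_sum f n x}"
  have E [measurable]: "E \<in> sets M" unfolding E_def by measurable
  \<comment> \<open>The maximum over n + 1 steps at \<open>x\<close> and the one over n steps at
    \<open>T x\<close> differ by at most |f x|, so unboundedness at one point is unboundedness at
    the other.\<close>
  have inv1: "T x \<in> E \<longleftrightarrow> x \<in> E" if x: "x \<in> space M" for x
  proof
    assume Tx: "T x \<in> E"
    show "x \<in> E"
      unfolding E_def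
    proof (safe intro!: x)
      fix c :: nat
      obtain d :: nat where d: "real c + \<bar>f x\<bar> < real d" using reals_Archimedean2 by blast
      from Tx obtain n where "real d < max_sum f n (T x)" unfolding E_def by auto
      then have "real c < max_sum f (Suc n) x" using d by auto
      then show "\<exists>n. real c < max_sum f n x" by blast
    qed
  next
    assume xE: "x \<in> E"
    have Tx: "T x \<in> space M" using x measurable_space[OF T] by auto
    show "T x \<in> E"
      unfolding E_def
    proof (safe intro!: Tx)
      fix c :: nat
      obtain d :: nat where d: "real c + \<bar>f x\<bar> < real d" using reals_Archimedean2 by blast
      from xE obtain n where n: "real d < max_sum f n x" unfolding E_def by auto
      then obtain m where m: "n = Suc m" by (cases n) auto
      have "real c < max_sum f m (T x)" using n d unfolding m by (auto simp: max_def split: if_splits)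
      then show "\<exists>n. real c < max_sum f n (T x)" by blast
    qed
  qed
  then have "T -` E \<inter> space M = E" unfolding E_def by auto
  with erg[OF E] have "measure M E = 0 \<or> measure M E = 1" by auto
  moreover have "measure M E \<noteq> 1"
  proof
    assume "measure M E = 1"
    then have AE_E: "AE x in M. x \<in> E" using AE_in_set_eq_1[OF E] by simp
    define d where "d n x = indicator E x * (max_sum f (Suc n) x - max_sum f n (T x))" for n x
    have lim: "(\<lambda>n. \<integral>x. d n x \<partial>M) \<longlonglongrightarrow> (\<integral>x. indicator E x * f x \<partial>M)"
    proof (rule integral_dominated_convergence[where w="\<lambda>x. \<bar>f x\<bar>"])
      show "AE x in M. (\<lambda>n. d n x) \<longlonglongrightarrow> indicator E x * f x"
      proof (rule AE_I2)
        fix x assume x: "x \<in> space M"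
        show "(\<lambda>n. d n x) \<longlonglongrightarrow> indicator E x * f x"
        proof (cases "x \<in> E")
          case True
          obtain c :: nat where c: "\<bar>f x\<bar> < real c" using reals_Archimedean2 by blast
          from True inv1[OF x] have "T x \<in> E" by simp
          then obtain n0 where n0: "real c < max_sum f n0 (T x)" unfolding E_def by auto
          \<comment> \<open>Beyond \<open>n0\<close> the maximum at \<open>T x\<close> exceeds |f
            x|, so the cut at 0 in the recursion is inactive and the difference equals
            \<open>f x\<close> exactly.\<close>
          have "d n x = indicator E x * f x" if "n \<ge> n0" for n
          proof -
            have "max_sum f n0 (T x) \<le> max_sum f n (T x)"
              using that max_sum_mono_Suc by (rule lift_Suc_mono_le[rotated])
            with n0 c show ?thesis by (simp add: d_def True)
          qed
          then show ?thesis
            by (intro tendsto_eventually) (auto simp: eventually_sequentially)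
        qed (simp add: d_def)
      qed
      show "AE x in M. norm (d n x) \<le> \<bar>f x\<bar>" for n
      proof (rule AE_I2)
        fix x
        show "norm (d n x) \<le> \<bar>f x\<bar>"
          using max_sum_nonneg[of f n "T x"] by (auto simp: d_def indicator_def max_def)
      qed
      show "integrable M (\<lambda>x. \<bar>f x\<bar>)" using f by auto
      show "d n \<in> borel_measurable M" for n unfolding d_def by measurable
    qed auto
    have "0 \<le> (\<integral>x. d n x \<partial>M)" for n
    proof -
      have i1: "integrable M (\<lambda>x. indicator E x * max_sum f k x)" for k
        using integrable_mult_indicator[OF E integrable_max_sum[OF f, of k]] by simp
      have i2: "integrable M (\<lambda>x. indicator E (T x) * max_sum f k (T x))" for k
        by (rule integrable_preserving[OF i1])
      \<comment> \<open>By invariance of \<open>E\<close> the indicator may be evaluated at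
        \<open>T x\<close>. Measure preservation then moves the second integral back to
        \<open>x\<close>, and monotonicity of \<open>max_sum\<close> in n gives the sign.\<close>
      have "(\<integral>x. d n x \<partial>M) = (\<integral>x. indicator E x * max_sum f (Suc n) x - indicator E (T x) * max_sum f n (T x) \<partial>M)"
        by (intro Bochner_Integration.integral_cong) (use inv1 in \<open>auto simp: d_def indicator_def\<close>)
      also have "\<dots> = (\<integral>x. indicator E x * max_sum f (Suc n) x \<partial>M) - (\<integral>x. indicator E (T x) * max_sum f n (T x) \<partial>M)"
        by (rule Bochner_Integration.integral_diff[OF i1 i2])
      also have "(\<integral>x. indicator E (T x) * max_sum f n (T x) \<partial>M) = (\<integral>x. indicator E x * max_sum f n x \<partial>M)"
        by (rule integral_preserving) measurable
      finally have eq: "(\<integral>x. d n x \<partial>M) = (\<integral>x. indicator E x * max_sum f (Suc n) x \<partial>M) - (\<integral>x. indicator E x * max_sum f n x \<partial>M)" .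
      have "(\<integral>x. indicator E x * max_sum f n x \<partial>M) \<le> (\<integral>x. indicator E x * max_sum f (Suc n) x \<partial>M)"
        by (intro integral_mono i1) (auto simp: indicator_def max_sum_mono_Suc simp del: max_sum.simps)
      with eq show ?thesis by simp
    qed
    then have "0 \<le> (\<integral>x. indicator E x * f x \<partial>M)"
      using lim by (intro LIMSEQ_le_const[OF lim]) auto
    also have "\<dots> = (\<integral>x. f x \<partial>M)"
      using AE_E by (intro integral_cong_AE) auto
    finally show False using neg by simp
  qed
  ultimately have "measure M E = 0" by simp
  then have "AE x in M. x \<notin> E" using E by (auto intro!: AE_not_in simp: null_sets_def emeasure_eq_measure)
  then show ?thesis
  proof (rule AE_mp, intro AE_I2 impI)
    fix x assume "x \<in> space M" "x \<notin> E"
    then obtain c :: nat where "\<And>n. max_sum f n x \<le> real c" unfolding E_def by (auto simp: not_less)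
    then show "\<exists>c. \<forall>n. (\<Sum>k<n. f ((T ^^ k) x)) \<le> c"
      by (intro exI[of _ "real c"] allI order_trans[OF sum_le_max_sum])
  qed
qed

text \<open>Subtracting the mean and a further 1 / (j + 1) makes the integral negative, so the
  centred sums are bounded above and their bound disappears after division by n. Countably many j
  keep a single null set.\<close>

lemma birkhoff_upper:
  fixes f :: "'b \<Rightarrow> real"
  assumes erg: "\<And>B. B \<in> sets M \<Longrightarrow> T -` B \<inter> space M = B \<Longrightarrow> measure M B = 0 \<or> measure M B = 1"
    and f: "integrable M f"
  shows "AE x in M. \<forall>e>0. \<forall>\<^sub>F n in sequentially. (\<Sum>k<n. f ((T ^^ k) x)) / real n < (\<integral>x. f x \<partial>M) + e"
proof -
  let ?I = "\<integral>x. f x \<partial>M"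
  have *: "AE x in M. \<exists>c. \<forall>n. (\<Sum>k<n. f ((T ^^ k) x) - ?I - 1 / real (Suc j)) \<le> c" for j :: nat
  proof (rule AE_sums_bounded_above[OF erg])
    show "integrable M (\<lambda>x. f x - ?I - 1 / real (Suc j))" using f by auto
    have "(\<integral>x. f x - ?I - 1 / real (Suc j) \<partial>M) = - (1 / real (Suc j))"
      using f by (simp add: prob_space)
    then show "(\<integral>x. f x - ?I - 1 / real (Suc j) \<partial>M) < 0" by simp
  qed
  have "AE x in M. \<forall>j::nat. \<exists>c. \<forall>n. (\<Sum>k<n. f ((T ^^ k) x) - ?I - 1 / real (Suc j)) \<le> c"
    unfolding AE_all_countable using * by blast
  then show ?thesis
  proof (rule AE_mp, intro AE_I2 impI allI)
    fix x and e :: real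
    assume b: "\<forall>j::nat. \<exists>c. \<forall>n. (\<Sum>k<n. f ((T ^^ k) x) - ?I - 1 / real (Suc j)) \<le> c" and e: "e > 0"
    obtain j where j: "1 / real (Suc j) < e / 2"
      using reals_Archimedean[of "e/2"] e by (auto simp: inverse_eq_divide)
    from b obtain c where c: "\<And>n. (\<Sum>k<n. f ((T ^^ k) x) - ?I - 1 / real (Suc j)) \<le> c" by blast
    obtain n0 :: nat where n0: "2 * \<bar>c\<bar> / e < real n0" using reals_Archimedean2 by blast
    have "(\<Sum>k<n. f ((T ^^ k) x)) / real n < ?I + e" if n: "n \<ge> Suc n0" for n
    proof -
      define q where "q = real n * (1 / real (Suc j))"
      have "(\<Sum>k<n. f ((T ^^ k) x)) - real n * ?I - q \<le> c"
        using c[of n] by (simp add: sum_subtractf q_def)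
      moreover have "q < real n * (e / 2)"
        unfolding q_def using n j by (intro mult_strict_left_mono) auto
      moreover have "c < real n * (e / 2)"
      proof -
        have "2 * \<bar>c\<bar> / e < real n" using n0 n by linarith
        then show ?thesis using e by (simp add: field_simps)
      qed
      moreover have "real n * (?I + e) = real n * ?I + real n * (e / 2) + real n * (e / 2)"
        by (simp add: algebra_simps)
      ultimately have "(\<Sum>k<n. f ((T ^^ k) x)) < real n * (?I + e)"
        by linarith
      then show ?thesis using n by (simp add: field_simps)
    qed
    then show "\<forall>\<^sub>F n in sequentially. (\<Sum>k<n. f ((T ^^ k) x)) / real n < ?I + e"
      unfolding eventually_sequentially by blast
  qed
qed

theorem birkhoff_ergodic:
  fixes f :: "'b \<Rightarrow> real"
  assumes erg: "\<And>B. B \<in> sets M \<Longrightarrow> T -` B \<inter> space M = B \<Longrightarrow> measure M B = 0 \<or> measure M B = 1"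
    and f: "integrable M f"
  shows "AE x in M. (\<lambda>n. (\<Sum>k<n. f ((T ^^ k) x)) / real n) \<longlonglongrightarrow> (\<integral>x. f x \<partial>M)"
proof -
  have g: "integrable M (\<lambda>x. - f x)" using f by simp
  have "AE x in M. \<forall>e>0. \<forall>\<^sub>F n in sequentially. (\<Sum>k<n. f ((T ^^ k) x)) / real n < (\<integral>x. f x \<partial>M) + e"
    by (rule birkhoff_upper[OF erg f])
  moreover have "AE x in M. \<forall>e>0. \<forall>\<^sub>F n in sequentially. (\<Sum>k<n. - f ((T ^^ k) x)) / real n < (\<integral>x. - f x \<partial>M) + e"
    by (rule birkhoff_upper[OF erg g])
  ultimately show ?thesis
  proof eventually_elim
    case (elim x)
    show ?case
    proof (rule order_tendstoI)
      fix a assume "a < (\<integral>x. f x \<partial>M)"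
      with elim(2)[rule_format, of "(\<integral>x. f x \<partial>M) - a"]
      show "\<forall>\<^sub>F n in sequentially. a < (\<Sum>k<n. f ((T ^^ k) x)) / real n"
        by (simp add: sum_negf)
    next
      fix a assume "(\<integral>x. f x \<partial>M) < a"
      with elim(1)[rule_format, of "a - (\<integral>x. f x \<partial>M)"]
      show "\<forall>\<^sub>F n in sequentially. (\<Sum>k<n. f ((T ^^ k) x)) / real n < a"
        by simp
    qed
  qed
qed

end

section \<open>Convex functions and integrals\<close>

text \<open>Slopes of a convex function increase, so every difference quotient with step at most 1
  is trapped between those with steps -1 and 1. This is the integrable majorant for differentiating
  under the integral.\<close>

lemma convex_slopes:
  fixes f :: "real \<Rightarrow> real"
  assumes f: "convex_on UNIV f" and h: "h \<noteq> 0" "\<bar>h\<bar> \<le> 1"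
  shows "f t - f (t - 1) \<le> (f (t + h) - f t) / h \<and> (f (t + h) - f t) / h \<le> f (t + 1) - f t"
proof -
  have c: "f ((1 - a) * x + a * y) \<le> (1 - a) * f x + a * f y" if "0 \<le> a" "a \<le> 1" for a x y
    using convex_onD[OF f that, of x y] by simp
  show ?thesis
  proof (cases "h > 0")
    case True
    have "f (t + h) \<le> (1 - h) * f t + h * f (t + 1)"
      using c[of h t "t + 1"] True h by (simp add: algebra_simps)
    \<comment> \<open>The point t is a convex combination of t - 1 and t + h; clearing the
      denominator 1 + h gives the left inequality.\<close>
    moreover have "f t \<le> (1 - 1 / (1 + h)) * f (t - 1) + 1 / (1 + h) * f (t + h)"
    proof -
      have "(1 - 1 / (1 + h)) * (t - 1) + 1 / (1 + h) * (t + h) = t"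
 
        using True by (simp add: divide_simps) (simp add: algebra_simps)
      with c[of "1 / (1 + h)" "t - 1" "t + h"] True show ?thesis by simp
    qed
    then have "(1 + h) * f t \<le> (1 + h) * ((1 - 1 / (1 + h)) * f (t - 1) + 1 / (1 + h) * f (t + h))"
      using True by (intro mult_left_mono) auto
    note le = this
    have "(1 + h) * (1 / (1 + h)) = 1" using True by simp
    then have "(1 + h) * ((1 - 1 / (1 + h)) * f (t - 1) + 1 / (1 + h) * f (t + h)) = h * f (t - 1) + f (t + h)"
      by algebra
    with le have "(1 + h) * f t \<le> h * f (t - 1) + f (t + h)" by simp
    ultimately show ?thesis using True by (simp add: field_simps)
  next
    case False
    with h have neg: "h < 0" by simp
    have "f (t + h) \<le> (1 + h) * f t + (- h) * f (t - 1)"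
      using c[of "-h" t "t - 1"] neg h by (simp add: algebra_simps)
    moreover have "f t \<le> (1 - 1 / (1 - h)) * f (t + 1) + 1 / (1 - h) * f (t + h)"
    proof -
      have "(1 - 1 / (1 - h)) * (t + 1) + 1 / (1 - h) * (t + h) = t"
        using neg by (simp add: divide_simps) (simp add: algebra_simps)
      with c[of "1 / (1 - h)" "t + 1" "t + h"] neg show ?thesis by simp
    qed
    then have "(1 - h) * f t \<le> (1 - h) * ((1 - 1 / (1 - h)) * f (t + 1) + 1 / (1 - h) * f (t + h))"
      using neg by (intro mult_left_mono) auto
    note le = this
    have "(1 - h) * (1 / (1 - h)) = 1" using neg by simp
    then have "(1 - h) * ((1 - 1 / (1 - h)) * f (t + 1) + 1 / (1 - h) * f (t + h)) = - h * f (t + 1) + f (t + h)"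
      by algebra
    with le have "(1 - h) * f t \<le> - h * f (t + 1) + f (t + h)" by simp
    ultimately show ?thesis using neg by (simp add: field_simps)
  qed
qed

text \<open>Convexity dominates all quotients with |h| \<le> 1 by the two unit increments, which are
  integrable, and dominated convergence applies along each sequence of steps tending to 0.\<close>

lemma convex_integral_has_real_derivative:
  fixes f :: "'b \<Rightarrow> real \<Rightarrow> real"
  assumes int: "\<And>t. integrable M (\<lambda>x. f x t)"
    and conv: "AE x in M. convex_on UNIV (f x)"
    and diff: "AE x in M. (f x has_real_derivative f' x) (at t)"
    and meas: "f' \<in> borel_measurable M"
  shows "((\<lambda>t. \<integral>x. f x t \<partial>M) has_real_derivative (\<integral>x. f' x \<partial>M)) (at t)"
proof -
  define w where "w x = \<bar>f x t - f x (t - 1)\<bar> + \<bar>f x (t + 1) - f x t\<bar>" for x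
  have "((\<lambda>h. \<integral>x. (f x (t + h) - f x t) / h \<partial>M) \<longlongrightarrow> (\<integral>x. f' x \<partial>M)) (at 0)"
  proof (subst tendsto_at_iff_sequentially, safe)
    fix h :: "nat \<Rightarrow> real"
    assume h0: "\<forall>i. h i \<in> UNIV - {0}" and h: "h \<longlonglongrightarrow> 0"
    from h have "\<forall>\<^sub>F i in sequentially. dist (h i) 0 < 1" by (rule tendstoD) simp
    then obtain N where N: "\<And>i. i \<ge> N \<Longrightarrow> \<bar>h i\<bar> \<le> 1"
      by (force simp: eventually_sequentially dist_real_def)
    have "(\<lambda>i. \<integral>x. (f x (t + h (i + N)) - f x t) / h (i + N) \<partial>M) \<longlonglongrightarrow> (\<integral>x. f' x \<partial>M)"
    proof (rule integral_dominated_convergence[where w=w])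
      show "integrable M w" unfolding w_def using int by (intro Bochner_Integration.integrable_add integrable_abs Bochner_Integration.integrable_diff)
      show "(\<lambda>x. (f x (t + h (i + N)) - f x t) / h (i + N)) \<in> borel_measurable M" for i
        using int by (intro borel_measurable_divide borel_measurable_diff borel_measurable_integrable) auto
      show "AE x in M. norm ((f x (t + h (i + N)) - f x t) / h (i + N)) \<le> w x" for i
        using conv
      proof eventually_elim
        case (elim x)
        show ?case
          using convex_slopes[OF elim, of "h (i + N)" t] h0 N[of "i + N"] unfolding w_def by auto
      qed
      show "AE x in M. (\<lambda>i. (f x (t + h (i + N)) - f x t) / h (i + N)) \<longlonglongrightarrow> f' x"
        using diff
      proof eventually_elim
        case (elim x)
        then have "((\<lambda>h. (f x (t + h) - f x t) / h) \<longlongrightarrow> f' x) (at 0)"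
          by (simp add: DERIV_def)
        then have "(\<lambda>i. (f x (t + h i) - f x t) / h i) \<longlonglongrightarrow> f' x"
          using h0 h by (auto simp: tendsto_at_iff_sequentially comp_def)
        then show ?case by (rule LIMSEQ_ignore_initial_segment)
      qed
    qed (fact meas)
    then have "(\<lambda>i. \<integral>x. (f x (t + h i) - f x t) / h i \<partial>M) \<longlonglongrightarrow> (\<integral>x. f' x \<partial>M)"
      by (rule LIMSEQ_offset)
    then show "((\<lambda>h. \<integral>x. (f x (t + h) - f x t) / h \<partial>M) \<circ> h) \<longlonglongrightarrow> (\<integral>x. f' x \<partial>M)"
      by (simp add: comp_def)
  qed
  moreover have "(\<integral>x. (f x (t + h) - f x t) / h \<partial>M) = ((\<integral>x. f x (t + h) \<partial>M) - (\<integral>x. f x t \<partial>M)) / h" for h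
    using int by (subst Bochner_Integration.integral_diff[symmetric]) auto
  ultimately show ?thesis by (simp only: DERIV_def)
qed

lemma convex_on_integral:
  fixes f :: "'b \<Rightarrow> real \<Rightarrow> real"
  assumes int: "\<And>t. integrable M (\<lambda>x. f x t)"
    and conv: "AE x in M. convex_on UNIV (f x)"
  shows "convex_on UNIV (\<lambda>t. \<integral>x. f x t \<partial>M)"
proof (rule convex_onI)
  fix a x y :: real assume a: "0 < a" "a < 1"
  have "(\<integral>z. f z ((1 - a) *\<^sub>R x + a *\<^sub>R y) \<partial>M) \<le> (\<integral>z. (1 - a) * f z x + a * f z y \<partial>M)"
  proof (rule integral_mono_AE[OF int])
    show "integrable M (\<lambda>z. (1 - a) * f z x + a * f z y)" using int by auto
    show "AE z in M. f z ((1 - a) *\<^sub>R x + a *\<^sub>R y) \<le> (1 - a) * f z x + a * f z y"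
      using conv by eventually_elim (use a in \<open>auto dest!: convex_onD[of UNIV _ a x y]\<close>)
  qed
  also have "\<dots> = (1 - a) * (\<integral>z. f z x \<partial>M) + a * (\<integral>z. f z y \<partial>M)" using int by simp
  finally show "(\<integral>z. f z ((1 - a) *\<^sub>R x + a *\<^sub>R y) \<partial>M) \<le> (1 - a) * (\<integral>z. f z x \<partial>M) + a * (\<integral>z. f z y \<partial>M)" .
qed simp

lemma convex_on_above_tangent:
  fixes f :: "real \<Rightarrow> real"
  assumes f: "convex_on UNIV f" and D: "(f has_real_derivative D) (at t)"
  shows "f t + D * (s - t) \<le> f s"
proof (cases "s = t")
  case False
  have lim: "((\<lambda>h. (f (t + h * (s - t)) - f t) / h) \<longlongrightarrow> D * (s - t)) (at_right 0)"
  proof -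
    have "((\<lambda>h. f (t + h * (s - t))) has_real_derivative D * (s - t)) (at 0)"
      by (rule DERIV_chain2[where g="\<lambda>h. t + h * (s - t)"]) (use D in \<open>auto intro!: derivative_eq_intros\<close>)
    then show ?thesis by (simp add: DERIV_def filterlim_at_split)
  qed
  have "\<forall>\<^sub>F h in at_right 0. (f (t + h * (s - t)) - f t) / h \<le> f s - f t"
    unfolding eventually_at_right_field
  proof (intro exI[of _ 1] conjI allI impI)
    fix h :: real assume h: "0 < h" "h < 1"
    have "t + h * (s - t) = (1 - h) *\<^sub>R t + h *\<^sub>R s" by (simp add: algebra_simps)
    then have "f (t + h * (s - t)) \<le> (1 - h) * f t + h * f s"
      using convex_onD[OF f, of h t s] h by simp
    then show "(f (t + h * (s - t)) - f t) / h \<le> f s - f t" using h by (simp add: field_simps)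
  qed simp
  from tendsto_upperbound[OF lim this] show ?thesis by simp
qed simp

section \<open>Decomposition of the tree at the root\<close>

text \<open>Only the sequence of laws of successive generations matters, not the environment that
  produced it. The subtrees of the root then fall under the same notion, with the sequence shifted
  by one.\<close>

definition offspring_laws :: "(nat \<Rightarrow> offspring measure) \<Rightarrow> bool" where
  "offspring_laws e \<longleftrightarrow> (\<forall>n. prob_space (e n) \<and> sets (e n) = sets offspring_space)"

definition tree_law :: "(nat \<Rightarrow> offspring measure) \<Rightarrow> marked_tree measure" where
  "tree_law e = PiM UNIV (\<lambda>u. e (length u))"

text \<open>The forest supplies a tree for every label, also for those of unborn children. It is
  therefore independent of the root mark, and the number of children only decides how many of the
  trees are looked at.\<close>

definition graft :: "offspring \<Rightarrow> (nat \<Rightarrow> marked_tree) \<Rightarrow> marked_tree" where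
  "graft x \<psi> u = (case u of [] \<Rightarrow> x | i # v \<Rightarrow> \<psi> i v)"

definition forest_law :: "(nat \<Rightarrow> offspring measure) \<Rightarrow> (nat \<Rightarrow> marked_tree) measure" where
  "forest_law e = PiM UNIV (\<lambda>_. tree_law e)"

abbreviation forest_space :: "(nat \<Rightarrow> marked_tree) measure" where
  "forest_space \<equiv> PiM UNIV (\<lambda>_. tree_space)"

lemma graft_simps [simp]: "graft x \<psi> [] = x" "graft x \<psi> (i # v) = \<psi> i v"
  by (auto simp: graft_def)

lemma offspring_laws_Suc: "offspring_laws e \<Longrightarrow> offspring_laws (\<lambda>n. e (Suc n))"
  by (simp add: offspring_laws_def)

lemma offspring_laws_prob: "offspring_laws e \<Longrightarrow> prob_space (e n)"
  and offspring_laws_sets: "offspring_laws e \<Longrightarrow> sets (e n) = sets offspring_space"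
  by (simp_all add: offspring_laws_def)

lemma sets_tree_law: "offspring_laws e \<Longrightarrow> sets (tree_law e) = sets tree_space"
  by (auto simp: tree_law_def tree_space_def offspring_laws_def intro!: sets_PiM_cong)

lemma prob_space_tree_law: "offspring_laws e \<Longrightarrow> prob_space (tree_law e)"
  by (auto simp: tree_law_def offspring_laws_def intro!: prob_space_PiM)

lemma sets_forest_law: "offspring_laws e \<Longrightarrow> sets (forest_law e) = sets forest_space"
  using sets_tree_law by (auto simp: forest_law_def intro!: sets_PiM_cong)

lemma prob_space_forest_law: "offspring_laws e \<Longrightarrow> prob_space (forest_law e)"
  using prob_space_tree_law by (auto simp: forest_law_def intro!: prob_space_PiM)

lemma space_offspring_space [simp]: "space offspring_space = UNIV"
  by (auto simp: offspring_space_def space_pair_measure space_PiM)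

lemma space_tree_space [simp]: "space tree_space = UNIV"
  by (auto simp: tree_space_def space_PiM)

lemma measurable_eval_tree [measurable]: "(\<lambda>\<omega>. \<omega> u) \<in> tree_space \<rightarrow>\<^sub>M offspring_space"
  unfolding tree_space_def by measurable

lemma measurable_fst_offspring [measurable]: "fst \<in> offspring_space \<rightarrow>\<^sub>M count_space UNIV"
  unfolding offspring_space_def by measurable

lemma measurable_snd_offspring [measurable]: "(\<lambda>x. snd x i) \<in> borel_measurable offspring_space"
  unfolding offspring_space_def by measurable

lemma measurable_subtree: "(\<lambda>\<omega> u. \<omega> (i # u)) \<in> tree_space \<rightarrow>\<^sub>M tree_space"
  unfolding tree_space_def by (rule measurable_PiM_single') (auto simp: space_PiM)

lemma measurable_graft [measurable]:
  "(\<lambda>(x, \<psi>). graft x \<psi>) \<in> offspring_space \<Otimes>\<^sub>M forest_space \<rightarrow>\<^sub>M tree_space"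
proof -
  have "(\<lambda>z. (case z of (x, \<psi>) \<Rightarrow> graft x \<psi>) u) \<in> offspring_space \<Otimes>\<^sub>M forest_space \<rightarrow>\<^sub>M offspring_space" for u
  proof (cases u)
    case Nil
    then show ?thesis by (simp add: split_beta')
  next
    case (Cons i v)
    have "(\<lambda>\<psi>. \<psi> i) \<in> forest_space \<rightarrow>\<^sub>M tree_space"
      by (rule measurable_component_singleton) simp
    from measurable_compose[OF measurable_compose[OF measurable_snd this] measurable_eval_tree]
    show ?thesis by (simp add: split_beta' Cons)
  qed
  then have "(\<lambda>(x, \<psi>). graft x \<psi>) \<in> offspring_space \<Otimes>\<^sub>M forest_space \<rightarrow>\<^sub>M PiM UNIV (\<lambda>_. offspring_space)"
    by (intro measurable_PiM_single') (simp_all only: space_offspring_space PiE_UNIV UNIV_I Pi_I)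
  then show ?thesis by (simp only: tree_space_def)
qed

text \<open>Both sides agree on cylinders. A finite set of words splits into the root and, for each
  first letter \<open>i\<close>, the finite set \<open>K i\<close> of remainders; the image law
  factorizes along this splitting and the factors are reassembled word by word.\<close>

lemma tree_law_graft:
  assumes e: "offspring_laws e"
  shows "tree_law e = distr (e 0 \<Otimes>\<^sub>M forest_law (\<lambda>n. e (Suc n))) tree_space (\<lambda>(x, \<psi>). graft x \<psi>)"
    (is "_ = distr (_ \<Otimes>\<^sub>M ?F) _ ?g")
proof -
  let ?T = "tree_law (\<lambda>n. e (Suc n))"
  note [measurable_cong] = offspring_laws_sets[OF e] sets_forest_law[OF offspring_laws_Suc[OF e]]
  interpret e: prob_space "e n" for n by (rule offspring_laws_prob[OF e])
  interpret T: prob_space ?T by (rule prob_space_tree_law[OF offspring_laws_Suc[OF e]])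
  interpret F: prob_space ?F by (rule prob_space_forest_law[OF offspring_laws_Suc[OF e]])
  interpret P: pair_prob_space "e 0" ?F ..
  interpret PT: product_prob_space "\<lambda>u. e (length u)" UNIV ..
  interpret PT': product_prob_space "\<lambda>u. e (Suc (length u))" UNIV ..
  interpret PF: product_prob_space "\<lambda>_::nat. ?T" UNIV ..
  have g [measurable]: "?g \<in> e 0 \<Otimes>\<^sub>M ?F \<rightarrow>\<^sub>M tree_space" by measurable
  have "distr (e 0 \<Otimes>\<^sub>M ?F) tree_space ?g = PiM UNIV (\<lambda>u. e (length u))"
  proof (rule PT.PiM_eq)
    show "sets (distr (e 0 \<Otimes>\<^sub>M ?F) tree_space ?g) = sets (PiM UNIV (\<lambda>u. e (length u)))"
      using sets_tree_law[OF e] by (simp add: tree_law_def)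
  next
    fix J :: "nat list set" and A :: "nat list \<Rightarrow> offspring set"
    assume J: "finite J" and A: "\<And>u. u \<in> J \<Longrightarrow> A u \<in> sets (e (length u))"
    \<comment> \<open>With the default UNIV outside \<open>J\<close> the root factor is 1 when the
      empty word is unconstrained.\<close>
    define B where "B u = (if u \<in> J then A u else UNIV)" for u
    have B [measurable]: "B u \<in> sets offspring_space" for u
      using A[of u] offspring_laws_sets[OF e] sets.top[of offspring_space] by (auto simp: B_def)
    define I where "I = hd ` (J - {[]})"
    define K where "K i = {v. i # v \<in> J}" for i
    have fin: "finite I" "finite (K i)" for i
      unfolding I_def K_def using J by (auto intro: finite_subset[OF _ finite_imageI[of J tl]] simp: image_iff intro!: finite_vimageI[of J "(#) i", unfolded vimage_def])
    define C where "C i = {\<omega> \<in> space tree_space. \<forall>v\<in>K i. \<omega> v \<in> B (i # v)}" for i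
    have C [measurable]: "C i \<in> sets tree_space" for i
      unfolding C_def using fin by measurable
    have preim: "?g -` prod_emb UNIV (\<lambda>u. e (length u)) J (Pi\<^sub>E J A) \<inter> space (e 0 \<Otimes>\<^sub>M ?F)
      = B [] \<times> {\<psi> \<in> space ?F. \<forall>i\<in>I. \<psi> i \<in> C i}"
    proof -
      have spe: "space (e n) = UNIV" for n
        using sets_eq_imp_space_eq[OF offspring_laws_sets[OF e]] by simp
      have spF: "space ?F = UNIV"
        using sets_eq_imp_space_eq[OF sets_forest_law[OF offspring_laws_Suc[OF e]]] by (simp add: space_PiM)
      have "(\<forall>u\<in>J. graft x \<psi> u \<in> A u) \<longleftrightarrow> x \<in> B [] \<and> (\<forall>i\<in>I. \<forall>v\<in>K i. \<psi> i v \<in> B (i # v))" (is "?l \<longleftrightarrow> ?r") for x \<psi>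
      proof
        assume ?l
        then show ?r by (force simp: B_def K_def)
      next
        assume r: ?r
        show ?l
        proof
          fix u assume u: "u \<in> J"
          show "graft x \<psi> u \<in> A u"
          proof (cases u)
            case Nil
            with r u show ?thesis by (auto simp: B_def)
          next
            case (Cons i v)
            with u have "i \<in> I" "v \<in> K i" unfolding I_def K_def by (force, simp)
            with r have "\<psi> i v \<in> B (i # v)" by blast
            with u Cons show ?thesis by (simp add: B_def)
          qed
        qed
      qed
      then show ?thesis
        by (auto simp: prod_emb_def space_pair_measure spe spF PiE_iff C_def split_beta' Pi_iff)
    qed
    have "emeasure (distr (e 0 \<Otimes>\<^sub>M ?F) tree_space ?g) (prod_emb UNIV (\<lambda>u. e (length u)) J (Pi\<^sub>E J A))
        = emeasure (e 0 \<Otimes>\<^sub>M ?F) (B [] \<times> {\<psi> \<in> space ?F. \<forall>i\<in>I. \<psi> i \<in> C i})"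
    proof (subst emeasure_distr[OF g])
      have "prod_emb UNIV (\<lambda>u. e (length u)) J (Pi\<^sub>E J A) \<in> sets (tree_law e)"
        unfolding tree_law_def using J A by (intro sets_PiM_I) auto
      then show "prod_emb UNIV (\<lambda>u. e (length u)) J (Pi\<^sub>E J A) \<in> sets tree_space"
        using sets_tree_law[OF e] by simp
    qed (simp only: preim)
    also have "\<dots> = emeasure (e 0) (B []) * emeasure ?F {\<psi> \<in> space ?F. \<forall>i\<in>I. \<psi> i \<in> C i}"
    proof (rule F.emeasure_pair_measure_Times)
      show "B [] \<in> sets (e 0)" using B offspring_laws_sets[OF e] by simp
      show "{\<psi> \<in> space ?F. \<forall>i\<in>I. \<psi> i \<in> C i} \<in> sets ?F"
      proof -
        have "{\<psi> \<in> space forest_space. \<forall>i\<in>I. \<psi> i \<in> C i} \<in> sets forest_space" using fin by measurable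
        then show ?thesis
          using sets_forest_law[OF offspring_laws_Suc[OF e]] sets_eq_imp_space_eq[OF sets_forest_law[OF offspring_laws_Suc[OF e]]] by simp
      qed
    qed
    also have "emeasure ?F {\<psi> \<in> space ?F. \<forall>i\<in>I. \<psi> i \<in> C i} = (\<Prod>i\<in>I. emeasure ?T (C i))"
      unfolding forest_law_def using fin C sets_tree_law[OF offspring_laws_Suc[OF e]]
      by (subst PF.emeasure_PiM_Collect) auto
    also have "\<dots> = (\<Prod>i\<in>I. \<Prod>v\<in>K i. emeasure (e (Suc (length v))) (B (i # v)))"
    proof (rule prod.cong[OF refl])
      fix i
      have sp: "space tree_space = space (PiM UNIV (\<lambda>u. e (Suc (length u))))"
        using sets_eq_imp_space_eq[OF sets_tree_law[OF offspring_laws_Suc[OF e]]] by (simp add: tree_law_def)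
      show "emeasure ?T (C i) = (\<Prod>v\<in>K i. emeasure (e (Suc (length v))) (B (i # v)))"
        unfolding tree_law_def C_def sp using fin B offspring_laws_sets[OF e]
        by (subst PT'.emeasure_PiM_Collect) auto
    qed
    also have "\<dots> = (\<Prod>(i, v)\<in>Sigma I K. emeasure (e (Suc (length v))) (B (i # v)))"
      using fin by (subst prod.Sigma) auto
    also have "\<dots> = (\<Prod>u\<in>J - {[]}. emeasure (e (length u)) (B u))"
    proof -
      have "bij_betw (\<lambda>(i, v). i # v) (Sigma I K) (J - {[]})"
      proof (rule bij_betwI'[rule_format])
        fix u assume u: "u \<in> J - {[]}"
        then obtain i v where iv: "u = i # v" by (cases u) auto
        have "i \<in> I" unfolding I_def using u iv by (intro image_eqI[of _ _ u]) auto
        with u iv show "\<exists>z\<in>Sigma I K. u = (case z of (i, v) \<Rightarrow> i # v)"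
          by (intro bexI[of _ "(i, v)"]) (auto simp: K_def)
      qed (auto simp: K_def)
      from prod.reindex_bij_betw[OF this, of "\<lambda>u. emeasure (e (length u)) (B u)"]
      show ?thesis by (simp add: split_beta')
    qed
    also have "emeasure (e 0) (B []) * (\<Prod>u\<in>J - {[]}. emeasure (e (length u)) (B u)) = (\<Prod>u\<in>J. emeasure (e (length u)) (A u))"
    proof -
      have eq: "(\<Prod>u\<in>J - {[]}. emeasure (e (length u)) (B u)) = (\<Prod>u\<in>J - {[]}. emeasure (e (length u)) (A u))"
        by (intro prod.cong) (auto simp: B_def)
      have 1: "emeasure (e 0) UNIV = 1"
        using e.emeasure_space_1[of 0] sets_eq_imp_space_eq[OF offspring_laws_sets[OF e]] by simp
      show ?thesis
      proof (cases "[] \<in> J")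
        case True
        then show ?thesis using J unfolding eq by (subst prod.remove[of J "[]"]) (auto simp: B_def)
      next
        case False
        then show ?thesis unfolding eq by (simp add: B_def 1)
      qed
    qed
    finally show "emeasure (distr (e 0 \<Otimes>\<^sub>M ?F) tree_space ?g) (prod_emb UNIV (\<lambda>u. e (length u)) J (Pi\<^sub>E J A))
      = (\<Prod>u\<in>J. emeasure (e (length u)) (A u))" .
  qed
  then show ?thesis by (simp add: tree_law_def)
qed

lemma nn_integral_tree_law:
  assumes e: "offspring_laws e" and F: "F \<in> borel_measurable tree_space"
  shows "(\<integral>\<^sup>+\<omega>. F \<omega> \<partial>tree_law e)
    = (\<integral>\<^sup>+x. \<integral>\<^sup>+\<psi>. F (graft x \<psi>) \<partial>forest_law (\<lambda>n. e (Suc n)) \<partial>e 0)"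
proof -
  let ?F = "forest_law (\<lambda>n. e (Suc n))"
  note [measurable_cong] = offspring_laws_sets[OF e] sets_forest_law[OF offspring_laws_Suc[OF e]]
  note [measurable] = F
  interpret F: prob_space ?F by (rule prob_space_forest_law[OF offspring_laws_Suc[OF e]])
  have "(\<integral>\<^sup>+\<omega>. F \<omega> \<partial>tree_law e) = (\<integral>\<^sup>+z. F (case z of (x, \<psi>) \<Rightarrow> graft x \<psi>) \<partial>(e 0 \<Otimes>\<^sub>M ?F))"
    by (subst tree_law_graft[OF e], subst nn_integral_distr) (use F in measurable)
  also have "\<dots> = (\<integral>\<^sup>+x. \<integral>\<^sup>+\<psi>. F (graft x \<psi>) \<partial>?F \<partial>e 0)"
    by (subst F.nn_integral_fst[symmetric]) auto
  finally show ?thesis .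
qed

lemma nn_integral_forest_component:
  assumes e: "offspring_laws e" and f: "f \<in> borel_measurable tree_space"
  shows "(\<integral>\<^sup>+\<psi>. f (\<psi> i) \<partial>forest_law e) = (\<integral>\<^sup>+\<omega>. f \<omega> \<partial>tree_law e)"
proof -
  have d: "distr (forest_law e) (tree_law e) (\<lambda>\<psi>. \<psi> i) = tree_law e"
    unfolding forest_law_def by (rule distr_PiM_component) (auto simp: prob_space_tree_law[OF e])
  have m: "(\<lambda>\<psi>. \<psi> i) \<in> forest_law e \<rightarrow>\<^sub>M tree_law e"
    unfolding forest_law_def by measurable
  have "f \<in> borel_measurable (tree_law e)" using f measurable_cong_sets[OF sets_tree_law[OF e] refl] by blast
  with nn_integral_distr[OF m, of f] show ?thesis unfolding d by simp
qed

lemma nn_integral_forest_independent: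
  fixes f g :: "marked_tree \<Rightarrow> ennreal"
  assumes e: "offspring_laws e" and f: "f \<in> borel_measurable tree_space" and g: "g \<in> borel_measurable tree_space"
    and ij: "i \<noteq> j"
  shows "(\<integral>\<^sup>+\<psi>. f (\<psi> i) * g (\<psi> j) \<partial>forest_law e) = (\<integral>\<^sup>+\<omega>. f \<omega> \<partial>tree_law e) * (\<integral>\<^sup>+\<omega>. g \<omega> \<partial>tree_law e)"
proof -
  let ?T = "tree_law e"
  note m = measurable_cong_sets[OF sets_tree_law[OF e] refl]
  have [measurable]: "f \<in> borel_measurable ?T" "g \<in> borel_measurable ?T" using f g m by blast+
  interpret T: prob_space ?T by (rule prob_space_tree_law[OF e])
  interpret PF: product_prob_space "\<lambda>_::nat. ?T" UNIV ..
  have fm: "PiM {i, j} (\<lambda>_. ?T) = distr (forest_law e) (PiM {i, j} (\<lambda>_. ?T)) (\<lambda>\<psi>. restrict \<psi> {i, j})"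
    unfolding forest_law_def by (rule PF.distr_PiM_restrict_finite[symmetric]) auto
  have "(\<integral>\<^sup>+\<psi>. f (\<psi> i) * g (\<psi> j) \<partial>PiM {i, j} (\<lambda>_. ?T)) = (\<integral>\<^sup>+\<psi>. f (\<psi> i) * g (\<psi> j) \<partial>forest_law e)"
    by (subst fm, subst nn_integral_distr) (auto simp: forest_law_def intro!: measurable_restrict_subset)
  moreover have "(\<integral>\<^sup>+\<psi>. (\<Prod>k\<in>{i, j}. (if k = i then f else g) (\<psi> k)) \<partial>PiM {i, j} (\<lambda>_. ?T))
     = (\<Prod>k\<in>{i, j}. \<integral>\<^sup>+\<omega>. (if k = i then f else g) \<omega> \<partial>?T)"
    by (rule PF.product_nn_integral_prod) auto
  ultimately show ?thesis using ij by simp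
qed

section \<open>Weighted population sums\<close>

text \<open>The sum of \<open>h\<close> over the positions of generation n, for a root placed at y,
  restricted to particles all of whose proper ancestors have offspring number in \<open>G\<close>.
  The recursion is at the root, to match \<open>graft\<close>, and y is an argument because subtrees
  start at displaced positions. Values in ennreal spare all integrability conditions.\<close>

primrec weight :: "nat set \<Rightarrow> (real \<Rightarrow> ennreal) \<Rightarrow> nat \<Rightarrow> real \<Rightarrow> marked_tree \<Rightarrow> ennreal" where
  "weight G h 0 y \<omega> = h y"
| "weight G h (Suc n) y \<omega> = (if fst (\<omega> []) \<in> G
     then \<Sum>i<fst (\<omega> []). weight G h n (y + snd (\<omega> []) i) (\<lambda>u. \<omega> (i # u)) else 0)"

abbreviation pop :: "nat \<Rightarrow> marked_tree \<Rightarrow> ennreal" where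
  "pop n \<equiv> weight UNIV (\<lambda>_. 1) n 0"

text \<open>For \<open>G = UNIV\<close> this is the quenched m_0(t) of a generation with law \<nu>,
  and at t = 0 its mean offspring number.\<close>

definition mom :: "offspring measure \<Rightarrow> nat set \<Rightarrow> real \<Rightarrow> ennreal" where
  "mom \<nu> G t = (\<integral>\<^sup>+x. (if fst x \<in> G then \<Sum>i<fst x. ennreal (exp (t * snd x i)) else 0) \<partial>\<nu>)"

abbreviation log_mom :: "offspring measure \<Rightarrow> nat set \<Rightarrow> real \<Rightarrow> real" where
  "log_mom \<nu> G t \<equiv> ln (enn2real (mom \<nu> G t))"

lemma weight_graft [simp]:
  "weight G h (Suc n) y (graft x \<psi>)
    = (if fst x \<in> G then \<Sum>i<fst x. weight G h n (y + snd x i) (\<psi> i) else 0)"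
  by (simp add: eta_contract_eq)

declare weight.simps(2) [simp del]

lemma measurable_random_sum:
  fixes f :: "nat \<Rightarrow> 'b \<Rightarrow> ennreal"
  assumes "\<And>i. f i \<in> borel_measurable M" and "N \<in> M \<rightarrow>\<^sub>M count_space UNIV"
  shows "(\<lambda>x. \<Sum>i<N x. f i x) \<in> borel_measurable M"
  by (rule measurable_compose_countable[OF _ assms(2), of "\<lambda>n x. \<Sum>i<n. f i x"])
     (use assms(1) in measurable)

lemma measurable_weight_pair:
  assumes h: "h \<in> borel_measurable borel"
  shows "(\<lambda>(y, \<omega>). weight G h n y \<omega>) \<in> borel_measurable (borel \<Otimes>\<^sub>M tree_space)"
proof (induction n)
  case 0
  then show ?case using h by (simp add: split_beta')
next
  case (Suc n)
  have eval: "(\<lambda>z. snd z []) \<in> borel \<Otimes>\<^sub>M tree_space \<rightarrow>\<^sub>M offspring_space"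
    by (rule measurable_compose[OF measurable_snd measurable_eval_tree])
  note displ = measurable_compose[OF eval measurable_snd_offspring]
    and num [measurable] = measurable_compose[OF eval measurable_fst_offspring]
  have "(\<lambda>z. weight G h n (fst z + snd (snd z []) i) (\<lambda>u. snd z (i # u))) \<in> borel_measurable (borel \<Otimes>\<^sub>M tree_space)" for i
    using measurable_compose[OF measurable_Pair[OF borel_measurable_add[OF measurable_fst displ]
          measurable_compose[OF measurable_snd measurable_subtree]] Suc, of i i]
    by simp
  from measurable_random_sum[OF this, of "\<lambda>z. fst (snd z [])"]
  have "(\<lambda>z. \<Sum>i<fst (snd z []). weight G h n (fst z + snd (snd z []) i) (\<lambda>u. snd z (i # u))) \<in> borel_measurable (borel \<Otimes>\<^sub>M tree_space)"
    using num by simp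
  moreover have "{z \<in> space (borel \<Otimes>\<^sub>M tree_space). fst (snd z []) \<in> G} \<in> sets (borel \<Otimes>\<^sub>M tree_space)"
    by (rule measurable_sets_Collect[OF num]) simp
  ultimately show ?case
    unfolding split_beta' weight.simps by (intro measurable_If) simp_all
qed

lemma measurable_weight':
  assumes "h \<in> borel_measurable borel" "f \<in> M \<rightarrow>\<^sub>M borel" "g \<in> M \<rightarrow>\<^sub>M tree_space"
  shows "(\<lambda>x. weight G h n (f x) (g x)) \<in> borel_measurable M"
  using measurable_compose[OF measurable_Pair[OF assms(2,3)] measurable_weight_pair[OF assms(1)]] by simp

lemma measurable_weight [measurable]:
  assumes "h \<in> borel_measurable borel"
  shows "weight G h n y \<in> borel_measurable tree_space"
  using measurable_weight'[OF assms measurable_const measurable_ident] by simp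

lemma weight_mono_set: "G \<subseteq> G' \<Longrightarrow> weight G h n y \<omega> \<le> weight G' h n y \<omega>"
proof (induction n arbitrary: y \<omega>)
  case (Suc n)
  then show ?case by (auto simp: weight.simps intro!: sum_mono)
qed simp

lemma weight_mono: "(\<And>y. h y \<le> h' y) \<Longrightarrow> weight G h n y \<omega> \<le> weight G h' n y \<omega>"
  by (induction n arbitrary: y \<omega>) (auto simp: weight.simps intro!: sum_mono)

lemma weight_const: "weight G (\<lambda>_. c) n y \<omega> = weight G (\<lambda>_. c) n 0 \<omega>"
proof (induction n arbitrary: y \<omega>)
  case (Suc n)
  show ?case unfolding weight.simps using Suc[of "_ + _"] by (metis (no_types, lifting) sum.cong)
qed simp

lemma measurable_mom_integrand [measurable]:
  "(\<lambda>x. if fst x \<in> G then \<Sum>i<fst x. ennreal (exp (t * snd x i)) else 0) \<in> borel_measurable offspring_space"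
proof -
  have "(\<lambda>x. \<Sum>i<fst x. ennreal (exp (t * snd x i))) \<in> borel_measurable offspring_space"
    by (rule measurable_random_sum) measurable
  then show ?thesis by measurable
qed

lemma measurable_offspring_laws:
  assumes "offspring_laws e" and "f \<in> offspring_space \<rightarrow>\<^sub>M N"
  shows "f \<in> e n \<rightarrow>\<^sub>M N"
  using assms(2) measurable_cong_sets[OF offspring_laws_sets[OF assms(1)] refl] by blast

lemma nn_integral_weight_Suc:
  assumes e: "offspring_laws e" and h [measurable]: "h \<in> borel_measurable borel"
  shows "(\<integral>\<^sup>+\<omega>. weight G h (Suc n) y \<omega> \<partial>tree_law e)
    = (\<integral>\<^sup>+x. (if fst x \<in> G then \<Sum>i<fst x. \<integral>\<^sup>+\<omega>. weight G h n (y + snd x i) \<omega> \<partial>tree_law (\<lambda>n. e (Suc n)) else 0) \<partial>e 0)"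
proof -
  note e' = offspring_laws_Suc[OF e]
  note [measurable_cong] = sets_forest_law[OF e']
  have "(\<integral>\<^sup>+\<psi>. weight G h (Suc n) y (graft x \<psi>) \<partial>forest_law (\<lambda>n. e (Suc n)))
     = (if fst x \<in> G then \<Sum>i<fst x. \<integral>\<^sup>+\<omega>. weight G h n (y + snd x i) \<omega> \<partial>tree_law (\<lambda>n. e (Suc n)) else 0)" for x
    using nn_integral_forest_component[OF e' measurable_weight[OF h]]
    by (simp add: nn_integral_sum)
  then show ?thesis by (simp add: nn_integral_tree_law[OF e])
qed

text \<open>Exponentials turn displacements into factors, so every generation contributes its own
  moment, also under truncation. This is the convolution structure of the mean measure.\<close>

lemma nn_integral_weight_exp:
  assumes "offspring_laws e"
  shows "(\<integral>\<^sup>+\<omega>. weight G (\<lambda>y. ennreal (exp (t * y))) n y \<omega> \<partial>tree_law e)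
    = ennreal (exp (t * y)) * (\<Prod>k<n. mom (e k) G t)"
  using assms
proof (induction n arbitrary: e y)
  case 0
  interpret prob_space "tree_law e" by (rule prob_space_tree_law[OF 0])
  show ?case by (simp add: emeasure_space_1)
next
  case (Suc n)
  note [measurable_cong] = offspring_laws_sets[OF Suc.prems]
  let ?P = "\<Prod>k<n. mom (e (Suc k)) G t"
  have "(\<integral>\<^sup>+\<omega>. weight G (\<lambda>y. ennreal (exp (t * y))) (Suc n) y \<omega> \<partial>tree_law e)
    = (\<integral>\<^sup>+x. (if fst x \<in> G then \<Sum>i<fst x. ennreal (exp (t * (y + snd x i))) * ?P else 0) \<partial>e 0)"
    by (subst nn_integral_weight_Suc[OF Suc.prems]) (simp_all only: Suc.IH[OF offspring_laws_Suc[OF Suc.prems]], measurable)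
  also have "\<dots> = (\<integral>\<^sup>+x. (ennreal (exp (t * y)) * ?P) * (if fst x \<in> G then \<Sum>i<fst x. ennreal (exp (t * snd x i)) else 0) \<partial>e 0)"
    by (intro nn_integral_cong)
       (simp add: sum_distrib_left distrib_left exp_add ennreal_mult' mult_ac del: sum_ennreal)
  also have "\<dots> = (ennreal (exp (t * y)) * ?P) * mom (e 0) G t"
    unfolding mom_def by (rule nn_integral_cmult[OF measurable_offspring_laws[OF Suc.prems measurable_mom_integrand]])
  finally show ?case by (simp add: prod.lessThan_Suc_shift mult_ac del: prod.lessThan_Suc)
qed

lemma nn_integral_weight_one:
  assumes "offspring_laws e"
  shows "(\<integral>\<^sup>+\<omega>. weight G (\<lambda>_. 1) n y \<omega> \<partial>tree_law e) = (\<Prod>k<n. mom (e k) G 0)"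
  using nn_integral_weight_exp[OF assms, of G 0 n y] by simp

text \<open>Induction at the root, over pairs of children. A pair with equal indices lies in one
  subtree and is covered by induction; unequal ones are independent and contribute a product of
  means, at most \<open>C\<close> times for each child on the truncated side. Each generation thus
  adds \<open>C\<close> to the constant, starting from 1. Only one factor is truncated:
  \<open>G' = {..C}\<close> yields a second moment, \<open>G' = UNIV\<close> the comparison with the
  whole population.\<close>

lemma nn_integral_weight_product_le:
  assumes e: "offspring_laws e" and h: "h \<in> borel_measurable borel"
    and m: "\<And>k. 1 \<le> mom (e k) G' 0"
  shows "(\<integral>\<^sup>+\<omega>. weight {..C} h n y \<omega> * weight G' (\<lambda>_. 1) n 0 \<omega> \<partial>tree_law e)
    \<le> of_nat (1 + C * n) * (\<Prod>k<n. mom (e k) G' 0) * (\<integral>\<^sup>+\<omega>. weight {..C} h n y \<omega> \<partial>tree_law e)"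
  using e m
proof (induction n arbitrary: e y)
  case 0
  then show ?case by simp
next
  case (Suc n)
  note e = Suc.prems(1)
  note e' = offspring_laws_Suc[OF e]
  note [measurable] = h
  note [measurable_cong] = offspring_laws_sets[OF e] sets_forest_law[OF e']
  let ?T = "tree_law (\<lambda>n. e (Suc n))" and ?F = "forest_law (\<lambda>n. e (Suc n))"
  let ?P = "\<Prod>k<n. mom (e (Suc k)) G' 0"
  let ?w = "weight {..C} h n" and ?v = "weight G' (\<lambda>_. 1) n 0"
  let ?E = "\<lambda>y. \<integral>\<^sup>+\<omega>. ?w y \<omega> \<partial>?T"
  let ?c = "of_nat (1 + C * Suc n) * ?P :: ennreal"
  have step: "(\<integral>\<^sup>+\<psi>. weight {..C} h (Suc n) y (graft x \<psi>) * weight G' (\<lambda>_. 1) (Suc n) 0 (graft x \<psi>) \<partial>?F)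
    \<le> ?c * (if fst x \<in> {..C} then \<Sum>i<fst x. ?E (y + snd x i) else 0)" for x
  proof (cases "fst x \<le> C")
    case True
    have v: "weight G' (\<lambda>_. 1) (Suc n) 0 (graft x \<psi>) \<le> (\<Sum>j<fst x. ?v (\<psi> j))" for \<psi>
      by (auto simp: weight_const[of G' 1 n "snd x _"])
    have "(\<integral>\<^sup>+\<psi>. weight {..C} h (Suc n) y (graft x \<psi>) * weight G' (\<lambda>_. 1) (Suc n) 0 (graft x \<psi>) \<partial>?F)
      \<le> (\<integral>\<^sup>+\<psi>. (\<Sum>i<fst x. \<Sum>j<fst x. ?w (y + snd x i) (\<psi> i) * ?v (\<psi> j)) \<partial>?F)"
    proof (rule nn_integral_mono)
      fix \<psi>
      have "weight {..C} h (Suc n) y (graft x \<psi>) * weight G' (\<lambda>_. 1) (Suc n) 0 (graft x \<psi>)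
         \<le> (\<Sum>i<fst x. ?w (y + snd x i) (\<psi> i)) * (\<Sum>j<fst x. ?v (\<psi> j))"
        using v[of \<psi>] True by (intro mult_mono) auto
      also have "\<dots> = (\<Sum>i<fst x. \<Sum>j<fst x. ?w (y + snd x i) (\<psi> i) * ?v (\<psi> j))"
        by (simp add: sum_product)
      finally show "weight {..C} h (Suc n) y (graft x \<psi>) * weight G' (\<lambda>_. 1) (Suc n) 0 (graft x \<psi>)
        \<le> (\<Sum>i<fst x. \<Sum>j<fst x. ?w (y + snd x i) (\<psi> i) * ?v (\<psi> j))" .
    qed
    also have "\<dots> = (\<Sum>i<fst x. \<Sum>j<fst x. \<integral>\<^sup>+\<psi>. ?w (y + snd x i) (\<psi> i) * ?v (\<psi> j) \<partial>?F)"
      by (simp add: nn_integral_sum)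
    \<comment> \<open>The independent contribution is charged for j = i as well, which makes the
      inner sum \<open>fst x\<close> copies of it plus the diagonal term; the truncation then bounds
      \<open>fst x\<close> by \<open>C\<close>.\<close>
    also have "\<dots> \<le> (\<Sum>i<fst x. \<Sum>j<fst x. (if j = i then of_nat (1 + C * n) * ?P * ?E (y + snd x i) else 0) + ?P * ?E (y + snd x i))"
    proof (intro sum_mono)
      fix i j
      show "(\<integral>\<^sup>+\<psi>. ?w (y + snd x i) (\<psi> i) * ?v (\<psi> j) \<partial>?F)
        \<le> (if j = i then of_nat (1 + C * n) * ?P * ?E (y + snd x i) else 0) + ?P * ?E (y + snd x i)"
      proof (cases "j = i")
        case True
        have "(\<integral>\<^sup>+\<psi>. ?w (y + snd x i) (\<psi> i) * ?v (\<psi> i) \<partial>?F) = (\<integral>\<^sup>+\<omega>. ?w (y + snd x i) \<omega> * ?v \<omega> \<partial>?T)"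
          using h by (intro nn_integral_forest_component[OF e']) measurable
        also have "\<dots> \<le> of_nat (1 + C * n) * ?P * ?E (y + snd x i)"
          by (rule Suc.IH[OF e']) (use Suc.prems in auto)
        finally show ?thesis using True by (auto intro: order_trans)
      next
        case False
        have "(\<integral>\<^sup>+\<psi>. ?w (y + snd x i) (\<psi> i) * ?v (\<psi> j) \<partial>?F) = ?E (y + snd x i) * (\<integral>\<^sup>+\<omega>. ?v \<omega> \<partial>?T)"
          using h False by (intro nn_integral_forest_independent[OF e']) measurable
        then show ?thesis using False by (simp add: nn_integral_weight_one[OF e'] mult_ac)
      qed
    qed
    also have "\<dots> = (\<Sum>i<fst x. of_nat (1 + C * n) * ?P * ?E (y + snd x i) + of_nat (fst x) * (?P * ?E (y + snd x i)))"
      by (intro sum.cong refl) (simp add: sum.distrib)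
    also have "\<dots> \<le> (\<Sum>i<fst x. of_nat (1 + C * n) * ?P * ?E (y + snd x i) + of_nat C * (?P * ?E (y + snd x i)))"
      using True by (intro sum_mono add_left_mono mult_right_mono) auto
    also have "\<dots> = ?c * (\<Sum>i<fst x. ?E (y + snd x i))"
      unfolding sum_distrib_left by (intro sum.cong refl) (simp add: algebra_simps)
    finally show ?thesis using True by simp
  qed simp
  have meas: "(\<lambda>x. if fst x \<in> {..C} then \<Sum>i<fst x. ?E (y + snd x i) else 0) \<in> borel_measurable (e 0)"
  proof -
    interpret T: prob_space ?T by (rule prob_space_tree_law[OF e'])
    have "(\<lambda>(y, \<omega>). ?w y \<omega>) \<in> borel_measurable (borel \<Otimes>\<^sub>M ?T)"
      using measurable_weight_pair[OF h] sets_tree_law[OF e'] by (simp cong: measurable_cong_sets sets_pair_measure_cong)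
    from T.borel_measurable_nn_integral_fst[OF this] have [measurable]: "?E \<in> borel_measurable borel" by simp
    have "(\<lambda>x. ?E (y + snd x i)) \<in> borel_measurable (e 0)" for i
      by (rule measurable_compose[OF borel_measurable_add[OF measurable_const
            measurable_offspring_laws[OF e measurable_snd_offspring]]]) measurable
    then have *: "(\<lambda>x. \<Sum>i<fst x. ?E (y + snd x i)) \<in> borel_measurable (e 0)"
      by (rule measurable_random_sum) (rule measurable_offspring_laws[OF e measurable_fst_offspring])
    have "{x \<in> space (e 0). fst x \<in> {..C}} \<in> sets (e 0)"
      by (rule measurable_sets_Collect[OF measurable_offspring_laws[OF e measurable_fst_offspring]]) simp
    from measurable_If[OF * measurable_const this] show ?thesis by simp
  qed
  have "(\<integral>\<^sup>+\<omega>. weight {..C} h (Suc n) y \<omega> * weight G' (\<lambda>_. 1) (Suc n) 0 \<omega> \<partial>tree_law e)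
    = (\<integral>\<^sup>+x. \<integral>\<^sup>+\<psi>. weight {..C} h (Suc n) y (graft x \<psi>) * weight G' (\<lambda>_. 1) (Suc n) 0 (graft x \<psi>) \<partial>?F \<partial>e 0)"
    by (rule nn_integral_tree_law[OF e]) measurable
  also have "\<dots> \<le> (\<integral>\<^sup>+x. ?c * (if fst x \<in> {..C} then \<Sum>i<fst x. ?E (y + snd x i) else 0) \<partial>e 0)"
    by (intro nn_integral_mono step)
  also have "\<dots> = ?c * (\<integral>\<^sup>+\<omega>. weight {..C} h (Suc n) y \<omega> \<partial>tree_law e)"
    by (subst nn_integral_cmult[OF meas]) (simp only: nn_integral_weight_Suc[OF e h])
  also have "\<dots> \<le> of_nat (1 + C * Suc n) * (\<Prod>k<Suc n. mom (e k) G' 0) * (\<integral>\<^sup>+\<omega>. weight {..C} h (Suc n) y \<omega> \<partial>tree_law e)"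
  proof (intro mult_right_mono mult_left_mono)
    \<comment> \<open>The product over the subtree lacks the mean of generation 0; being at least 1,
      that mean can be inserted.\<close>
    have "1 * ?P \<le> mom (e 0) G' 0 * ?P" using Suc.prems(2)[of 0] by (intro mult_right_mono) auto
    then show "?P \<le> (\<Prod>k<Suc n. mom (e k) G' 0)"
      by (simp add: prod.lessThan_Suc_shift del: prod.lessThan_Suc)
  qed auto
  finally show ?case .
qed

lemma ennreal_inverse_antimono: "a \<le> b \<Longrightarrow> inverse b \<le> inverse (a :: ennreal)"
  by (cases a rule: ennreal_cases; cases b rule: ennreal_cases; cases "a = 0")
     (auto simp: inverse_ennreal le_imp_inverse_le ennreal_le_iff top_unique)

lemma one_le_prod_ennreal:
  assumes "\<And>k. 1 \<le> m k" and "prod m A = ennreal P"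
  shows "1 \<le> P"
proof -
  have "1 \<le> prod m A" by (rule prod_ge_1) (use assms(1) in auto)
  then have "ennreal 1 \<le> ennreal P" unfolding assms(2) by simp
  then show ?thesis by (subst (asm) ennreal_le_iff2) auto
qed

section \<open>Generations rewritten as root recursions\<close>

lemma position_Cons: "position \<omega> (i # v) = displacement \<omega> [] i + position (\<lambda>u. \<omega> (i # u)) v"
  by (simp add: position_def displacement_def sum.lessThan_Suc_shift del: sum.lessThan_Suc)

text \<open>\<open>generation\<close> appends a last letter whereas \<open>weight\<close> branches
  on the first one; this identity reconciles them.\<close>

lemma generation_Suc_root:
  "generation \<omega> (Suc n)
    = (\<Union>i\<in>{..<num_children \<omega> []}. (#) i ` generation (\<lambda>u. \<omega> (i # u)) n)"
proof (induction n arbitrary: \<omega>)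
  case (Suc n)
  have "generation \<omega> (Suc (Suc n)) = {u @ [j] | u j. u \<in> generation \<omega> (Suc n) \<and> j < num_children \<omega> u}"
    by simp
  also have "\<dots> = (\<Union>i\<in>{..<num_children \<omega> []}. (#) i ` {v @ [j] | v j. v \<in> generation (\<lambda>u. \<omega> (i # u)) n \<and> j < num_children (\<lambda>u. \<omega> (i # u)) v})"
    (is "?L = ?R")
  proof (intro set_eqI iffI)
    fix z assume "z \<in> ?L"
    then obtain u j where z: "z = u @ [j]" "u \<in> generation \<omega> (Suc n)" "j < num_children \<omega> u" by blast
    then obtain i v where "u = i # v" "i < num_children \<omega> []" "v \<in> generation (\<lambda>u. \<omega> (i # u)) n"
      unfolding Suc by auto
    with z show "z \<in> ?R" by (auto simp: num_children_def)
  next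
    fix z assume "z \<in> ?R"
    then obtain i v j where "z = i # v @ [j]" "i < num_children \<omega> []" "v \<in> generation (\<lambda>u. \<omega> (i # u)) n"
      "j < num_children (\<lambda>u. \<omega> (i # u)) v" by blast
    then show "z \<in> ?L"
      unfolding Suc by (intro CollectI exI[of _ "i # v"] exI[of _ j]) (auto simp: num_children_def)
  qed
  finally show ?case by simp
qed (auto simp: num_children_def)

lemma sum_generation_eq_weight:
  "(\<Sum>u\<in>generation \<omega> n. h (y + position \<omega> u)) = weight UNIV h n y \<omega>"
proof (induction n arbitrary: y \<omega>)
  case 0
  then show ?case by (simp add: position_def)
next
  case (Suc n)
  have "(\<Sum>u\<in>generation \<omega> (Suc n). h (y + position \<omega> u))
     = (\<Sum>i<num_children \<omega> []. \<Sum>u\<in>(#) i ` generation (\<lambda>u. \<omega> (i # u)) n. h (y + position \<omega> u))"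
    unfolding generation_Suc_root by (rule sum.UNION_disjoint) (auto simp: finite_generation)
  also have "\<dots> = (\<Sum>i<num_children \<omega> []. \<Sum>v\<in>generation (\<lambda>u. \<omega> (i # u)) n. h ((y + displacement \<omega> [] i) + position (\<lambda>u. \<omega> (i # u)) v))"
    by (rule sum.cong[OF refl]) (simp add: sum.reindex position_Cons add.assoc)
  finally show ?case by (simp add: Suc weight.simps num_children_def displacement_def)
qed

lemma ennreal_Z_eq_weight: "ennreal (Z \<omega> n B) = weight UNIV (indicator B) n 0 \<omega>"
  using sum_generation_eq_weight[where h="indicator B" and \<omega>=\<omega> and n=n and y=0]
  by (simp add: Z_def ennreal_indicator flip: sum_ennreal)

text \<open>Extinction is harmless: the real quotient 0 / 0 is 0, and so is 0 times the infinite
  inverse of 0 in ennreal.\<close>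

lemma ennreal_Z_ratio:
  "ennreal (Z \<omega> n B / Z \<omega> n UNIV) = weight UNIV (indicator B) n 0 \<omega> * inverse (pop n \<omega>)"
proof -
  have nn: "0 \<le> Z \<omega> n B" "0 \<le> Z \<omega> n UNIV" by (auto simp: Z_def intro!: sum_nonneg)
  have pop: "pop n \<omega> = ennreal (Z \<omega> n UNIV)" by (simp add: ennreal_Z_eq_weight)
  show ?thesis
  proof (cases "Z \<omega> n UNIV = 0")
    case True
    then have "generation \<omega> n = {}" by (simp add: Z_def finite_generation)
    then have "Z \<omega> n B = 0" by (simp add: Z_def)
    then show ?thesis by (simp flip: ennreal_Z_eq_weight)
  next
    case False
    with nn show ?thesis
      by (simp add: pop inverse_ennreal divide_inverse flip: ennreal_Z_eq_weight ennreal_mult)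
  qed
qed

text \<open>In the term of child \<open>i\<close> the population is bounded below by the progeny of
  one other child. The numerator and this denominator live on different subtrees, so the expectation
  factorizes, with a harmonic moment one generation shorter in the shifted environment.\<close>

lemma weight_Suc_times_inverse_pop_le:
  assumes e: "offspring_laws e" and h [measurable]: "h \<in> borel_measurable borel"
    and two: "AE x in e 0. 2 \<le> fst x"
  shows "(\<integral>\<^sup>+\<omega>. weight UNIV h (Suc n) y \<omega> * inverse (pop (Suc n) \<omega>) \<partial>tree_law e)
    \<le> (\<integral>\<^sup>+\<omega>. weight UNIV h (Suc n) y \<omega> \<partial>tree_law e)
      * (\<integral>\<^sup>+\<omega>. inverse (pop n \<omega>) \<partial>tree_law (\<lambda>n. e (Suc n)))"
proof -
  note e' = offspring_laws_Suc[OF e]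
  note [measurable_cong] = sets_forest_law[OF e']
  let ?T = "tree_law (\<lambda>n. e (Suc n))" and ?F = "forest_law (\<lambda>n. e (Suc n))"
  let ?H = "\<integral>\<^sup>+\<omega>. inverse (pop n \<omega>) \<partial>?T"
  let ?V = "\<lambda>x. \<integral>\<^sup>+\<psi>. weight UNIV h (Suc n) y (graft x \<psi>) \<partial>?F"
  have step: "(\<integral>\<^sup>+\<psi>. weight UNIV h (Suc n) y (graft x \<psi>) * inverse (pop (Suc n) (graft x \<psi>)) \<partial>?F)
    \<le> ?V x * ?H" if x: "2 \<le> fst x" for x
  proof -
    \<comment> \<open>A sibling of \<open>i\<close>: child 0, or child 1 when \<open>i\<close>
      itself is 0. It exists because there are at least two children.\<close>
    define j where "j i = (if i = 0 then 1 else 0 :: nat)" for i :: nat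
    have j: "j i < fst x" "i \<noteq> j i" for i using x by (auto simp: j_def)
    have "(\<integral>\<^sup>+\<psi>. weight UNIV h (Suc n) y (graft x \<psi>) * inverse (pop (Suc n) (graft x \<psi>)) \<partial>?F)
      \<le> (\<integral>\<^sup>+\<psi>. (\<Sum>i<fst x. weight UNIV h n (y + snd x i) (\<psi> i) * inverse (pop n (\<psi> (j i)))) \<partial>?F)"
    proof (rule nn_integral_mono)
      fix \<psi>
      have "inverse (pop (Suc n) (graft x \<psi>)) \<le> inverse (pop n (\<psi> (j i)))" for i
      proof (rule ennreal_inverse_antimono)
        have "pop n (\<psi> (j i)) \<le> (\<Sum>i<fst x. pop n (\<psi> i))"
          using j(1) by (intro member_le_sum) auto
        then show "pop n (\<psi> (j i)) \<le> pop (Suc n) (graft x \<psi>)"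
          by (simp add: weight_const[of UNIV 1 n "snd x _"])
      qed
      then show "weight UNIV h (Suc n) y (graft x \<psi>) * inverse (pop (Suc n) (graft x \<psi>))
        \<le> (\<Sum>i<fst x. weight UNIV h n (y + snd x i) (\<psi> i) * inverse (pop n (\<psi> (j i))))"
        by (auto simp: sum_distrib_right intro!: sum_mono mult_left_mono)
    qed
    also have "\<dots> = (\<Sum>i<fst x. \<integral>\<^sup>+\<psi>. weight UNIV h n (y + snd x i) (\<psi> i) * inverse (pop n (\<psi> (j i))) \<partial>?F)"
      by (rule nn_integral_sum) measurable
    also have "\<dots> = (\<Sum>i<fst x. (\<integral>\<^sup>+\<omega>. weight UNIV h n (y + snd x i) \<omega> \<partial>?T) * ?H)"
      by (intro sum.cong refl nn_integral_forest_independent[OF e'] j(2)) measurable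
    also have "\<dots> = ?V x * ?H"
      using nn_integral_forest_component[OF e' measurable_weight[OF h]]
      by (simp add: nn_integral_sum sum_distrib_right)
    finally show ?thesis .
  qed
  interpret F: prob_space ?F by (rule prob_space_forest_law[OF e'])
  note [measurable_cong] = offspring_laws_sets[OF e]
  have meas: "?V \<in> borel_measurable (e 0)"
  proof -
    have "(\<lambda>z. weight UNIV h (Suc n) y (case z of (x, \<psi>) \<Rightarrow> graft x \<psi>)) \<in> borel_measurable (e 0 \<Otimes>\<^sub>M ?F)"
      by measurable
    then have "(\<lambda>(x, \<psi>). weight UNIV h (Suc n) y (graft x \<psi>)) \<in> borel_measurable (e 0 \<Otimes>\<^sub>M ?F)"
      by (simp add: split_beta' del: weight_graft)
    from F.borel_measurable_nn_integral_fst[OF this] show ?thesis by simp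
  qed
  have "(\<integral>\<^sup>+\<omega>. weight UNIV h (Suc n) y \<omega> * inverse (pop (Suc n) \<omega>) \<partial>tree_law e)
    = (\<integral>\<^sup>+x. \<integral>\<^sup>+\<psi>. weight UNIV h (Suc n) y (graft x \<psi>) * inverse (pop (Suc n) (graft x \<psi>)) \<partial>?F \<partial>e 0)"
    by (rule nn_integral_tree_law[OF e]) measurable
  also have "\<dots> \<le> (\<integral>\<^sup>+x. ?V x * ?H \<partial>e 0)"
    by (rule nn_integral_mono_AE) (use two in eventually_elim, fact step)
  also have "\<dots> = (\<integral>\<^sup>+x. ?V x \<partial>e 0) * ?H"
    by (rule nn_integral_multc[OF meas])
  also have "(\<integral>\<^sup>+x. ?V x \<partial>e 0)
    = (\<integral>\<^sup>+\<omega>. weight UNIV h (Suc n) y \<omega> \<partial>tree_law e)"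
    by (rule nn_integral_tree_law[OF e, symmetric]) measurable
  finally show ?thesis .
qed

section \<open>Small populations and harmonic moments\<close>

definition small_prob :: "(nat \<Rightarrow> offspring measure) \<Rightarrow> nat \<Rightarrow> ennreal \<Rightarrow> ennreal" where
  "small_prob e n a = (\<integral>\<^sup>+\<omega>. indicator {\<omega>. pop n \<omega> \<le> a} \<omega> \<partial>tree_law e)"

lemma measurable_small [measurable]:
  "(\<lambda>\<omega>. indicator {\<omega>. pop n \<omega> \<le> a} \<omega> :: ennreal) \<in> borel_measurable tree_space"
proof -
  have "{\<omega> \<in> space tree_space. pop n \<omega> \<le> a} \<in> sets tree_space" by measurable
  then show ?thesis by (intro borel_measurable_indicator) simp
qed

text \<open>If the whole population is at most a, so are the progenies of children 0 and 1, and
  these are independent.\<close>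

lemma small_prob_Suc_le:
  assumes e: "offspring_laws e" and two: "AE x in e 0. 2 \<le> fst x"
  shows "small_prob e (Suc n) a \<le> (small_prob (\<lambda>n. e (Suc n)) n a) ^ 2"
proof -
  note e' = offspring_laws_Suc[OF e]
  note [measurable_cong] = sets_forest_law[OF e']
  let ?T = "tree_law (\<lambda>n. e (Suc n))" and ?F = "forest_law (\<lambda>n. e (Suc n))"
  let ?I = "\<lambda>n. indicator {\<omega>. pop n \<omega> \<le> a} :: marked_tree \<Rightarrow> ennreal"
  interpret e: prob_space "e 0" by (rule offspring_laws_prob[OF e])
  have step: "(\<integral>\<^sup>+\<psi>. ?I (Suc n) (graft x \<psi>) \<partial>?F) \<le> (small_prob (\<lambda>n. e (Suc n)) n a) ^ 2"
    if x: "2 \<le> fst x" for x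
  proof -
    have "(\<integral>\<^sup>+\<psi>. ?I (Suc n) (graft x \<psi>) \<partial>?F) \<le> (\<integral>\<^sup>+\<psi>. ?I n (\<psi> 0) * ?I n (\<psi> 1) \<partial>?F)"
    proof (rule nn_integral_mono)
      fix \<psi>
      have "pop n (\<psi> i) \<le> pop (Suc n) (graft x \<psi>)" if "i < fst x" for i
      proof -
        have "pop n (\<psi> i) \<le> (\<Sum>i<fst x. pop n (\<psi> i))"
          using that by (intro member_le_sum) auto
        then show ?thesis by (simp add: weight_const[of UNIV 1 n "snd x _"])
      qed
      from this[of 0] this[of 1] x
      show "?I (Suc n) (graft x \<psi>) \<le> ?I n (\<psi> 0) * ?I n (\<psi> 1)"
        by (auto simp: indicator_def simp del: weight_graft intro: order_trans)
    qed
    also have "\<dots> = small_prob (\<lambda>n. e (Suc n)) n a * small_prob (\<lambda>n. e (Suc n)) n a"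
      unfolding small_prob_def by (rule nn_integral_forest_independent[OF e']) auto
    finally show ?thesis by (simp add: power2_eq_square)
  qed
  have "small_prob e (Suc n) a = (\<integral>\<^sup>+x. \<integral>\<^sup>+\<psi>. ?I (Suc n) (graft x \<psi>) \<partial>?F \<partial>e 0)"
    unfolding small_prob_def by (rule nn_integral_tree_law[OF e]) measurable
  also have "\<dots> \<le> (\<integral>\<^sup>+x. (small_prob (\<lambda>n. e (Suc n)) n a) ^ 2 \<partial>e 0)"
    by (rule nn_integral_mono_AE) (use two in eventually_elim, fact step)
  also have "\<dots> = (small_prob (\<lambda>n. e (Suc n)) n a) ^ 2"
    by (simp add: e.emeasure_space_1)
  finally show ?thesis .
qed

lemma small_prob_iterate:
  assumes "offspring_laws e" and "\<And>k. AE x in e k. 2 \<le> fst x"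
  shows "small_prob e (k + n) a \<le> (small_prob (\<lambda>i. e (k + i)) n a) ^ (2 ^ k)"
  using assms
proof (induction k arbitrary: e)
  case (Suc k)
  have "small_prob e (Suc k + n) a \<le> (small_prob (\<lambda>n. e (Suc n)) (k + n) a) ^ 2"
    using small_prob_Suc_le[OF Suc.prems(1) Suc.prems(2)] by simp
  also have "\<dots> \<le> ((small_prob (\<lambda>i. e (Suc (k + i))) n a) ^ (2 ^ k)) ^ 2"
    by (intro power_mono Suc.IH offspring_laws_Suc Suc.prems) simp
  also have "\<dots> = (small_prob (\<lambda>i. e (Suc k + i)) n a) ^ (2 ^ Suc k)"
    by (simp add: power_mult[symmetric] mult.commute)
  finally show ?case .
qed simp

text \<open>
  Instead of the Cauchy--Schwarz inequality, the proof integrates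
  \<open>W \<le> P / 2 + W\<^sup>2 / (4 D P) + D P \<one>(W > P / 2)\<close>, where \<open>D = 1 + C n\<close>.
\<close>

lemma small_prob_half_mean_le:
  assumes e: "offspring_laws e" and m1: "\<And>k. 1 \<le> mom (e k) {..C} 0"
    and P: "(\<Prod>k<n. mom (e k) {..C} 0) = ennreal P"
  shows "small_prob e n (ennreal (P / 2)) \<le> ennreal (1 - 1 / (4 * (1 + real C * real n)))"
proof -
  define D where "D = 1 + real C * real n"
  have D: "D \<ge> 1" by (simp add: D_def)
  have P1: "1 \<le> P" by (rule one_le_prod_ennreal[OF m1 P])
  interpret T: prob_space "tree_law e" by (rule prob_space_tree_law[OF e])
  let ?W = "weight {..C} (\<lambda>_. 1) n 0"
  note [measurable_cong] = sets_tree_law[OF e]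
  have W [measurable]: "?W \<in> borel_measurable (tree_law e)" by measurable
  let ?B = "{\<omega> \<in> space (tree_law e). ennreal (P / 2) < ?W \<omega>}"
  have B: "?B \<in> sets (tree_law e)" by measurable
  define p where "p = measure (tree_law e) ?B"
  have EB: "(\<integral>\<^sup>+\<omega>. indicator ?B \<omega> \<partial>tree_law e) = ennreal p"
    using B by (simp add: p_def T.emeasure_eq_measure)
  have EW: "(\<integral>\<^sup>+\<omega>. ?W \<omega> \<partial>tree_law e) = ennreal P"
    unfolding nn_integral_weight_one[OF e] P ..
  have EW2: "(\<integral>\<^sup>+\<omega>. ?W \<omega> * ?W \<omega> \<partial>tree_law e) \<le> ennreal (D * P * P)"
  proof -
    have "(\<integral>\<^sup>+\<omega>. ?W \<omega> * ?W \<omega> \<partial>tree_law e) \<le> of_nat (1 + C * n) * ennreal P * ennreal P"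
      using nn_integral_weight_product_le[OF e, of "\<lambda>_. 1" "{..C}" C n 0] m1 by (simp add: EW P)
    also have "of_nat (1 + C * n) = ennreal D"
      unfolding D_def by (metis ennreal_of_nat_eq_real_of_nat of_nat_1 of_nat_add of_nat_mult)
    also have "ennreal D * ennreal P * ennreal P = ennreal (D * P * P)"
      using D P1 by (simp add: ennreal_mult)
    finally show ?thesis .
  qed
  have pw: "?W \<omega> \<le> ennreal (P / 2) + (ennreal (1 / (4 * D * P)) * (?W \<omega> * ?W \<omega>) + ennreal (D * P) * indicator ?B \<omega>)"
    if \<omega>: "\<omega> \<in> space (tree_law e)" for \<omega>
  proof (cases "?W \<omega> \<le> ennreal (P / 2)")
    case True
    then show ?thesis by (simp add: add_increasing2)
  next
    case False
    then have ind: "indicator ?B \<omega> = (1 :: ennreal)" using \<omega> by auto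
    show ?thesis
    proof (cases "?W \<omega>" rule: ennreal_cases)
      case (real w)
      \<comment> \<open>Completing the square: w \<le> w^2 / (4 D P) + D P.\<close>
      have "0 \<le> (w / (2 * D * P) - 1)\<^sup>2" by simp
      then have "0 \<le> (w / (2 * D * P) - 1)\<^sup>2 * (D * P)" using D P1 by (intro mult_nonneg_nonneg) auto
      also have "\<dots> = 1 / (4 * D * P) * (w * w) + D * P - w"
        using D P1 by (simp add: power2_eq_square field_simps)
      finally have "w \<le> P / 2 + (1 / (4 * D * P) * (w * w) + D * P)" using P1 by simp
      then have "ennreal w \<le> ennreal (P / 2 + (1 / (4 * D * P) * (w * w) + D * P))"
        by (rule ennreal_leI)
      also have "\<dots> = ennreal (P / 2) + (ennreal (1 / (4 * D * P)) * (ennreal w * ennreal w) + ennreal (D * P))"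
      proof -
        have "0 \<le> 1 / (4 * D * P)" "0 \<le> D * P" using D P1 by auto
        then show ?thesis using P1 real(1)
          by (subst ennreal_plus, simp, simp)+ (simp only: ennreal_mult mult_nonneg_nonneg)
      qed
      finally show ?thesis using real ind by simp
    next
      case top
      have "ennreal (1 / (4 * D * P)) * (\<top> * \<top>) = \<top>" using D P1 by (simp add: ennreal_mult_top)
      then show ?thesis by (simp add: top ind)
    qed
  qed
  have "ennreal P \<le> (\<integral>\<^sup>+\<omega>. ennreal (P / 2) + (ennreal (1 / (4 * D * P)) * (?W \<omega> * ?W \<omega>) + ennreal (D * P) * indicator ?B \<omega>) \<partial>tree_law e)"
    unfolding EW[symmetric] by (rule nn_integral_mono) (fact pw)
  also have "\<dots> = ennreal (P / 2) + (ennreal (1 / (4 * D * P)) * (\<integral>\<^sup>+\<omega>. ?W \<omega> * ?W \<omega> \<partial>tree_law e) + ennreal (D * P) * ennreal p)"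
    using B by (simp add: nn_integral_add nn_integral_cmult EB T.emeasure_space_1 flip: p_def T.emeasure_eq_measure)
  also have "\<dots> \<le> ennreal (P / 2) + (ennreal (1 / (4 * D * P)) * ennreal (D * P * P) + ennreal (D * P) * ennreal p)"
    by (intro add_left_mono add_right_mono mult_left_mono EW2) auto
  also have "\<dots> = ennreal (P / 2 + (1 / (4 * D * P) * (D * P * P) + D * P * p))"
  proof -
    have "0 \<le> P / 2" "0 \<le> 1 / (4 * D * P)" "0 \<le> D * P * P" "0 \<le> D * P" "0 \<le> p"
      using D P1 by (auto simp: p_def)
    then show ?thesis by (simp only: ennreal_plus ennreal_mult mult_nonneg_nonneg add_nonneg_nonneg)
  qed
  finally have "P \<le> P / 2 + (1 / (4 * D * P) * (D * P * P) + D * P * p)"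
    using D P1 by (subst (asm) ennreal_le_iff) (auto simp: p_def)
  \<comment> \<open>The second moment bound D P^2 reduces the quadratic term to P / 4. Together with
    P / 2 this leaves P / 4 for the indicator, that is D P p \<ge> P / 4.\<close>
  also have "1 / (4 * D * P) * (D * P * P) = P / 4" using D P1 by simp
  finally have "P * (1 / 4) \<le> P * (D * p)" by (simp add: mult_ac)
  then have "1 / 4 \<le> D * p" using P1 by (subst (asm) mult_le_cancel_left_pos) auto
  then have p: "1 / (4 * D) \<le> p" using D by (simp add: field_simps)
  \<comment> \<open>The truncated population is a lower bound for the whole one, so a small
    \<open>pop\<close> excludes the event \<open>?B\<close>.\<close>
  have "small_prob e n (ennreal (P / 2)) \<le> (\<integral>\<^sup>+\<omega>. indicator (space (tree_law e) - ?B) \<omega> \<partial>tree_law e)"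
    unfolding small_prob_def
    by (rule nn_integral_mono) (auto simp: indicator_def not_less intro: order_trans[OF weight_mono_set])
  also have "\<dots> = ennreal (1 - p)"
    using B by (simp add: T.emeasure_eq_measure T.prob_compl p_def)
  also have "\<dots> \<le> ennreal (1 - 1 / (4 * D))" using p by (intro ennreal_leI) simp
  finally show ?thesis by (simp add: D_def)
qed

lemma AE_one_le_pop:
  assumes "offspring_laws e" and "\<And>k. AE x in e k. 2 \<le> fst x"
  shows "AE \<omega> in tree_law e. 1 \<le> pop n \<omega>"
proof -
  have "AE \<omega> in tree_law e. 2 \<le> fst (\<omega> u)" for u
    unfolding tree_law_def
    by (rule AE_PiM_component[of UNIV "\<lambda>u. e (length u)"]) (use assms in \<open>auto simp: offspring_laws_prob\<close>)
  then have "AE \<omega> in tree_law e. \<forall>u. 2 \<le> fst (\<omega> u)" by (simp add: AE_all_countable)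
  then show ?thesis
  proof eventually_elim
    case (elim \<omega>)
    have "1 \<le> weight UNIV (\<lambda>_. 1) n y \<omega>" if "\<forall>u. 2 \<le> fst (\<omega> u)" for y \<omega>
      using that
    proof (induction n arbitrary: y \<omega>)
      case (Suc n)
      let ?f = "\<lambda>i. weight UNIV (\<lambda>_. 1) n (y + snd (\<omega> []) i) (\<lambda>u. \<omega> (i # u))"
      have "2 \<le> fst (\<omega> [])" using Suc.prems by blast
      then have "0 \<in> {..<fst (\<omega> [])}" by simp
      then have "?f 0 \<le> sum ?f {..<fst (\<omega> [])}" by (rule member_le_sum) auto
      moreover have "1 \<le> ?f 0" by (rule Suc.IH) (use Suc.prems in blast)
      ultimately have "1 \<le> sum ?f {..<fst (\<omega> [])}" by (rule order_trans[rotated])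
      then show ?case by (simp only: weight.simps UNIV_I if_True)
    qed simp
    with elim show ?case by blast
  qed
qed

text \<open>Off the event of a population at most P / 2 the inverse is at most 2 / P, on it at most
  1. The first k generations serve only to create 2^k independent trials, each observed for n
  generations; this is why P is a product over the last n laws.\<close>

lemma harmonic_moment_le:
  assumes e: "offspring_laws e" and two: "\<And>k. AE x in e k. 2 \<le> fst x"
    and m1: "\<And>k. 1 \<le> mom (e k) {..C} 0"
    and P: "(\<Prod>i<n. mom (e (k + i)) {..C} 0) = ennreal P"
  shows "(\<integral>\<^sup>+\<omega>. inverse (pop (k + n) \<omega>) \<partial>tree_law e)
    \<le> ennreal (2 / P + (1 - 1 / (4 * (1 + real C * real n))) ^ (2 ^ k))"
proof -
  have P1: "1 \<le> P" by (rule one_le_prod_ennreal[OF m1 P])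
  have q: "1 / (4 * (1 + real C * real n)) \<le> 1"
  proof -
    define x where "x = real C * real n"
    have "0 \<le> x" by (simp add: x_def)
    then show ?thesis unfolding x_def[symmetric] by simp
  qed
  interpret T: prob_space "tree_law e" by (rule prob_space_tree_law[OF e])
  note [measurable_cong] = sets_tree_law[OF e]
  have ek: "offspring_laws (\<lambda>i. e (k + i))" using e by (simp add: offspring_laws_def)
  let ?I = "indicator {\<omega>. pop (k + n) \<omega> \<le> ennreal (P / 2)} :: marked_tree \<Rightarrow> ennreal"
  have "(\<integral>\<^sup>+\<omega>. inverse (pop (k + n) \<omega>) \<partial>tree_law e) \<le> (\<integral>\<^sup>+\<omega>. ennreal (2 / P) + ?I \<omega> \<partial>tree_law e)"
  proof (rule nn_integral_mono_AE)
    show "AE \<omega> in tree_law e. inverse (pop (k + n) \<omega>) \<le> ennreal (2 / P) + ?I \<omega>"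
      using AE_one_le_pop[OF e two, of "k + n"]
    proof eventually_elim
      case (elim \<omega>)
      show ?case
      proof (cases "pop (k + n) \<omega> \<le> ennreal (P / 2)")
        case True
        from ennreal_inverse_antimono[OF elim] True show ?thesis
          by (auto simp: indicator_def intro: add_increasing)
      next
        case False
        then have "inverse (pop (k + n) \<omega>) \<le> inverse (ennreal (P / 2))"
          by (intro ennreal_inverse_antimono) auto
        then show ?thesis using P1 False by (simp add: inverse_ennreal indicator_def)
      qed
    qed
  qed
  also have "\<dots> = ennreal (2 / P) + small_prob e (k + n) (ennreal (P / 2))"
    by (simp add: nn_integral_add small_prob_def T.emeasure_space_1)
  also have "small_prob e (k + n) (ennreal (P / 2)) \<le> (small_prob (\<lambda>i. e (k + i)) n (ennreal (P / 2))) ^ (2 ^ k)"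
    by (rule small_prob_iterate[OF e two])
  also have "\<dots> \<le> ennreal (1 - 1 / (4 * (1 + real C * real n))) ^ (2 ^ k)"
    by (intro power_mono small_prob_half_mean_le[OF ek m1 P]) simp
  also have "\<dots> = ennreal ((1 - 1 / (4 * (1 + real C * real n))) ^ (2 ^ k))"
  proof (rule ennreal_power)
    show "0 \<le> 1 - 1 / (4 * (1 + real C * real n))" using q by simp
  qed
  also have "ennreal (2 / P) + \<dots> = ennreal (2 / P + (1 - 1 / (4 * (1 + real C * real n))) ^ (2 ^ k))"
    using P1 q by (intro ennreal_plus[symmetric] zero_le_power) auto
  finally show ?thesis by (simp add: add_left_mono)
qed

text \<open>
  Integrate \<open>2 Y / b - Y Z / b\<^sup>2 \<le> Y / Z\<close> with \<open>b\<close> an upper bound for \<open>E (Y Z) / E Y\<close>.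
\<close>

lemma weight_times_inverse_pop_ge:
  assumes e: "offspring_laws e" and h [measurable]: "h \<in> borel_measurable borel"
    and m1: "\<And>k. 1 \<le> mom (e k) UNIV 0"
    and P: "(\<Prod>k<n. mom (e k) UNIV 0) = ennreal P"
    and fin: "(\<integral>\<^sup>+\<omega>. weight {..C} h n 0 \<omega> \<partial>tree_law e) = ennreal E"
  shows "ennreal (E / ((1 + real C * real n) * P)) \<le> (\<integral>\<^sup>+\<omega>. weight UNIV h n 0 \<omega> * inverse (pop n \<omega>) \<partial>tree_law e)"
proof (cases "E \<le> 0")
  case True
  have P1: "1 \<le> P" by (rule one_le_prod_ennreal[OF m1 P])
  then have "E / ((1 + real C * real n) * P) \<le> 0" using True by (auto simp: divide_le_0_iff)
  then show ?thesis by (simp add: ennreal_neg)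
next
  case False
  note [measurable_cong] = sets_tree_law[OF e]
  define b where "b = (1 + real C * real n) * P"
  have P1: "1 \<le> P" by (rule one_le_prod_ennreal[OF m1 P])
  have b: "b \<ge> 1" unfolding b_def using mult_mono[of 1 "1 + real C * real n" 1 P] P1 by simp
  let ?Y = "weight {..C} h n 0"
  let ?X = "\<integral>\<^sup>+\<omega>. ?Y \<omega> * inverse (pop n \<omega>) \<partial>tree_law e"
  have EYZ: "(\<integral>\<^sup>+\<omega>. ?Y \<omega> * pop n \<omega> \<partial>tree_law e) \<le> ennreal (b * E)"
  proof -
    have "(\<integral>\<^sup>+\<omega>. ?Y \<omega> * pop n \<omega> \<partial>tree_law e) \<le> of_nat (1 + C * n) * ennreal P * ennreal E"
      using nn_integral_weight_product_le[OF e h m1, of C n 0] by (simp add: fin P)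
    also have "of_nat (1 + C * n) = ennreal (1 + real C * real n)"
      by (metis ennreal_of_nat_eq_real_of_nat of_nat_1 of_nat_add of_nat_mult)
    also have "ennreal (1 + real C * real n) * ennreal P * ennreal E = ennreal (b * E)"
      unfolding b_def using False P1 by (simp add: ennreal_mult del: ennreal_plus)
    finally show ?thesis .
  qed
  have pw: "ennreal (2 / b) * ?Y \<omega> \<le> ?Y \<omega> * inverse (pop n \<omega>) + ennreal (1 / b\<^sup>2) * (?Y \<omega> * pop n \<omega>)" for \<omega>
  proof -
    \<comment> \<open>For finite positive z this is (1 - z / b)^2 / z \<ge> 0; at 0 and at infinity
      the right side is infinite.\<close>
    have "ennreal (2 / b) \<le> inverse z + ennreal (1 / b\<^sup>2) * z" for z
    proof (cases z rule: ennreal_cases)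
      case (real r)
      show ?thesis
      proof (cases "r = 0")
        case False
        with real have r: "r > 0" by simp
        have "0 \<le> (1 - r / b)\<^sup>2 / r" using r by simp
        also have "\<dots> = inverse r + 1 / b\<^sup>2 * r - 2 / b"
          using r b by (simp add: power2_eq_square field_simps)
        finally have "ennreal (2 / b) \<le> ennreal (inverse r + 1 / b\<^sup>2 * r)"
          by (intro ennreal_leI) simp
        also have "ennreal (inverse r + 1 / b\<^sup>2 * r) = inverse z + ennreal (1 / b\<^sup>2) * z"
          using r by (simp only: real inverse_ennreal ennreal_plus ennreal_mult zero_le_power2
              divide_nonneg_nonneg mult_nonneg_nonneg zero_le_one less_imp_le inverse_nonnegative_iff_nonnegative)
        finally show ?thesis .
      qed (simp add: real)
    next
      case top
      then show ?thesis using b by (simp add: ennreal_mult_top)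
    qed
    from mult_left_mono[OF this[of "pop n \<omega>"], of "?Y \<omega>"] show ?thesis
      by (simp add: distrib_left mult_ac)
  qed
  have "ennreal (2 / b * E) = (\<integral>\<^sup>+\<omega>. ennreal (2 / b) * ?Y \<omega> \<partial>tree_law e)"
    using b False by (simp add: nn_integral_cmult fin flip: ennreal_mult)
  also have "\<dots> \<le> (\<integral>\<^sup>+\<omega>. ?Y \<omega> * inverse (pop n \<omega>) + ennreal (1 / b\<^sup>2) * (?Y \<omega> * pop n \<omega>) \<partial>tree_law e)"
    by (intro nn_integral_mono pw)
  also have "\<dots> = ?X + ennreal (1 / b\<^sup>2) * (\<integral>\<^sup>+\<omega>. ?Y \<omega> * pop n \<omega> \<partial>tree_law e)"
    by (simp add: nn_integral_add nn_integral_cmult)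
  also have "\<dots> \<le> ?X + ennreal (1 / b\<^sup>2) * ennreal (b * E)"
    by (intro add_left_mono mult_left_mono EYZ) simp
  also have "ennreal (1 / b\<^sup>2) * ennreal (b * E) = ennreal (E / b)"
    using b False by (simp add: power2_eq_square flip: ennreal_mult)
  finally have le: "ennreal (2 / b * E) \<le> ?X + ennreal (E / b)" .
  have "ennreal (E / b) + ennreal (E / b) = ennreal (2 / b * E)"
    using b False by (simp flip: ennreal_plus)
  \<comment> \<open>The left side is twice the finite number E / b, so one copy cancels.\<close>
  with le have "ennreal (E / b) + ennreal (E / b) \<le> ennreal (E / b) + ?X" by (simp only: add.commute)
  then have "ennreal (E / b) \<le> ?X" by (subst (asm) ennreal_add_left_cancel_le) simp
  also have "\<dots> \<le> (\<integral>\<^sup>+\<omega>. weight UNIV h n 0 \<omega> * inverse (pop n \<omega>) \<partial>tree_law e)"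
    by (intro nn_integral_mono mult_right_mono weight_mono_set) auto
  finally show ?thesis by (simp add: b_def)
qed

section \<open>Laws with uniformly bounded moments\<close>

text \<open>The constants do not depend on the generation. Thresholds derived from them are uniform
  over all such sequences, in particular valid for the shifted ones.\<close>

definition regular_laws :: "real \<Rightarrow> real \<Rightarrow> (nat \<Rightarrow> offspring measure) \<Rightarrow> bool" where
  "regular_laws \<delta> K e \<longleftrightarrow> offspring_laws e \<and>
    (\<forall>k. (AE x in e k. 2 \<le> fst x) \<and> (\<integral>\<^sup>+x. ennreal (real (fst x) powr (1 + \<delta>)) \<partial>e k) \<le> ennreal K)"

lemma regular_laws_offset: "regular_laws \<delta> K e \<Longrightarrow> regular_laws \<delta> K (\<lambda>i. e (k + i))"
  by (auto simp: regular_laws_def offspring_laws_def)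

lemma regular_laws_Suc: "regular_laws \<delta> K e \<Longrightarrow> regular_laws \<delta> K (\<lambda>i. e (Suc i))"
  using regular_laws_offset[of \<delta> K e 1] by simp

lemma mom_zero: "mom \<nu> G 0 = (\<integral>\<^sup>+x. (if fst x \<in> G then of_nat (fst x) else 0) \<partial>\<nu>)"
  unfolding mom_def by (intro nn_integral_cong) auto

lemma mom_mono: "G \<subseteq> G' \<Longrightarrow> mom \<nu> G t \<le> mom \<nu> G' t"
  unfolding mom_def by (intro nn_integral_mono) auto

context
  fixes \<delta> K :: real and e :: "nat \<Rightarrow> offspring measure"
  assumes pos: "\<delta> > 0" "K > 0" and reg: "regular_laws \<delta> K e"
begin

lemma reg_offspring_laws: "offspring_laws e"
  using reg by (simp add: regular_laws_def)

lemma reg_two: "AE x in e k. 2 \<le> fst x"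
  using reg by (simp add: regular_laws_def)

lemma reg_moment: "(\<integral>\<^sup>+x. ennreal (real (fst x) powr (1 + \<delta>)) \<partial>e k) \<le> ennreal K"
  using reg by (simp add: regular_laws_def)

lemma measurable_reg_borel [measurable]: "(\<lambda>x. f (fst x)) \<in> borel_measurable (e k)"
  using measurable_compose[OF measurable_offspring_laws[OF reg_offspring_laws measurable_fst_offspring], of f borel] by simp

lemma mean_le: "mom (e k) UNIV 0 \<le> ennreal (1 + K)"
proof -
  interpret prob_space "e k" by (rule offspring_laws_prob[OF reg_offspring_laws])
  have "mom (e k) UNIV 0 \<le> (\<integral>\<^sup>+x. 1 + ennreal (real (fst x) powr (1 + \<delta>)) \<partial>e k)"
    unfolding mom_zero
  proof (intro nn_integral_mono)
    fix x :: offspring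
    have "real (fst x) \<le> 1 + real (fst x) powr (1 + \<delta>)"
    proof (cases "fst x = 0")
      case False
      then have "real (fst x) powr 1 \<le> real (fst x) powr (1 + \<delta>)" using pos by (intro powr_mono) auto
      then show ?thesis using False by simp
    qed simp
    then have "ennreal (real (fst x)) \<le> ennreal (1 + real (fst x) powr (1 + \<delta>))" by (rule ennreal_leI)
    then show "(if fst x \<in> UNIV then of_nat (fst x) else 0) \<le> 1 + ennreal (real (fst x) powr (1 + \<delta>))"
      by (simp add: ennreal_of_nat_eq_real_of_nat)
  qed
  also have "\<dots> = 1 + (\<integral>\<^sup>+x. ennreal (real (fst x) powr (1 + \<delta>)) \<partial>e k)"
    by (subst nn_integral_add) (auto simp: emeasure_space_1)
  also have "\<dots> \<le> 1 + ennreal K" by (intro add_left_mono reg_moment)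
  finally show ?thesis using pos by simp
qed

lemma mean_ge: "2 \<le> mom (e k) UNIV 0"
proof -
  interpret prob_space "e k" by (rule offspring_laws_prob[OF reg_offspring_laws])
  have "2 = (\<integral>\<^sup>+x. 2 \<partial>e k)" by (simp add: emeasure_space_1)
  also have "\<dots> \<le> mom (e k) UNIV 0"
    unfolding mom_zero using reg_two[of k]
  proof (intro nn_integral_mono_AE, eventually_elim)
    case (elim x)
    then have "of_nat 2 \<le> (of_nat (fst x) :: ennreal)" by (simp only: of_nat_le_iff)
    then show ?case by simp
  qed
  finally show ?thesis .
qed

section \<open>Effect of cutting the offspring numbers at \<open>C\<close>\<close>

context
  fixes C :: nat and \<rho> :: real
  assumes C: "C \<ge> 1" "K * real C powr (- \<delta>) \<le> \<rho>" and \<rho>: "0 < \<rho>" "\<rho> \<le> 1 / 2"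
begin

text \<open>Above the cutoff (n / C)^\<delta> \<ge> 1, as in Markov's inequality for moments.
  Integrated, it bounds both the lost mean and the lost probability by \<rho>.\<close>

lemma tail_le: "real n powr (1 + \<delta>) * real C powr (- \<delta>) \<ge> real n" if "C < n"
proof -
  have "real C powr \<delta> \<le> real n powr \<delta>" using that pos by (intro powr_mono2) auto
  then have "1 \<le> real n powr \<delta> * real C powr (- \<delta>)"
    using C(1) by (simp add: powr_minus field_simps)
  then have "real n * 1 \<le> real n * (real n powr \<delta> * real C powr (- \<delta>))" by (intro mult_left_mono) auto
  then show ?thesis using that by (simp add: powr_add mult.assoc)
qed

lemma tail_integral: "(\<integral>\<^sup>+x. ennreal (real C powr (- \<delta>)) * ennreal (real (fst x) powr (1 + \<delta>)) \<partial>e k) \<le> ennreal \<rho>"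
proof -
  have "(\<integral>\<^sup>+x. ennreal (real C powr (- \<delta>)) * ennreal (real (fst x) powr (1 + \<delta>)) \<partial>e k)
    = ennreal (real C powr (- \<delta>)) * (\<integral>\<^sup>+x. ennreal (real (fst x) powr (1 + \<delta>)) \<partial>e k)"
    by (rule nn_integral_cmult) measurable
  also have "\<dots> \<le> ennreal (real C powr (- \<delta>)) * ennreal K"
    by (intro mult_left_mono reg_moment) simp
  also have "\<dots> = ennreal (K * real C powr (- \<delta>))"
    using pos by (subst ennreal_mult[symmetric]) (auto simp: mult.commute)
  also have "\<dots> \<le> ennreal \<rho>" using C by (intro ennreal_leI)
  finally show ?thesis .
qed

lemma mean_le_truncated: "mom (e k) UNIV 0 \<le> mom (e k) {..C} 0 + ennreal \<rho>"
proof -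
  have "mom (e k) UNIV 0 \<le> (\<integral>\<^sup>+x. (if fst x \<in> {..C} then of_nat (fst x) else 0)
     + ennreal (real C powr (- \<delta>)) * ennreal (real (fst x) powr (1 + \<delta>)) \<partial>e k)"
    unfolding mom_zero
  proof (intro nn_integral_mono)
    fix x :: offspring
    have "ennreal (real (fst x)) \<le> ennreal (real C powr (- \<delta>) * real (fst x) powr (1 + \<delta>))" if "C < fst x"
      using tail_le[OF that] by (intro ennreal_leI) (simp add: mult.commute)
    then show "(if fst x \<in> UNIV then of_nat (fst x) else 0) \<le> (if fst x \<in> {..C} then of_nat (fst x) else 0)
     + ennreal (real C powr (- \<delta>)) * ennreal (real (fst x) powr (1 + \<delta>))"
      by (auto simp: ennreal_of_nat_eq_real_of_nat ennreal_mult)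
  qed
  also have "\<dots> = mom (e k) {..C} 0 + (\<integral>\<^sup>+x. ennreal (real C powr (- \<delta>)) * ennreal (real (fst x) powr (1 + \<delta>)) \<partial>e k)"
    unfolding mom_zero by (rule nn_integral_add) measurable
  also have "\<dots> \<le> mom (e k) {..C} 0 + ennreal \<rho>" by (intro add_left_mono tail_integral)
  finally show ?thesis .
qed

text \<open>The mean is at least 2 and the cut removes at most 1 / 2. Means of at least 1 are what
  the pair estimate needs in order to fill up incomplete products.\<close>

lemma truncated_mean_ge: "1 \<le> mom (e k) {..C} 0"
proof (rule ccontr)
  assume "\<not> 1 \<le> mom (e k) {..C} 0"
  then have "mom (e k) {..C} 0 < ennreal 1" by simp
  then obtain r where r: "mom (e k) {..C} 0 = ennreal r" "0 \<le> r" "r < 1"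
    by (cases "mom (e k) {..C} 0" rule: ennreal_cases) (auto simp: ennreal_less_iff simp del: ennreal_1)
  have "ennreal 2 \<le> ennreal (r + \<rho>)"
    using order_trans[OF mean_ge mean_le_truncated, of k] r \<rho> by simp
  then show False using r \<rho> by (subst (asm) ennreal_le_iff) auto
qed

text \<open>A truncated mean of at least 1 turns the additive loss into a factor, so that products
  over n generations can be compared.\<close>

lemma mean_le_mult_truncated: "mom (e k) UNIV 0 \<le> ennreal (1 + \<rho>) * mom (e k) {..C} 0"
proof -
  have "mom (e k) UNIV 0 \<le> mom (e k) {..C} 0 + ennreal \<rho> * 1" using mean_le_truncated by simp
  also have "\<dots> \<le> mom (e k) {..C} 0 + ennreal \<rho> * mom (e k) {..C} 0"
    by (intro add_left_mono mult_left_mono truncated_mean_ge) simp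
  finally show ?thesis using \<rho> by (simp add: distrib_right)
qed

lemma prob_exceeds_le: "emeasure (e k) {x \<in> space (e k). C < fst x} \<le> ennreal \<rho>"
proof -
  have "{x \<in> space (e k). C < fst x} \<in> sets (e k)"
    by (rule measurable_sets_Collect[OF measurable_offspring_laws[OF reg_offspring_laws measurable_fst_offspring]]) simp
  then have "emeasure (e k) {x \<in> space (e k). C < fst x} = (\<integral>\<^sup>+x. indicator {x \<in> space (e k). C < fst x} x \<partial>e k)"
    by simp
  also have "\<dots> \<le> (\<integral>\<^sup>+x. ennreal (real C powr (- \<delta>)) * ennreal (real (fst x) powr (1 + \<delta>)) \<partial>e k)"
  proof (rule nn_integral_mono)
    fix x :: offspring
    have "ennreal 1 \<le> ennreal (real C powr (- \<delta>) * real (fst x) powr (1 + \<delta>))" if "C < fst x"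
      using tail_le[OF that] that by (intro ennreal_leI) (simp add: mult.commute)
    then show "indicator {x \<in> space (e k). C < fst x} x \<le> ennreal (real C powr (- \<delta>)) * ennreal (real (fst x) powr (1 + \<delta>))"
      by (auto simp: indicator_def ennreal_mult)
  qed
  also have "\<dots> \<le> ennreal \<rho>" by (rule tail_integral)
  finally show ?thesis .
qed

text \<open>The means of the first k generations are bounded crudely by 1 + K, the others by 1 +
  \<rho> times the truncated ones, whose product cancels the factor 1 / P of the harmonic moment.
  The exceptional event is weighed against the crude bound for all generations, which its doubly
  exponential smallness in k can absorb.\<close>

lemma harmonic_moment_times_mean_le:
  "(\<integral>\<^sup>+\<omega>. inverse (pop (k + n) \<omega>) \<partial>tree_law e) * (\<Prod>i<k + n. mom (e i) UNIV 0)
    \<le> ennreal (2 * (1 + K) ^ k * (1 + \<rho>) ^ n + exp (- (2 ^ k / (4 * (1 + real C * real n)))) * (1 + K) ^ (k + n))"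
proof -
  note e = reg_offspring_laws
  let ?H = "\<integral>\<^sup>+\<omega>. inverse (pop (k + n) \<omega>) \<partial>tree_law e"
  have fin: "mom (e i) {..C} 0 < \<top>" for i
    using order_trans[OF mom_mono[of "{..C}" UNIV "e i" 0] mean_le] by (auto simp: less_top[symmetric] top_unique)
  define P where "P = enn2real (\<Prod>i<n. mom (e (k + i)) {..C} 0)"
  have P: "(\<Prod>i<n. mom (e (k + i)) {..C} 0) = ennreal P"
    unfolding P_def using fin by (subst ennreal_enn2real) (auto simp: ennreal_prod_eq_top less_top[symmetric])
  have P1: "1 \<le> P" by (rule one_le_prod_ennreal[OF truncated_mean_ge P])
  define q where "q = 1 / (4 * (1 + real C * real n))"
  have q: "0 \<le> q" "q \<le> 1"
  proof -
    define x where "x = real C * real n"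
    have "0 \<le> x" by (simp add: x_def)
    then show "0 \<le> q" "q \<le> 1" unfolding q_def x_def[symmetric] by auto
  qed
  have H: "?H \<le> ennreal (2 / P) + ennreal ((1 - q) ^ (2 ^ k))"
    using harmonic_moment_le[OF e reg_two truncated_mean_ge P] P1 q by (simp add: q_def)
  have all: "(\<Prod>i<k + n. mom (e i) UNIV 0) \<le> ennreal ((1 + K) ^ (k + n))"
  proof -
    have "(\<Prod>i<k + n. mom (e i) UNIV 0) \<le> (\<Prod>i<k + n. ennreal (1 + K))"
      by (intro prod_mono_ennreal) (auto simp: mean_le)
    then show ?thesis using pos by (simp add: ennreal_power del: ennreal_plus)
  qed
  have split: "(\<Prod>i<k + n. mom (e i) UNIV 0) \<le> ennreal ((1 + K) ^ k * (1 + \<rho>) ^ n * P)"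
  proof -
    have "(\<Prod>i<k + n. mom (e i) UNIV 0) = (\<Prod>i<k. mom (e i) UNIV 0) * (\<Prod>i<n. mom (e (k + i)) UNIV 0)"
    proof (induction n)
      case (Suc n)
      then show ?case by (simp add: mult.assoc)
    qed simp
    also have "\<dots> \<le> (\<Prod>i<k. ennreal (1 + K)) * (\<Prod>i<n. ennreal (1 + \<rho>) * mom (e (k + i)) {..C} 0)"
      by (intro mult_mono prod_mono_ennreal) (auto simp: mean_le mean_le_mult_truncated simp del: ennreal_plus)
    also have "\<dots> = ennreal ((1 + K) ^ k) * (ennreal ((1 + \<rho>) ^ n) * ennreal P)"
      using pos \<rho> by (simp add: prod.distrib P ennreal_power del: ennreal_plus)
    also have "\<dots> = ennreal ((1 + K) ^ k * (1 + \<rho>) ^ n * P)"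
      using pos \<rho> P1 by (simp add: ennreal_mult mult.assoc)
    finally show ?thesis .
  qed
  have "?H * (\<Prod>i<k + n. mom (e i) UNIV 0) \<le> (ennreal (2 / P) + ennreal ((1 - q) ^ (2 ^ k))) * (\<Prod>i<k + n. mom (e i) UNIV 0)"
    by (intro mult_right_mono H) simp
  also have "\<dots> = ennreal (2 / P) * (\<Prod>i<k + n. mom (e i) UNIV 0) + ennreal ((1 - q) ^ (2 ^ k)) * (\<Prod>i<k + n. mom (e i) UNIV 0)"
    by (simp only: distrib_right)
  also have "\<dots> \<le> ennreal (2 / P) * ennreal ((1 + K) ^ k * (1 + \<rho>) ^ n * P) + ennreal ((1 - q) ^ (2 ^ k)) * ennreal ((1 + K) ^ (k + n))"
    by (intro add_mono mult_left_mono split all) auto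
  also have "\<dots> = ennreal (2 / P * ((1 + K) ^ k * (1 + \<rho>) ^ n * P) + (1 - q) ^ (2 ^ k) * (1 + K) ^ (k + n))"
  proof -
    have "0 \<le> 2 / P" "0 \<le> (1 + K) ^ k * (1 + \<rho>) ^ n * P" "0 \<le> (1 - q) ^ (2 ^ k)" "0 \<le> (1 + K) ^ (k + n)"
      using pos \<rho> P1 q by auto
    then show ?thesis by (simp only: ennreal_plus ennreal_mult mult_nonneg_nonneg)
  qed
  also have "\<dots> \<le> ennreal (2 * (1 + K) ^ k * (1 + \<rho>) ^ n + exp (- (2 ^ k / (4 * (1 + real C * real n)))) * (1 + K) ^ (k + n))"
  proof (intro ennreal_leI add_mono mult_right_mono)
    show "2 / P * ((1 + K) ^ k * (1 + \<rho>) ^ n * P) \<le> 2 * (1 + K) ^ k * (1 + \<rho>) ^ n"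
      using P1 by simp
    have "(1 - q) ^ (2 ^ k) \<le> exp (- q) ^ (2 ^ k)"
      using q exp_ge_add_one_self[of "- q"] by (intro power_mono) auto
    also have "\<dots> = exp (- (2 ^ k / (4 * (1 + real C * real n))))"
      by (simp add: exp_of_nat_mult[symmetric] q_def)
    finally show "(1 - q) ^ (2 ^ k) \<le> exp (- (2 ^ k / (4 * (1 + real C * real n))))" .
  qed (use pos in auto)
  finally show ?thesis .
qed

end
end

text \<open>Here 2 powr (n / J - 1) stands for a lower bound of 2^(n div J). Its exponential growth
  beats n M even after division by a linear factor.\<close>

lemma eventually_exp_bound:
  fixes J M \<epsilon> c :: real
  assumes "J > 0" "M > 0" "\<epsilon> > 0" "c \<ge> 0"
  shows "\<forall>\<^sub>F n in sequentially. 2 * exp (2 * \<epsilon> * real n)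
    + exp (real n * M - 2 powr (real n / J - 1) / (4 * (1 + c * real n))) \<le> exp (3 * \<epsilon> * real n)"
proof -
  have "\<forall>\<^sub>F n in sequentially. 2 * exp (2 * \<epsilon> * real n) \<le> exp (3 * \<epsilon> * real n) / 2"
    using assms by real_asymp
  moreover have "\<forall>\<^sub>F n in sequentially. real n * M \<le> 2 powr (real n / J - 1) / (4 * (1 + c * real n))"
  proof (cases "c = 0")
    case True
    then show ?thesis using assms by real_asymp
  next
    case False
    with assms have "c > 0" by simp
    then show ?thesis using assms by real_asymp
  qed
  moreover have "\<forall>\<^sub>F n in sequentially. 1 \<le> exp (3 * \<epsilon> * real n) / 2"
    using assms by real_asymp
  ultimately show ?thesis
  proof eventually_elim
    case (elim n)
    from elim(2) have "exp (real n * M - 2 powr (real n / J - 1) / (4 * (1 + c * real n))) \<le> 1" by simp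
    with elim(1,3) show ?case by linarith
  qed
qed

lemma exists_truncation:
  fixes \<delta> K \<rho> :: real
  assumes "\<delta> > 0" "\<rho> > 0"
  shows "\<exists>C0. \<forall>C\<ge>C0. C \<ge> 1 \<and> K * real C powr (- \<delta>) \<le> \<rho>"
proof -
  have "(\<lambda>C. K * real C powr (- \<delta>)) \<longlonglongrightarrow> K * 0"
    using assms by (intro tendsto_mult tendsto_const tendsto_neg_powr filterlim_real_sequentially) auto
  then have "\<forall>\<^sub>F C in sequentially. K * real C powr (- \<delta>) < \<rho>"
    using assms by (intro order_tendstoD) auto
  with eventually_ge_at_top[of "1 :: nat"]
  have "\<forall>\<^sub>F C in sequentially. C \<ge> 1 \<and> K * real C powr (- \<delta>) \<le> \<rho>" by eventually_elim auto
  then show ?thesis by (simp add: eventually_sequentially)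
qed

lemma harmonic_moment_eventually:
  assumes pos: "\<delta> > 0" "K > 0" "\<epsilon> > 0"
  shows "\<exists>n0. \<forall>n\<ge>n0. \<forall>e. regular_laws \<delta> K e \<longrightarrow>
    (\<integral>\<^sup>+\<omega>. inverse (pop n \<omega>) \<partial>tree_law e) * (\<Prod>i<n. mom (e i) UNIV 0) \<le> ennreal (exp (\<epsilon> * real n))"
proof -
  \<comment> \<open>One third of \<epsilon> n is allotted to the truncation, one to the initial k
    generations, and one to the factor 2 and the exceptional event.\<close>
  define \<rho> where "\<rho> = min (1 / 2) (\<epsilon> / 3)"
  have \<rho>: "0 < \<rho>" "\<rho> \<le> 1 / 2" "\<rho> \<le> \<epsilon> / 3" using pos by (auto simp: \<rho>_def)
  obtain C where C: "C \<ge> 1" "K * real C powr (- \<delta>) \<le> \<rho>" using exists_truncation[OF pos(1) \<rho>(1)] by blast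
  define M where "M = ln (1 + K)"
  have M: "M > 0" "exp M = 1 + K" using pos by (auto simp: M_def)
  \<comment> \<open>With k = n div J the crude factor (1 + K)^k is at most exp (n M / J), so J > 3 M
    / \<epsilon> keeps it within its share.\<close>
  obtain J :: nat where J: "3 * M / \<epsilon> < real J" using reals_Archimedean2 by blast
  have J0: "real J > 0" using J M pos by (smt (verit) divide_pos_pos)
  have "\<forall>\<^sub>F n in sequentially. 2 * exp (2 * (\<epsilon> / 3) * real n)
    + exp (real n * M - 2 powr (real n / real J - 1) / (4 * (1 + real C * real n))) \<le> exp (3 * (\<epsilon> / 3) * real n)"
    using pos M J0 by (intro eventually_exp_bound) auto
  then obtain n0 where n0: "\<And>n. n \<ge> n0 \<Longrightarrow> 2 * exp (2 * (\<epsilon> / 3) * real n)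
    + exp (real n * M - 2 powr (real n / real J - 1) / (4 * (1 + real C * real n))) \<le> exp (3 * (\<epsilon> / 3) * real n)"
    by (auto simp: eventually_sequentially)
  show ?thesis
  proof (intro exI[of _ n0] allI impI)
    fix n e assume n: "n \<ge> n0" and reg: "regular_laws \<delta> K e"
    let ?X = "(\<integral>\<^sup>+\<omega>. inverse (pop n \<omega>) \<partial>tree_law e) * (\<Prod>i<n. mom (e i) UNIV 0)"
    let ?u = "real n * M - 2 powr (real n / real J - 1) / (4 * (1 + real C * real n))"
    define k where "k = n div J"
    define n' where "n' = n - k"
    have kn: "k + n' = n" by (simp add: n'_def k_def)
    have k_le: "real k \<le> real n / real J" unfolding k_def by (rule of_nat_div_le_of_nat)
    have k_ge: "real n / real J - 1 \<le> real k"
    proof -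
      have "n < J * (n div J + 1)" using J0 by (simp add: dividend_less_times_div)
      then have "real n < real J * (real k + 1)" unfolding k_def by (metis of_nat_1 of_nat_add of_nat_less_iff of_nat_mult)
      then show ?thesis using J0 by (simp add: field_simps)
    qed
    have "?X
      \<le> ennreal (2 * (1 + K) ^ k * (1 + \<rho>) ^ n' + exp (- (2 ^ k / (4 * (1 + real C * real n')))) * (1 + K) ^ n)"
      using harmonic_moment_times_mean_le[OF pos(1,2) reg C \<rho>(1,2), of k n'] by (simp only: kn)
    also have "\<dots> \<le> ennreal (exp (\<epsilon> * real n))"
    proof (rule ennreal_leI)
      have "(1 + K) ^ k = exp (real k * M)" by (simp add: exp_of_nat_mult M)
      also have "\<dots> \<le> exp (\<epsilon> / 3 * real n)"
      proof -
        have "real k * M \<le> real n / real J * M" using k_le M by (intro mult_right_mono) auto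
        also have "\<dots> = real n * (M / real J)" by simp
        also have "\<dots> \<le> real n * (\<epsilon> / 3)"
          using J J0 pos by (intro mult_left_mono) (auto simp: field_simps)
        finally show ?thesis by (simp add: mult.commute)
      qed
      finally have 1: "(1 + K) ^ k \<le> exp (\<epsilon> / 3 * real n)" .
      have "(1 + \<rho>) ^ n' \<le> exp (\<epsilon> / 3) ^ n'"
        using \<rho> order_trans[OF _ exp_ge_add_one_self, of "1 + \<rho>" "\<epsilon> / 3"]
        by (intro power_mono) linarith+
      also have "\<dots> \<le> exp (\<epsilon> / 3) ^ n" using pos by (intro power_increasing) (auto simp: n'_def)
      also have "\<dots> = exp (\<epsilon> / 3 * real n)" by (simp add: exp_of_nat_mult[symmetric] mult.commute)
      finally have 2: "(1 + \<rho>) ^ n' \<le> exp (\<epsilon> / 3 * real n)" .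
      have "2 powr (real n / real J - 1) / (4 * (1 + real C * real n)) \<le> 2 ^ k / (4 * (1 + real C * real n'))"
      proof (intro frac_le mult_left_mono add_left_mono)
        show "2 powr (real n / real J - 1) \<le> 2 ^ k"
          using powr_mono[OF k_ge, of 2] by (simp add: powr_realpow)
      qed (auto simp: n'_def intro: add_pos_nonneg)
      then have le: "exp (- (2 ^ k / (4 * (1 + real C * real n')))) \<le> exp (- (2 powr (real n / real J - 1) / (4 * (1 + real C * real n))))"
        by simp
      have "(1 + K) ^ n = exp (real n * M)" by (simp add: exp_of_nat_mult M)
      then have 3: "exp (- (2 ^ k / (4 * (1 + real C * real n')))) * (1 + K) ^ n
        \<le> exp ?u"
        using mult_right_mono[OF le, of "exp (real n * M)"] by (simp add: mult_exp_exp)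
      have "2 * (1 + K) ^ k * (1 + \<rho>) ^ n' \<le> 2 * exp (\<epsilon> / 3 * real n) * exp (\<epsilon> / 3 * real n)"
        using 1 2 \<rho> pos by (intro mult_mono) auto
      also have "\<dots> = 2 * exp (2 * (\<epsilon> / 3) * real n)" by (simp flip: exp_add)
      finally show "2 * (1 + K) ^ k * (1 + \<rho>) ^ n' + exp (- (2 ^ k / (4 * (1 + real C * real n')))) * (1 + K) ^ n
        \<le> exp (\<epsilon> * real n)"
        using 3 n0[OF n] by simp
    qed
    finally show "?X \<le> ennreal (exp (\<epsilon> * real n))" .
  qed
qed

text \<open>Only the harmonic moment needs large n, hence the threshold depends neither on t nor on
  the laws. The mean of generation 0, absent from the shifted product, is paid for by 1 + K.\<close>

lemma tilted_ratio_eventually: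
  assumes pos: "\<delta> > 0" "K > 0" "\<epsilon> > 0"
  shows "\<exists>n0. \<forall>n\<ge>n0. \<forall>e. regular_laws \<delta> K e \<longrightarrow>
    (\<forall>t. (\<integral>\<^sup>+\<omega>. weight UNIV (\<lambda>y. ennreal (exp (t * y))) n 0 \<omega> * inverse (pop n \<omega>) \<partial>tree_law e)
       * (\<Prod>i<n. mom (e i) UNIV 0)
     \<le> (\<Prod>i<n. mom (e i) UNIV t) * ennreal ((1 + K) * exp (\<epsilon> * real n)))"
proof -
  from harmonic_moment_eventually[OF pos] obtain n0 where
    n0: "\<And>n e. n \<ge> n0 \<Longrightarrow> regular_laws \<delta> K e \<Longrightarrow>
      (\<integral>\<^sup>+\<omega>. inverse (pop n \<omega>) \<partial>tree_law e) * (\<Prod>i<n. mom (e i) UNIV 0) \<le> ennreal (exp (\<epsilon> * real n))"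
    by blast
  show ?thesis
  proof (intro exI[of _ "Suc n0"] allI impI)
    fix n e t assume n: "Suc n0 \<le> n" and reg: "regular_laws \<delta> K e"
    then obtain m where m: "n = Suc m" "m \<ge> n0" by (cases n) auto
    note e = reg_offspring_laws[OF pos(1,2) reg]
    let ?h = "\<lambda>y. ennreal (exp (t * y))"
    let ?X = "\<integral>\<^sup>+\<omega>. weight UNIV ?h n 0 \<omega> * inverse (pop n \<omega>) \<partial>tree_law e"
    let ?H = "\<integral>\<^sup>+\<omega>. inverse (pop m \<omega>) \<partial>tree_law (\<lambda>n. e (Suc n))"
    have "?X
      \<le> (\<integral>\<^sup>+\<omega>. weight UNIV ?h n 0 \<omega> \<partial>tree_law e) * ?H"
      unfolding m(1) by (rule weight_Suc_times_inverse_pop_le[OF e _ reg_two[OF pos(1,2) reg]]) measurable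
    also have "(\<integral>\<^sup>+\<omega>. weight UNIV ?h n 0 \<omega> \<partial>tree_law e) = (\<Prod>i<n. mom (e i) UNIV t)"
      by (simp add: nn_integral_weight_exp[OF e])
    finally have "?X * (\<Prod>i<n. mom (e i) UNIV 0)
      \<le> (\<Prod>i<n. mom (e i) UNIV t) * ?H * (\<Prod>i<n. mom (e i) UNIV 0)"
      by (intro mult_right_mono) auto
    also have "\<dots> = (\<Prod>i<n. mom (e i) UNIV t) * (mom (e 0) UNIV 0 * (?H * (\<Prod>i<m. mom (e (Suc i)) UNIV 0)))"
      unfolding m(1) by (simp only: prod.lessThan_Suc_shift mult_ac)
    also have "\<dots> \<le> (\<Prod>i<n. mom (e i) UNIV t) * (ennreal (1 + K) * ennreal (exp (\<epsilon> * real m)))"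
      by (intro mult_left_mono mult_mono mean_le[OF pos(1,2) reg] n0[OF m(2) regular_laws_Suc[OF reg]]) auto
    also have "\<dots> = (\<Prod>i<n. mom (e i) UNIV t) * ennreal ((1 + K) * exp (\<epsilon> * real m))"
      using pos by (simp add: ennreal_mult del: ennreal_plus)
    also have "\<dots> \<le> (\<Prod>i<n. mom (e i) UNIV t) * ennreal ((1 + K) * exp (\<epsilon> * real n))"
      using pos by (intro mult_left_mono ennreal_leI) (auto simp: m(1))
    finally show "?X * (\<Prod>i<n. mom (e i) UNIV 0)
     \<le> (\<Prod>i<n. mom (e i) UNIV t) * ennreal ((1 + K) * exp (\<epsilon> * real n))" .
  qed
qed

section \<open>Large deviations for a fixed environment\<close>

lemma elog_le: "x \<le> ennreal (exp y) \<Longrightarrow> elog x \<le> ereal y"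
  using ln_le_cancel_iff[of "enn2real x" "exp y"]
  by (cases x rule: ennreal_cases) (auto simp: elog_def ennreal_eq_0_iff top_unique)

lemma elog_ge: "ennreal (exp y) \<le> x \<Longrightarrow> ereal y \<le> elog x"
  by (cases x rule: ennreal_cases) (auto simp: elog_def ennreal_eq_0_iff ln_ge_iff)

lemma scaled_elog_le:
  assumes "n > 0" "x \<le> ennreal (exp (real n * c))"
  shows "ereal (1 / real n) * elog x \<le> ereal c"
proof -
  have "ereal (1 / real n) * elog x \<le> ereal (1 / real n) * ereal (real n * c)"
    by (intro ereal_mult_left_mono elog_le assms) auto
  then show ?thesis using assms(1) by simp
qed

lemma scaled_elog_ge:
  assumes "n > 0" "ennreal (exp (real n * c)) \<le> x"
  shows "ereal c \<le> ereal (1 / real n) * elog x"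
proof -
  have "ereal (1 / real n) * ereal (real n * c) \<le> ereal (1 / real n) * elog x"
    by (intro ereal_mult_left_mono elog_ge assms) auto
  then show ?thesis using assms(1) by simp
qed

lemma ennreal_le_divide:
  assumes "x * ennreal a \<le> ennreal b" "a > 0" "b \<ge> 0"
  shows "x \<le> ennreal (b / a)"
proof (cases x rule: ennreal_cases)
  case (real r)
  then show ?thesis using assms by (simp add: pos_le_divide_eq flip: ennreal_mult)
next
  case top
  then show ?thesis using assms by (simp add: ennreal_top_mult top_unique)
qed

lemma weight_add: "weight G (\<lambda>y. h y + h' y) n y \<omega> = weight G h n y \<omega> + weight G h' n y \<omega>"
  by (induction n arbitrary: y \<omega>) (auto simp: weight.simps sum.distrib)

lemma weight_cmult: "weight G (\<lambda>y. c * h y) n y \<omega> = c * weight G h n y \<omega>"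
  by (induction n arbitrary: y \<omega>) (auto simp: weight.simps sum_distrib_left)

lemma prod_eq_exp_sum_ln:
  fixes m :: "nat \<Rightarrow> ennreal"
  assumes "\<And>k. 0 < m k \<and> m k < \<top>"
  shows "(\<Prod>k<n. m k) = ennreal (exp (\<Sum>k<n. ln (enn2real (m k))))"
proof (induction n)
  case (Suc n)
  have "m n = ennreal (exp (ln (enn2real (m n))))"
    using assms[of n] by (simp add: enn2real_positive_iff)
  with Suc show ?case by (simp add: exp_add ennreal_mult)
qed simp

lemma eventually_prod_bounds:
  assumes m: "\<And>k. 0 < m k \<and> m k < (\<top> :: ennreal)"
    and lim: "(\<lambda>n. (\<Sum>k<n. ln (enn2real (m k))) / real n) \<longlonglongrightarrow> L" and \<epsilon>: "\<epsilon> > 0"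
  shows "\<forall>\<^sub>F n in sequentially. ennreal (exp (real n * (L - \<epsilon>))) \<le> (\<Prod>k<n. m k)
    \<and> (\<Prod>k<n. m k) \<le> ennreal (exp (real n * (L + \<epsilon>)))"
proof -
  have "\<forall>\<^sub>F n in sequentially. (\<Sum>k<n. ln (enn2real (m k))) / real n > L - \<epsilon>"
    by (rule order_tendstoD(1)[OF lim]) (use \<epsilon> in simp)
  moreover have "\<forall>\<^sub>F n in sequentially. (\<Sum>k<n. ln (enn2real (m k))) / real n < L + \<epsilon>"
    by (rule order_tendstoD(2)[OF lim]) (use \<epsilon> in simp)
  ultimately show ?thesis using eventually_gt_at_top[of 0]
  proof eventually_elim
    case (elim n)
    then show ?case
      unfolding prod_eq_exp_sum_ln[OF m] by (auto intro!: ennreal_leI simp: field_simps)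
  qed
qed

section \<open>Choosing exponents and slopes for the rate function\<close>

lemma open_contains_rational:
  fixes S :: "real set"
  assumes "open S" "t \<in> S"
  obtains q where "q \<in> \<rat>" "q \<in> S"
proof -
  obtain d where d: "d > 0" "ball t d \<subseteq> S" using assms open_contains_ball by blast
  then obtain q where "q \<in> \<rat>" "t < q" "q < t + d" using Rats_dense_in_real[of t "t + d"] by auto
  with d that show thesis by (auto simp: dist_real_def subset_iff)
qed

text \<open>
  The tangent at \<open>0\<close> forces the exponent attached to the leftmost point of \<open>A\<close> beyond the slope
  at \<open>0\<close> to be nonnegative, so one exponent serves the whole half-line.
\<close>

lemma chernoff_exponent:
  fixes f :: "real \<Rightarrow> real"
  assumes f: "continuous_on UNIV f" and tangent: "\<And>t. f 0 + D * t \<le> f t" and c: "c < 0"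
    and A: "\<And>x. x \<in> closure A \<Longrightarrow> \<exists>t. f t - f 0 - t * x < c"
  shows "\<exists>t\<in>\<rat>. \<exists>b. f t - f 0 - t * b < c \<and> (\<forall>x\<in>A. D \<le> x \<longrightarrow> t * b \<le> t * x)"
proof (cases "A \<inter> {D..} = {}")
  case True
  \<comment> \<open>Nothing of \<open>A\<close> lies to the right of D, so t = 1 is admissible and b
    is merely taken large: the left side is then c - 1.\<close>
  then show ?thesis
    by (intro bexI[of _ 1] exI[of _ "f 1 - f 0 - c + 1"]) auto
next
  case False
  let ?B = "A \<inter> {D..}"
  define b where "b = Inf ?B"
  have bdd: "bdd_below ?B" by (auto intro: bdd_belowI[of _ D])
  have "b \<in> closure ?B" unfolding b_def by (rule closure_contains_Inf[OF False bdd])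
  then have bA: "b \<in> closure A" using closure_mono[of ?B A] by auto
  have Db: "D \<le> b" unfolding b_def using False by (intro cInf_greatest) auto
  from A[OF bA] obtain t where t: "f t - f 0 - t * b < c" by blast
  \<comment> \<open>For t \<le> 0 the tangent would give f t - f 0 - t b \<ge> t (D - b) \<ge> 0,
    against c < 0.\<close>
  have "t > 0"
  proof (rule ccontr)
    assume "\<not> t > 0"
    then have "0 \<le> t * (D - b)" using Db by (intro mult_nonpos_nonpos) auto
    with t tangent[of t] c show False by (simp add: algebra_simps)
  qed
  \<comment> \<open>Both requirements are open in t, so t can be replaced by a rational
    exponent.\<close>
  let ?S = "{0<..} \<inter> {t. f t - f 0 - t * b < c}"
  have "open ?S"
    by (intro open_Int open_greaterThan open_Collect_less continuous_intros f)
  moreover have "t \<in> ?S" using t \<open>t > 0\<close> by simp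
  ultimately obtain q where q: "q \<in> \<rat>" "q \<in> ?S"
    by (rule open_contains_rational)
  have "q * b \<le> q * x" if "x \<in> A" "D \<le> x" for x
  proof -
    have "b \<le> x" unfolding b_def using that by (intro cInf_lower bdd) auto
    then show ?thesis using q(2) by (intro mult_left_mono) auto
  qed
  with q show ?thesis by (intro bexI[of _ q] exI[of _ b]) auto
qed

text \<open>
  Maximising \<open>x t - f t - \<gamma> t\<^sup>2 / 2\<close> with small \<open>\<gamma>\<close> yields slopes of \<open>f\<close> arbitrarily close to \<open>x\<close>
  even when the supremum defining the Legendre transform at \<open>x\<close> is not attained.
\<close>

lemma nearby_slope:
  fixes f f' :: "real \<Rightarrow> real"
  assumes D: "\<And>t. (f has_real_derivative f' t) (at t)"
    and L: "\<And>t. x * t - f t \<le> L" and r: "r > 0"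
  shows "\<exists>t. \<bar>f' t - x\<bar> < r \<and> t * f' t - f t \<le> L"
proof -
  \<comment> \<open>Chosen so that \<gamma> times 2 (L + f 0 + 1) equals r^2. The maximizer
    satisfies \<gamma> t^2 \<le> 2 (L + f 0), hence |\<gamma> t| < r, and \<gamma> t is the error in
    the slope.\<close>
  define \<gamma> where "\<gamma> = r\<^sup>2 / (2 * (L + f 0 + 1))"
  have L0: "0 \<le> L + f 0" using L[of 0] by simp
  have \<gamma>: "\<gamma> > 0" unfolding \<gamma>_def using L0 r by simp
  define h where "h t = x * t - f t - \<gamma> * t\<^sup>2 / 2" for t
  \<comment> \<open>Outside [-T, T] the quadratic penalty pushes \<open>h\<close> below
    \<open>h 0\<close>, so the maximum over this interval is global.\<close>
  define T where "T = 2 * (L + f 0 + 1) / \<gamma> + 1"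
  have T: "T \<ge> 1" unfolding T_def using L0 \<gamma> by simp
  have out: "h t < h 0" if "\<bar>t\<bar> > T" for t
  proof -
    have "T * 1 \<le> T * T" using T by (intro mult_left_mono) auto
    then have "T \<le> T\<^sup>2" by (simp add: power2_eq_square)
    also have "T\<^sup>2 < t\<^sup>2" using that T by (metis abs_ge_zero abs_of_nonneg power2_abs power_strict_mono order_trans zero_le_one zero_less_numeral)
    finally have "\<gamma> * T < \<gamma> * t\<^sup>2" using \<gamma> by simp
    moreover have "\<gamma> * T = 2 * (L + f 0 + 1) + \<gamma>" using \<gamma> by (simp add: T_def field_simps)
    ultimately have "L - \<gamma> * t\<^sup>2 / 2 < - f 0" using \<gamma> by simp
    then show ?thesis using L[of t] by (simp add: h_def)
  qed
  have cont: "continuous_on UNIV f" using D by (meson DERIV_isCont continuous_at_imp_continuous_on)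
  have "\<exists>t\<in>{-T..T}. \<forall>s\<in>{-T..T}. h s \<le> h t"
    unfolding h_def using T
    by (intro continuous_attains_sup continuous_intros continuous_on_subset[OF cont]) auto
  then obtain t where t: "t \<in> {-T..T}" "\<And>s. s \<in> {-T..T} \<Longrightarrow> h s \<le> h t" by blast
  have "0 \<in> {-T..T}" using T by simp
  then have h0: "h 0 \<le> h t" using t by blast
  have max: "h s \<le> h t" for s
  proof (cases "\<bar>s\<bar> > T")
    case True
    with out[of s] h0 show ?thesis by simp
  qed (intro t(2), auto)
  have "(h has_real_derivative x - f' t - \<gamma> * t) (at t)"
    unfolding h_def by (auto intro!: derivative_eq_intros D)
  then have "x - f' t - \<gamma> * t = 0"
    by (rule DERIV_local_max[of _ _ _ 1]) (use max in auto)
  then have y: "f' t = x - \<gamma> * t" by simp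
  have "\<gamma> * t\<^sup>2 \<le> 2 * (L + f 0)" using h0 L[of t] by (simp add: h_def)
  then have "\<gamma> * (\<gamma> * t\<^sup>2) \<le> \<gamma> * (2 * (L + f 0))" using \<gamma> by (intro mult_left_mono) auto
  then have "(\<gamma> * t)\<^sup>2 \<le> \<gamma> * (2 * (L + f 0))" by (simp add: power2_eq_square mult_ac)
  also have "\<dots> < \<gamma> * (2 * (L + f 0 + 1))" using \<gamma> by simp
  also have "\<dots> = r\<^sup>2" using L0 by (simp add: \<gamma>_def)
  finally have "\<bar>\<gamma> * t\<bar> < r" using r by (metis abs_le_square_iff abs_of_pos linorder_not_less)
  moreover have "t * f' t - f t \<le> L"
  proof -
    have "t * f' t - f t = x * t - f t - \<gamma> * t\<^sup>2" unfolding y by (simp add: power2_eq_square algebra_simps)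
    also have "\<dots> \<le> x * t - f t" using \<gamma> by simp
    finally show ?thesis using L[of t] by simp
  qed
  ultimately show ?thesis by (intro exI[of _ t]) (auto simp: y)
qed

text \<open>Averages will be known only at rational parameters. The two one-sided increments encode
  that the slope at s is within \<epsilon> of y without differentiating there; as strict
  inequalities between continuous functions they survive the passage from t to a rational s. The
  bound on |s| controls a tilting error that is fixed before s is chosen.\<close>

lemma rational_near_slope:
  fixes f :: "real \<Rightarrow> real"
  assumes cont: "continuous_on UNIV f" and D: "(f has_real_derivative y) (at t)" and \<epsilon>: "\<epsilon> > 0"
    and L: "t * y - f t < L"
  shows "\<exists>s\<in>\<rat>. \<exists>d\<in>\<rat>. d > 0 \<and> f (s + d) - f s < d * (y + \<epsilon>) \<and> f (s - d) - f s < - d * (y - \<epsilon>)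
    \<and> s * y - f s < L \<and> \<bar>s\<bar> < \<bar>t\<bar> + 1"
proof -
  have lim: "((\<lambda>h. (f (t + h) - f t) / h) \<longlongrightarrow> y) (at 0)" using D by (simp add: DERIV_def)
  from tendstoD[OF lim \<epsilon>] obtain d0 where d0: "d0 > 0"
    "\<And>h. h \<noteq> 0 \<Longrightarrow> \<bar>h\<bar> < d0 \<Longrightarrow> \<bar>(f (t + h) - f t) / h - y\<bar> < \<epsilon>"
    by (auto simp: eventually_at dist_real_def)
  obtain d where d: "d \<in> \<rat>" "0 < d" "d < d0" using Rats_dense_in_real[OF d0(1)] by auto
  have 1: "f (t + d) - f t < d * (y + \<epsilon>)"
    using d0(2)[of d] d by (auto simp: abs_less_iff field_simps)
  have 2: "f (t - d) - f t < - d * (y - \<epsilon>)"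
    using d0(2)[of "- d"] d by (auto simp: abs_less_iff field_simps)
  let ?S = "{s. f (s + d) - f s < d * (y + \<epsilon>)} \<inter> {s. f (s - d) - f s < - d * (y - \<epsilon>)}
    \<inter> {s. s * y - f s < L} \<inter> {s. \<bar>s\<bar> < \<bar>t\<bar> + 1}"
  have c: "continuous_on UNIV (\<lambda>s. f (g s))" if "continuous_on UNIV g" for g
    using continuous_on_compose2[OF cont that] by auto
  have "open ?S"
    by (intro open_Int open_Collect_less continuous_intros c cont)
  moreover have "t \<in> ?S" using 1 2 L by simp
  ultimately obtain s where s: "s \<in> \<rat>" "s \<in> ?S"
    by (rule open_contains_rational)
  with d show ?thesis by (intro bexI[of _ s] bexI[of _ d]) auto
qed

section \<open>Upper and lower bounds for one sequence of laws\<close>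

definition ratio :: "(nat \<Rightarrow> offspring measure) \<Rightarrow> real set \<Rightarrow> nat \<Rightarrow> ennreal" where
  "ratio e A n = (\<integral>\<^sup>+\<omega>. weight UNIV (indicator ((\<lambda>x. real n * x) ` A)) n 0 \<omega> * inverse (pop n \<omega>) \<partial>tree_law e)"

abbreviation log_ratio :: "(nat \<Rightarrow> offspring measure) \<Rightarrow> real set \<Rightarrow> nat \<Rightarrow> ereal" where
  "log_ratio e A n \<equiv> ereal (1 / real n) * elog (ratio e A n)"

context
  fixes \<delta> K :: real and e :: "nat \<Rightarrow> offspring measure" and \<Lambda> \<Lambda>' :: "real \<Rightarrow> real" and \<Lambda>\<^sub>C :: "nat \<Rightarrow> real \<Rightarrow> real"
  assumes pos: "\<delta> > 0" "K > 0" and reg: "regular_laws \<delta> K e"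
    and fin: "\<And>k t. t \<in> \<rat> \<Longrightarrow> 0 < mom (e k) UNIV t \<and> mom (e k) UNIV t < \<top>"
    and lim: "\<And>t. t \<in> \<rat> \<Longrightarrow> (\<lambda>n. (\<Sum>k<n. log_mom (e k) UNIV t) / real n) \<longlonglongrightarrow> \<Lambda> t"
    and trunc: "\<And>t. t \<in> \<rat> \<Longrightarrow> (\<lambda>C. \<Lambda>\<^sub>C C t) \<longlonglongrightarrow> \<Lambda> t"
    and trunc_pos: "\<And>t. t \<in> \<rat> \<Longrightarrow> \<forall>\<^sub>F C in sequentially. \<forall>k. 0 < mom (e k) {..C} t"
    and trunc_lim: "\<And>t. t \<in> \<rat> \<Longrightarrow> \<forall>\<^sub>F C in sequentially.
      (\<lambda>n. (\<Sum>k<n. log_mom (e k) {..C} t) / real n) \<longlonglongrightarrow> \<Lambda>\<^sub>C C t"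
    and conv: "convex_on UNIV \<Lambda>"
    and deriv: "\<And>t. (\<Lambda> has_real_derivative \<Lambda>' t) (at t)"
begin

lemma rate_continuous: "continuous_on UNIV \<Lambda>"
  using deriv by (meson DERIV_isCont continuous_at_imp_continuous_on)

text \<open>Centring the exponential at n b makes it at least 1 at y = n x whenever t x \<ge> t b.
  The spare factor 1 / 2 lets two such bounds, one for each half-line, add up to exp (n c).\<close>

lemma tilted_ratio_bound:
  assumes t: "t \<in> \<rat>" and c: "\<Lambda> t - \<Lambda> 0 - t * b < c"
  shows "\<forall>\<^sub>F n in sequentially.
    (\<integral>\<^sup>+\<omega>. weight UNIV (\<lambda>y. ennreal (exp (t * (y - real n * b)))) n 0 \<omega> * inverse (pop n \<omega>) \<partial>tree_law e)
    \<le> ennreal (exp (real n * c) / 2)"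
proof -
  note e = reg_offspring_laws[OF pos reg]
  note [measurable_cong] = sets_tree_law[OF e]
  \<comment> \<open>A quarter of the gap: three shares go to the harmonic moment and to the products
    at t and at 0, the fourth absorbs the constant 2 (1 + K).\<close>
  define \<epsilon> where "\<epsilon> = (c - (\<Lambda> t - \<Lambda> 0 - t * b)) / 4"
  have \<epsilon>: "\<epsilon> > 0" using c by (simp add: \<epsilon>_def)
  have c_eq: "\<Lambda> t - \<Lambda> 0 - t * b = c - 4 * \<epsilon>" unfolding \<epsilon>_def by (simp add: field_simps)
  from tilted_ratio_eventually[OF pos \<epsilon>] reg
  have "\<forall>\<^sub>F n in sequentially. (\<integral>\<^sup>+\<omega>. weight UNIV (\<lambda>y. ennreal (exp (t * y))) n 0 \<omega> * inverse (pop n \<omega>) \<partial>tree_law e)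
       * (\<Prod>i<n. mom (e i) UNIV 0)
     \<le> (\<Prod>i<n. mom (e i) UNIV t) * ennreal ((1 + K) * exp (\<epsilon> * real n))"
    unfolding eventually_sequentially by blast
  moreover note eventually_prod_bounds[OF fin[OF t] lim[OF t] \<epsilon>]
  moreover note eventually_prod_bounds[OF fin[of 0] lim[of 0] \<epsilon>, simplified]
  moreover have "\<forall>\<^sub>F n in sequentially. (1 + K) * exp (- \<epsilon> * real n) \<le> 1 / 2"
    using \<epsilon> pos by real_asymp
  ultimately show ?thesis
  proof eventually_elim
    case (elim n)
    let ?q = "exp (real n * (\<Lambda> t + \<epsilon>)) * ((1 + K) * exp (\<epsilon> * real n)) / exp (real n * (\<Lambda> 0 - \<epsilon>))"
    let ?Y = "\<lambda>\<omega>. weight UNIV (\<lambda>y. ennreal (exp (t * y))) n 0 \<omega> * inverse (pop n \<omega>)"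
    let ?h = "\<lambda>y. ennreal (exp (t * (y - real n * b)))"
    let ?X = "\<integral>\<^sup>+\<omega>. ?Y \<omega> \<partial>tree_law e"
    have "?X * ennreal (exp (real n * (\<Lambda> 0 - \<epsilon>))) \<le> ?X * (\<Prod>i<n. mom (e i) UNIV 0)"
      using elim(3) by (intro mult_left_mono) auto
    also have "\<dots> \<le> (\<Prod>i<n. mom (e i) UNIV t) * ennreal ((1 + K) * exp (\<epsilon> * real n))" by (rule elim(1))
    also have "\<dots> \<le> ennreal (exp (real n * (\<Lambda> t + \<epsilon>))) * ennreal ((1 + K) * exp (\<epsilon> * real n))"
      using elim(2) by (intro mult_right_mono) auto
    also have "\<dots> = ennreal (exp (real n * (\<Lambda> t + \<epsilon>)) * ((1 + K) * exp (\<epsilon> * real n)))"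
      using pos by (intro ennreal_mult[symmetric]) auto
    finally have X: "?X \<le> ennreal ?q"
      by (rule ennreal_le_divide) (use pos in auto)
    have "(\<integral>\<^sup>+\<omega>. weight UNIV ?h n 0 \<omega> * inverse (pop n \<omega>) \<partial>tree_law e)
      = (\<integral>\<^sup>+\<omega>. ennreal (exp (- t * (real n * b))) * ?Y \<omega> \<partial>tree_law e)"
    proof (intro nn_integral_cong)
      fix \<omega>
      have "?h = (\<lambda>y. ennreal (exp (- t * (real n * b))) * ennreal (exp (t * y)))"
        by (simp add: ennreal_mult[symmetric] mult_exp_exp algebra_simps)
      then show "weight UNIV ?h n 0 \<omega> * inverse (pop n \<omega>)
        = ennreal (exp (- t * (real n * b))) * ?Y \<omega>"
        by (simp only: weight_cmult mult.assoc)
    qed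
    also have "\<dots> = ennreal (exp (- t * (real n * b))) * ?X"
      by (rule nn_integral_cmult) measurable
    also have "\<dots> \<le> ennreal (exp (- t * (real n * b))) *
      ennreal ?q"
      by (intro mult_left_mono X) auto
    also have "\<dots> = ennreal (exp (- t * (real n * b)) * ?q)"
      using pos by (intro ennreal_mult[symmetric]) auto
    also have "\<dots> \<le> ennreal (exp (real n * c) / 2)"
    proof (rule ennreal_leI)
      have "exp (- t * (real n * b)) * ?q
        = (1 + K) * exp (real n * (\<Lambda> t - \<Lambda> 0 - t * b + 3 * \<epsilon>))"
        by (simp add: exp_add[symmetric] exp_diff[symmetric] mult_exp_exp divide_simps) (simp add: exp_add[symmetric] algebra_simps mult_exp_exp)
      also have "\<dots> = (1 + K) * exp (- \<epsilon> * real n) * exp (real n * c)"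
        unfolding c_eq by (simp add: mult_exp_exp algebra_simps)
      also have "\<dots> \<le> 1 / 2 * exp (real n * c)" by (intro mult_right_mono elim(4)) simp
      finally show "exp (- t * (real n * b)) * ?q
        \<le> exp (real n * c) / 2" by simp
    qed
    finally show ?case .
  qed
qed

text \<open>The point \<Lambda>' 0 separates \<open>A\<close> into two parts, each governed by a
  single exponent; the left part becomes the right one after reflecting \<open>A\<close> and
  \<Lambda>. For c \<ge> 0 the trivial bound of the ratio by 1 suffices.\<close>

lemma ratio_upper:
  assumes c: "- (INF x\<in>closure A. legendre \<Lambda> x) - ereal (\<Lambda> 0) < ereal c"
  shows "\<forall>\<^sub>F n in sequentially. ratio e A n \<le> ennreal (exp (real n * c))"
proof (cases "c < 0")
  case False
  note e = reg_offspring_laws[OF pos reg]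
  interpret T: prob_space "tree_law e" by (rule prob_space_tree_law[OF e])
  have "ratio e A n \<le> ennreal (exp (real n * c))" for n
  proof -
    have "ratio e A n \<le> (\<integral>\<^sup>+\<omega>. 1 \<partial>tree_law e)"
      unfolding ratio_def
    proof (intro nn_integral_mono)
      fix \<omega>
      have "weight UNIV (indicator ((\<lambda>x. real n * x) ` A)) n 0 \<omega> * inverse (pop n \<omega>) \<le> pop n \<omega> * inverse (pop n \<omega>)"
        by (intro mult_right_mono weight_mono) (auto simp: indicator_def)
      also have "\<dots> \<le> 1"
        by (cases "pop n \<omega>" rule: ennreal_cases; cases "pop n \<omega> = 0")
           (auto simp: inverse_ennreal ennreal_mult[symmetric])
      finally show "weight UNIV (indicator ((\<lambda>x. real n * x) ` A)) n 0 \<omega> * inverse (pop n \<omega>) \<le> 1" .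
    qed
    also have "\<dots> \<le> ennreal (exp (real n * c))"
      using False by (simp add: T.emeasure_space_1)
    finally show ?thesis .
  qed
  then show ?thesis by simp
next
  case True
  note e = reg_offspring_laws[OF pos reg]
  note [measurable_cong] = sets_tree_law[OF e]
  have A: "\<exists>t. \<Lambda> t - \<Lambda> 0 - t * x < c" if x: "x \<in> closure A" for x
  proof -
    have "(INF x\<in>closure A. legendre \<Lambda> x) \<le> legendre \<Lambda> x" by (rule INF_lower[OF x])
    then have "- legendre \<Lambda> x - ereal (\<Lambda> 0) \<le> - (INF x\<in>closure A. legendre \<Lambda> x) - ereal (\<Lambda> 0)"
      by (intro ereal_minus_mono) auto
    with c have "- legendre \<Lambda> x - ereal (\<Lambda> 0) < ereal c" by (rule le_less_trans[rotated])
    then have "ereal (- c - \<Lambda> 0) < legendre \<Lambda> x" by (cases "legendre \<Lambda> x") auto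
    then obtain t where "ereal (- c - \<Lambda> 0) < ereal (x * t - \<Lambda> t)"
      unfolding legendre_def by (auto simp: less_SUP_iff)
    then show ?thesis by (intro exI[of _ t]) (simp add: mult.commute)
  qed
  have tangent: "\<Lambda> 0 + \<Lambda>' 0 * t \<le> \<Lambda> t" for t
    using convex_on_above_tangent[OF conv deriv[of 0], of t] by simp
  from chernoff_exponent[OF rate_continuous tangent True A]
  obtain t1 b1 where 1: "t1 \<in> \<rat>" "\<Lambda> t1 - \<Lambda> 0 - t1 * b1 < c" "\<And>x. x \<in> A \<Longrightarrow> \<Lambda>' 0 \<le> x \<Longrightarrow> t1 * b1 \<le> t1 * x" by blast
  have "\<exists>t\<in>\<rat>. \<exists>b. \<Lambda> (- t) - \<Lambda> (- 0) - t * b < c \<and> (\<forall>x\<in>uminus ` A. - \<Lambda>' 0 \<le> x \<longrightarrow> t * b \<le> t * x)"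
  proof (rule chernoff_exponent[OF _ _ True])
    show "continuous_on UNIV (\<lambda>t. \<Lambda> (- t))"
      by (rule continuous_on_compose2[OF rate_continuous]) (auto intro!: continuous_intros)
    show "\<Lambda> (- 0) + - \<Lambda>' 0 * t \<le> \<Lambda> (- t)" for t using tangent[of "- t"] by simp
    fix x assume "x \<in> closure (uminus ` A)"
    moreover have "uminus ` closure (uminus ` A) \<subseteq> closure (uminus ` uminus ` A)"
      by (rule closure_bounded_linear_image_subset) (rule bounded_linear_minus[OF bounded_linear_ident])
    ultimately have "- x \<in> closure A" by (auto simp: image_image)
    from A[OF this] obtain t where "\<Lambda> t - \<Lambda> 0 - t * (- x) < c" by blast
    then show "\<exists>t. \<Lambda> (- t) - \<Lambda> (- 0) - t * x < c" by (intro exI[of _ "- t"]) simp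
  qed
  then obtain t2 b2 where 2: "t2 \<in> \<rat>" "\<Lambda> (- t2) - \<Lambda> 0 - (- t2) * (- b2) < c"
    "\<And>x. x \<in> A \<Longrightarrow> x \<le> \<Lambda>' 0 \<Longrightarrow> (- t2) * (- b2) \<le> (- t2) * x"
    by force
  have "- t2 \<in> \<rat>" using 2(1) by simp
  from tilted_ratio_bound[OF 1(1,2)] tilted_ratio_bound[OF this 2(2)] eventually_gt_at_top[of 0]
  show ?thesis
  proof eventually_elim
    case (elim n)
    let ?h1 = "\<lambda>y. ennreal (exp (t1 * (y - real n * b1)))"
    let ?h2 = "\<lambda>y. ennreal (exp (- t2 * (y - real n * - b2)))"
    have ind: "indicator ((\<lambda>x. real n * x) ` A) y \<le> ?h1 y + ?h2 y" for y
    proof (cases "y \<in> (\<lambda>x. real n * x) ` A")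
      case True
      then obtain x where x: "x \<in> A" "y = real n * x" by blast
      have h: "1 \<le> ennreal (exp (s * (y - real n * b)))" if "s * b \<le> s * x" for s b
      proof -
        have "0 \<le> real n * (s * x - s * b)" using that by simp
        also have "\<dots> = s * (y - real n * b)" by (simp add: x(2) algebra_simps)
        finally have "ennreal 1 \<le> ennreal (exp (s * (y - real n * b)))" by (intro ennreal_leI) simp
        then show ?thesis by simp
      qed
      show ?thesis
      proof (cases "\<Lambda>' 0 \<le> x")
        case True
        with h[OF 1(3)[OF x(1)]] show ?thesis by (auto simp: indicator_def intro: add_increasing2)
      next
        case False
        with h[OF 2(3)[OF x(1)]] show ?thesis by (auto simp: indicator_def intro: add_increasing)
      qed
    qed simp
    have "ratio e A n \<le> (\<integral>\<^sup>+\<omega>. weight UNIV ?h1 n 0 \<omega> * inverse (pop n \<omega>) + weight UNIV ?h2 n 0 \<omega> * inverse (pop n \<omega>) \<partial>tree_law e)"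
      unfolding ratio_def
    proof (intro nn_integral_mono)
      fix \<omega>
      have "weight UNIV (indicator ((\<lambda>x. real n * x) ` A)) n 0 \<omega> \<le> weight UNIV (\<lambda>y. ?h1 y + ?h2 y) n 0 \<omega>"
        by (intro weight_mono ind)
      then show "weight UNIV (indicator ((\<lambda>x. real n * x) ` A)) n 0 \<omega> * inverse (pop n \<omega>)
        \<le> weight UNIV ?h1 n 0 \<omega> * inverse (pop n \<omega>) + weight UNIV ?h2 n 0 \<omega> * inverse (pop n \<omega>)"
        unfolding weight_add distrib_right[symmetric] by (rule mult_right_mono) simp
    qed
    also have "\<dots> = (\<integral>\<^sup>+\<omega>. weight UNIV ?h1 n 0 \<omega> * inverse (pop n \<omega>) \<partial>tree_law e) + (\<integral>\<^sup>+\<omega>. weight UNIV ?h2 n 0 \<omega> * inverse (pop n \<omega>) \<partial>tree_law e)"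
      by (rule nn_integral_add) measurable
    also have "\<dots> \<le> ennreal (exp (real n * c) / 2) + ennreal (exp (real n * c) / 2)"
      using elim(1,2) by (intro add_mono) auto
    also have "\<dots> = ennreal (exp (real n * c))" by (simp flip: ennreal_plus)
    finally show ?case .
  qed
qed

text \<open>The exponential exp (s z) is split into the window around n y and two tails, each tail
  being dominated by a neighbouring tilt s + d or s - d. The increments of \<Lambda> make the tails
  exponentially smaller than the moment at s, so a level C that is good at s alone suffices.\<close>

lemma truncated_local_lower:
  assumes s: "s \<in> \<rat>" "d \<in> \<rat>" "d > 0" and \<epsilon>: "\<epsilon> > 0"
    and s1: "\<Lambda> (s + d) - \<Lambda> s < d * (y + \<epsilon>)" and s2: "\<Lambda> (s - d) - \<Lambda> s < - d * (y - \<epsilon>)"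
    and c: "c < \<Lambda> s - s * y - \<bar>s\<bar> * \<epsilon>"
  shows "\<exists>C. (\<forall>k. 1 \<le> mom (e k) {..C} 0) \<and> (\<forall>\<^sub>F n in sequentially.
    ennreal (exp (real n * c)) \<le> (\<integral>\<^sup>+\<omega>. weight {..C} (indicator {z. \<bar>z - real n * y\<bar> < real n * \<epsilon>}) n 0 \<omega> \<partial>tree_law e))"
proof -
  note e = reg_offspring_laws[OF pos reg]
  note [measurable_cong] = sets_tree_law[OF e]
  \<comment> \<open>A fifth of the smallest slack. Each tail is at most exp (n (\<Lambda> s - 4
    \<eta>)), the truncated moment at least exp (n (\<Lambda> s - 2 \<eta>)), and one more \<eta>
    absorbs the factor 1 / 2 that remains after subtracting the tails.\<close>
  define \<eta> where "\<eta> = min (min (d * (y + \<epsilon>) - (\<Lambda> (s + d) - \<Lambda> s)) (- d * (y - \<epsilon>) - (\<Lambda> (s - d) - \<Lambda> s)))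
    (\<Lambda> s - s * y - \<bar>s\<bar> * \<epsilon> - c) / 5"
  have \<eta>: "\<eta> > 0" "\<Lambda> (s + d) - d * (y + \<epsilon>) \<le> \<Lambda> s - 5 * \<eta>" "\<Lambda> (s - d) + d * (y - \<epsilon>) \<le> \<Lambda> s - 5 * \<eta>"
    "c + 5 * \<eta> \<le> \<Lambda> s - s * y - \<bar>s\<bar> * \<epsilon>"
    unfolding \<eta>_def using s1 s2 c by (auto simp: min_def field_simps)
  obtain C0 where C0: "\<And>C. C \<ge> C0 \<Longrightarrow> C \<ge> 1 \<and> K * real C powr (- \<delta>) \<le> 1 / 2"
    using exists_truncation[OF pos(1), of "1 / 2" K] by auto
  have "\<forall>\<^sub>F C in sequentially. \<Lambda>\<^sub>C C s > \<Lambda> s - \<eta>"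
    by (rule order_tendstoD(1)[OF trunc[OF s(1)]]) (use \<eta> in simp)
  with trunc_pos[OF s(1)] trunc_lim[OF s(1)] eventually_ge_at_top[of C0]
  have "\<forall>\<^sub>F C in sequentially. (\<forall>k. 0 < mom (e k) {..C} s) \<and> C0 \<le> C \<and> \<Lambda>\<^sub>C C s > \<Lambda> s - \<eta>
    \<and> (\<lambda>n. (\<Sum>k<n. log_mom (e k) {..C} s) / real n) \<longlonglongrightarrow> \<Lambda>\<^sub>C C s"
    by eventually_elim auto
  then obtain C where C: "\<And>k. 0 < mom (e k) {..C} s" "C0 \<le> C" "\<Lambda>\<^sub>C C s > \<Lambda> s - \<eta>"
    "(\<lambda>n. (\<Sum>k<n. log_mom (e k) {..C} s) / real n) \<longlonglongrightarrow> \<Lambda>\<^sub>C C s"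
    by (auto simp: eventually_sequentially)
  have finC: "mom (e k) {..C} t < \<top>" if "t \<in> \<rat>" for k t
    using fin[OF that, of k] mom_mono[of "{..C}" UNIV "e k" t] by (auto intro: le_less_trans)
  have m1: "1 \<le> mom (e k) {..C} 0" for k
    using truncated_mean_ge[OF pos reg, of C "1 / 2"] C0[OF C(2)] by simp
  have sd: "s + d \<in> \<rat>" "s - d \<in> \<rat>" using s by auto
  have "\<forall>\<^sub>F n in sequentially. 2 * exp (- 2 * \<eta> * real n) \<le> 1 / 2"
    using \<eta>(1) by real_asymp
  moreover have "\<forall>\<^sub>F n in sequentially. exp (- 1 * \<eta> * real n) \<le> 1 / 2"
    using \<eta>(1) by real_asymp
  moreover note eventually_prod_bounds[OF conjI[OF C(1) finC[OF s(1)]] C(4) \<eta>(1)]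
  moreover note eventually_prod_bounds[OF fin[OF sd(1)] lim[OF sd(1)] \<eta>(1)]
  moreover note eventually_prod_bounds[OF fin[OF sd(2)] lim[OF sd(2)] \<eta>(1)]
  ultimately have "\<forall>\<^sub>F n in sequentially. ennreal (exp (real n * c))
    \<le> (\<integral>\<^sup>+\<omega>. weight {..C} (indicator {z. \<bar>z - real n * y\<bar> < real n * \<epsilon>}) n 0 \<omega> \<partial>tree_law e)"
    using eventually_gt_at_top[of 0]
  proof eventually_elim
    case (elim n)
    let ?I = "indicator {z. \<bar>z - real n * y\<bar> < real n * \<epsilon>} :: real \<Rightarrow> ennreal"
    have [measurable]: "?I \<in> borel_measurable borel" by measurable
    let ?E = "\<integral>\<^sup>+\<omega>. weight {..C} ?I n 0 \<omega> \<partial>tree_law e"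
    let ?a = "exp (real n * (s * y + \<bar>s\<bar> * \<epsilon>))"
    let ?b1 = "exp (- real n * (d * (y + \<epsilon>)))" and ?b2 = "exp (real n * (d * (y - \<epsilon>)))"
    let ?h = "\<lambda>t z. ennreal (exp (t * z))"
    have EW: "(\<integral>\<^sup>+\<omega>. weight {..C} (?h t) n 0 \<omega> \<partial>tree_law e) = (\<Prod>k<n. mom (e k) {..C} t)" for t
      by (simp add: nn_integral_weight_exp[OF e])
    have pw: "?h s z \<le> ennreal ?a * ?I z + (ennreal ?b1 * ?h (s + d) z + ennreal ?b2 * ?h (s - d) z)" for z
    proof -
      have "exp (s * z) \<le> ?a" if "\<bar>z - real n * y\<bar> < real n * \<epsilon>"
      proof -
        have "s * (z - real n * y) \<le> \<bar>s\<bar> * \<bar>z - real n * y\<bar>" by (metis abs_ge_self abs_mult)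
        also have "\<dots> \<le> \<bar>s\<bar> * (real n * \<epsilon>)" using that by (intro mult_left_mono) auto
        finally show ?thesis by (simp add: algebra_simps)
      qed
      moreover have "exp (s * z) \<le> ?b1 * exp ((s + d) * z)" if "z \<ge> real n * y + real n * \<epsilon>"
      proof -
        have "0 \<le> d * (z - (real n * y + real n * \<epsilon>))" using s(3) that by simp
        then show ?thesis by (simp add: mult_exp_exp algebra_simps)
      qed
      moreover have "exp (s * z) \<le> ?b2 * exp ((s - d) * z)" if "z \<le> real n * y - real n * \<epsilon>"
      proof -
        have "0 \<le> d * (real n * y - real n * \<epsilon> - z)" using s(3) that by simp
        then show ?thesis by (simp add: mult_exp_exp algebra_simps)
      qed
      ultimately have "exp (s * z) \<le> ?a * indicator {z. \<bar>z - real n * y\<bar> < real n * \<epsilon>} z + (?b1 * exp ((s + d) * z) + ?b2 * exp ((s - d) * z))"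
        by (cases "\<bar>z - real n * y\<bar> < real n * \<epsilon>"; cases "z \<ge> real n * y + real n * \<epsilon>")
           (auto intro: add_increasing2 add_increasing order_trans)
      then have "?h s z \<le> ennreal (?a * indicator {z. \<bar>z - real n * y\<bar> < real n * \<epsilon>} z + (?b1 * exp ((s + d) * z) + ?b2 * exp ((s - d) * z)))"
        by (rule ennreal_leI)
      also have "\<dots> = ennreal ?a * ?I z + (ennreal ?b1 * ?h (s + d) z + ennreal ?b2 * ?h (s - d) z)"
        by (simp add: ennreal_plus ennreal_mult ennreal_indicator)
      finally show ?thesis .
    qed
    have "(\<Prod>k<n. mom (e k) {..C} s) \<le> (\<integral>\<^sup>+\<omega>. ennreal ?a * weight {..C} ?I n 0 \<omega>
       + (ennreal ?b1 * weight {..C} (?h (s + d)) n 0 \<omega> + ennreal ?b2 * weight {..C} (?h (s - d)) n 0 \<omega>) \<partial>tree_law e)"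
      unfolding EW[symmetric] weight_cmult[symmetric] weight_add[symmetric]
      by (intro nn_integral_mono weight_mono pw)
    also have "\<dots> = ennreal ?a * ?E + (ennreal ?b1 * (\<Prod>k<n. mom (e k) {..C} (s + d)) + ennreal ?b2 * (\<Prod>k<n. mom (e k) {..C} (s - d)))"
      by (simp add: nn_integral_add nn_integral_cmult EW)
    also have "\<dots> \<le> ennreal ?a * ?E + (ennreal ?b1 * ennreal (exp (real n * (\<Lambda> (s + d) + \<eta>))) + ennreal ?b2 * ennreal (exp (real n * (\<Lambda> (s - d) + \<eta>))))"
    proof (intro add_left_mono add_mono mult_left_mono)
      show "(\<Prod>k<n. mom (e k) {..C} (s + d)) \<le> ennreal (exp (real n * (\<Lambda> (s + d) + \<eta>)))"
        using elim(4) by (intro order_trans[OF prod_mono_ennreal[OF mom_mono[of "{..C}" UNIV]]]) auto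
      show "(\<Prod>k<n. mom (e k) {..C} (s - d)) \<le> ennreal (exp (real n * (\<Lambda> (s - d) + \<eta>)))"
        using elim(5) by (intro order_trans[OF prod_mono_ennreal[OF mom_mono[of "{..C}" UNIV]]]) auto
    qed auto
    also have "ennreal ?b1 * ennreal (exp (real n * (\<Lambda> (s + d) + \<eta>))) \<le> ennreal (exp (real n * (\<Lambda> s - 4 * \<eta>)))"
    proof -
      have "real n * (\<Lambda> (s + d) - d * (y + \<epsilon>) + \<eta>) \<le> real n * (\<Lambda> s - 4 * \<eta>)"
        using \<eta>(2) by (intro mult_left_mono) auto
      then show ?thesis by (simp add: ennreal_mult[symmetric] mult_exp_exp algebra_simps)
    qed
    also have "ennreal ?b2 * ennreal (exp (real n * (\<Lambda> (s - d) + \<eta>))) \<le> ennreal (exp (real n * (\<Lambda> s - 4 * \<eta>)))"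
    proof -
      have "real n * (\<Lambda> (s - d) + d * (y - \<epsilon>) + \<eta>) \<le> real n * (\<Lambda> s - 4 * \<eta>)"
        using \<eta>(3) by (intro mult_left_mono) auto
      then show ?thesis by (simp add: ennreal_mult[symmetric] mult_exp_exp algebra_simps)
    qed
    finally have le: "(\<Prod>k<n. mom (e k) {..C} s) \<le> ennreal ?a * ?E + (ennreal (exp (real n * (\<Lambda> s - 4 * \<eta>))) + ennreal (exp (real n * (\<Lambda> s - 4 * \<eta>))))"
      by (simp add: add_left_mono add_mono)
    show ?case
    proof (cases ?E rule: ennreal_cases)
      case (real E)
      have "ennreal (exp (real n * (\<Lambda> s - 2 * \<eta>))) \<le> ennreal (exp (real n * (\<Lambda>\<^sub>C C s - \<eta>)))"
        using C(3) by (intro ennreal_leI iffD2[OF exp_le_cancel_iff] mult_left_mono) auto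
      also have "\<dots> \<le> ennreal ?a * ?E + (ennreal (exp (real n * (\<Lambda> s - 4 * \<eta>))) + ennreal (exp (real n * (\<Lambda> s - 4 * \<eta>))))"
        using elim(3) le by (meson order_trans)
      also have "\<dots> = ennreal (?a * E + 2 * exp (real n * (\<Lambda> s - 4 * \<eta>)))"
        using real by (simp add: ennreal_mult[symmetric] ennreal_plus[symmetric] del: ennreal_plus)
      finally have "exp (real n * (\<Lambda> s - 2 * \<eta>)) \<le> ?a * E + 2 * exp (real n * (\<Lambda> s - 4 * \<eta>))"
        using real by (subst (asm) ennreal_le_iff) auto
      moreover have "2 * exp (real n * (\<Lambda> s - 4 * \<eta>)) = 2 * exp (- 2 * \<eta> * real n) * exp (real n * (\<Lambda> s - 2 * \<eta>))"
        by (simp add: mult_exp_exp algebra_simps)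
      moreover have "2 * exp (- 2 * \<eta> * real n) * exp (real n * (\<Lambda> s - 2 * \<eta>)) \<le> 1 / 2 * exp (real n * (\<Lambda> s - 2 * \<eta>))"
        by (intro mult_right_mono elim(1)) simp
      ultimately have "1 / 2 * exp (real n * (\<Lambda> s - 2 * \<eta>)) \<le> ?a * E" by linarith
      moreover have "exp (- 1 * \<eta> * real n) * exp (real n * (\<Lambda> s - 2 * \<eta>)) \<le> 1 / 2 * exp (real n * (\<Lambda> s - 2 * \<eta>))"
        by (intro mult_right_mono elim(2)) simp
      ultimately have "exp (- 1 * \<eta> * real n) * exp (real n * (\<Lambda> s - 2 * \<eta>)) \<le> ?a * E" by linarith
      moreover have "?a * exp (real n * c) \<le> exp (- 1 * \<eta> * real n) * exp (real n * (\<Lambda> s - 2 * \<eta>))"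
      proof -
        have "real n * (s * y + \<bar>s\<bar> * \<epsilon> + c) \<le> real n * (\<Lambda> s - 3 * \<eta>)"
          using \<eta>(1,4) by (intro mult_left_mono) auto
        then show ?thesis by (simp add: mult_exp_exp algebra_simps)
      qed
      ultimately have "?a * exp (real n * c) \<le> ?a * E" by linarith
      then have "exp (real n * c) \<le> E" by simp
      then show ?thesis using real by (simp add: ennreal_leI)
    qed simp
  qed
  with m1 show ?thesis by blast
qed

text \<open>A slope y near x has rate at most L, and a window of width n \<epsilon> around n y lies
  in n A. The truncated mean of this window is divided by 1 + C n times the mean of Z_n, which costs
  the exponent \<Lambda> 0 and a subexponential factor.\<close>

lemma ratio_lower:
  assumes x: "x \<in> interior A" and c: "ereal c < - legendre \<Lambda> x - ereal (\<Lambda> 0)" and A: "A \<in> sets borel"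
  shows "\<forall>\<^sub>F n in sequentially. ennreal (exp (real n * c)) \<le> ratio e A n"
proof -
  note e = reg_offspring_laws[OF pos reg]
  note [measurable_cong] = sets_tree_law[OF e]
  have "legendre \<Lambda> x < ereal (- c - \<Lambda> 0)" using c by (cases "legendre \<Lambda> x") auto
  then obtain L where L: "legendre \<Lambda> x < ereal L" "ereal L < ereal (- c - \<Lambda> 0)" using ereal_dense2 by blast
  have Lt: "x * t - \<Lambda> t \<le> L" for t
  proof -
    have "ereal (x * t - \<Lambda> t) \<le> legendre \<Lambda> x" unfolding legendre_def by (rule SUP_upper) simp
    with L(1) have "ereal (x * t - \<Lambda> t) \<le> ereal L" by (meson order_trans less_imp_le)
    then show ?thesis by simp
  qed
  obtain r where r: "r > 0" "ball x r \<subseteq> A" using x by (auto simp: mem_interior)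
  from nearby_slope[OF deriv Lt, of "r / 2"] r(1) obtain t where
    t: "\<bar>\<Lambda>' t - x\<bar> < r / 2" "t * \<Lambda>' t - \<Lambda> t \<le> L" by auto
  define y where "y = \<Lambda>' t"
  \<comment> \<open>The slack between c and -L - \<Lambda> 0. A quarter covers the rational
    approximation of the tilt, a quarter the width of the window, and a quarter is kept in
    \<open>c'\<close>.\<close>
  define \<kappa> where "\<kappa> = - c - \<Lambda> 0 - L"
  have \<kappa>: "\<kappa> > 0" using L(2) by (simp add: \<kappa>_def)
  define \<epsilon> where "\<epsilon> = min (r / 2) (\<kappa> / (4 * (\<bar>t\<bar> + 1)))"
  have \<epsilon>: "\<epsilon> > 0" "\<epsilon> \<le> r / 2" "(\<bar>t\<bar> + 1) * \<epsilon> \<le> \<kappa> / 4"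
  proof -
    show "\<epsilon> > 0" using r \<kappa> by (auto simp: \<epsilon>_def)
    show "\<epsilon> \<le> r / 2" unfolding \<epsilon>_def by (rule min.cobounded1)
    have "(\<bar>t\<bar> + 1) * \<epsilon> \<le> (\<bar>t\<bar> + 1) * (\<kappa> / (4 * (\<bar>t\<bar> + 1)))"
      unfolding \<epsilon>_def by (intro mult_left_mono) auto
    also have "\<dots> = \<kappa> / 4"
    proof -
      have "a * (\<kappa> / (4 * a)) = \<kappa> / 4" if "a > 0" for a using that by simp
      from this[of "\<bar>t\<bar> + 1"] show ?thesis by simp
    qed
    finally show "(\<bar>t\<bar> + 1) * \<epsilon> \<le> \<kappa> / 4" .
  qed
  have "t * y - \<Lambda> t < L + \<kappa> / 4" using t(2) \<kappa> by (simp add: y_def)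
  from rational_near_slope[OF rate_continuous deriv[of t] \<epsilon>(1) this[unfolded y_def]]
  obtain s d where s: "s \<in> \<rat>" "d \<in> \<rat>" "d > 0" "\<Lambda> (s + d) - \<Lambda> s < d * (y + \<epsilon>)"
    "\<Lambda> (s - d) - \<Lambda> s < - d * (y - \<epsilon>)" "s * y - \<Lambda> s < L + \<kappa> / 4" "\<bar>s\<bar> < \<bar>t\<bar> + 1"
    unfolding y_def[symmetric] by blast
  have s\<epsilon>: "\<bar>s\<bar> * \<epsilon> \<le> \<kappa> / 4"
    using \<epsilon> s(7) mult_right_mono[of "\<bar>s\<bar>" "\<bar>t\<bar> + 1" \<epsilon>] by linarith
  \<comment> \<open>The reserve \<kappa> / 4 is spent in two halves: on the factor 1 + C n and on
    the deviation of the product of means from exp (n \<Lambda> 0).\<close>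
  define c' where "c' = c + \<Lambda> 0 + \<kappa> / 4"
  have "c' < \<Lambda> s - s * y - \<bar>s\<bar> * \<epsilon>" 
  proof -
    have "c + \<Lambda> 0 = - L - \<kappa>" by (simp add: \<kappa>_def)
    then show ?thesis unfolding c'_def using s(6) s\<epsilon> \<kappa> by linarith
  qed
  from truncated_local_lower[OF s(1-3) \<epsilon>(1) s(4,5) this]
  obtain C where C: "\<And>k. 1 \<le> mom (e k) {..C} 0" "\<forall>\<^sub>F n in sequentially. ennreal (exp (real n * c'))
     \<le> (\<integral>\<^sup>+\<omega>. weight {..C} (indicator {z. \<bar>z - real n * y\<bar> < real n * \<epsilon>}) n 0 \<omega> \<partial>tree_law e)"
    by blast
  have m1: "1 \<le> mom (e k) UNIV 0" for k
    using C(1) mom_mono[of "{..C}" UNIV "e k" 0] by (meson order_trans subset_UNIV)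
  have \<kappa>8: "\<kappa> / 8 > 0" using \<kappa> by simp
  have "\<forall>\<^sub>F n in sequentially. (1 + real C * real n) * exp (- (\<kappa> / 8) * real n) \<le> 1"
  proof (cases "C = 0")
    case True
    then show ?thesis using \<kappa>8 by simp
  next
    case False
    then have "real C > 0" by simp
    then show ?thesis using \<kappa>8 by real_asymp
  qed
  moreover note C(2)
  moreover note eventually_prod_bounds[OF fin[of 0] lim[of 0] \<kappa>8, simplified]
  ultimately show ?thesis using eventually_gt_at_top[of 0]
  proof eventually_elim
    case (elim n)
    let ?I = "indicator {z. \<bar>z - real n * y\<bar> < real n * \<epsilon>} :: real \<Rightarrow> ennreal"
    have I [measurable]: "?I \<in> borel_measurable borel" by measurable
    have sub: "?I z \<le> indicator ((\<lambda>x. real n * x) ` A) z" for z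
    proof (cases "\<bar>z - real n * y\<bar> < real n * \<epsilon>")
      case True
      have n: "real n > 0" using elim by simp
      have "z - real n * y = real n * (z / real n - y)" using n by (simp add: field_simps)
      then have "real n * \<bar>z / real n - y\<bar> < real n * \<epsilon>" using True n by (simp add: abs_mult)
      then have "\<bar>z / real n - y\<bar> < \<epsilon>" using n by simp
      then have "\<bar>z / real n - x\<bar> < r" using t(1) \<epsilon>(2) unfolding y_def by linarith
      then have "z / real n \<in> A" using r(2) by (auto simp: dist_real_def abs_minus_commute)
      then have "z \<in> (\<lambda>x. real n * x) ` A" using n by (intro image_eqI[of _ _ "z / real n"]) auto
      then show ?thesis by (simp add: indicator_def)
    qed simp
    define P where "P = exp (\<Sum>k<n. log_mom (e k) UNIV 0)"
    have P: "(\<Prod>k<n. mom (e k) UNIV 0) = ennreal P"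
      unfolding P_def using fin[of 0] by (intro prod_eq_exp_sum_ln) simp
    have P_le: "P \<le> exp (real n * (\<Lambda> 0 + \<kappa> / 8))" using elim(3) unfolding P by simp
    let ?E = "\<integral>\<^sup>+\<omega>. weight {..C} ?I n 0 \<omega> \<partial>tree_law e"
    have "?E \<le> (\<integral>\<^sup>+\<omega>. weight UNIV (\<lambda>_. 1) n 0 \<omega> \<partial>tree_law e)"
      by (intro nn_integral_mono order_trans[OF weight_mono_set[of _ UNIV] weight_mono]) (auto simp: indicator_def)
    also have "\<dots> = ennreal P" by (simp add: nn_integral_weight_one[OF e] P)
    finally obtain E where E: "?E = ennreal E" "E \<ge> 0" by (cases ?E rule: ennreal_cases) (auto simp: top_unique)
    have EE: "exp (real n * c') \<le> E" using elim(2) E by simp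
    have "ennreal (exp (real n * c)) \<le> ennreal (E / ((1 + real C * real n) * P))"
    proof (rule ennreal_leI)
      have pos': "(1 + real C * real n) * P > 0" by (auto simp: P_def intro!: mult_pos_pos add_pos_nonneg)
      have "exp (real n * c) * ((1 + real C * real n) * P) \<le> exp (real n * c) * ((1 + real C * real n) * exp (real n * (\<Lambda> 0 + \<kappa> / 8)))"
        using P_le by (intro mult_left_mono) auto
      also have "\<dots> = ((1 + real C * real n) * exp (- (\<kappa> / 8) * real n)) * exp (real n * c')"
        by (simp add: c'_def mult_exp_exp mult.assoc mult.left_commute) (simp add: algebra_simps mult_exp_exp)
      also have "\<dots> \<le> 1 * exp (real n * c')" by (intro mult_right_mono elim(1)) simp
      also have "\<dots> \<le> E" using EE by simp
      finally show "exp (real n * c) \<le> E / ((1 + real C * real n) * P)"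
        using pos' by (simp add: pos_le_divide_eq)
    qed
    also have "\<dots> \<le> (\<integral>\<^sup>+\<omega>. weight UNIV ?I n 0 \<omega> * inverse (pop n \<omega>) \<partial>tree_law e)"
      by (rule weight_times_inverse_pop_ge[OF e I m1 P E(1)])
    also have "\<dots> \<le> ratio e A n"
      unfolding ratio_def by (intro nn_integral_mono mult_right_mono weight_mono sub) simp
    finally show ?case .
  qed
qed

lemma ratio_large_deviations:
  assumes A: "A \<in> sets borel"
  shows "- (INF x\<in>interior A. legendre \<Lambda> x) - ereal (\<Lambda> 0) \<le> liminf (log_ratio e A)"
    and "limsup (log_ratio e A) \<le> - (INF x\<in>closure A. legendre \<Lambda> x) - ereal (\<Lambda> 0)"
proof -
  show "limsup (log_ratio e A) \<le> - (INF x\<in>closure A. legendre \<Lambda> x) - ereal (\<Lambda> 0)"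
  proof (rule dense_ge)
    fix z assume "- (INF x\<in>closure A. legendre \<Lambda> x) - ereal (\<Lambda> 0) < z"
    then obtain c where c: "- (INF x\<in>closure A. legendre \<Lambda> x) - ereal (\<Lambda> 0) < ereal c" "ereal c < z"
      using ereal_dense2 by blast
    from ratio_upper[OF c(1)] eventually_gt_at_top[of 0]
    have "\<forall>\<^sub>F n in sequentially. log_ratio e A n \<le> ereal c"
      by eventually_elim (rule scaled_elog_le)
    then have "limsup (log_ratio e A) \<le> ereal c" by (rule Limsup_bounded)
    with c(2) show "limsup (log_ratio e A) \<le> z" by simp
  qed
  show "- (INF x\<in>interior A. legendre \<Lambda> x) - ereal (\<Lambda> 0) \<le> liminf (log_ratio e A)"
  proof (rule dense_le)
    fix z assume "z < - (INF x\<in>interior A. legendre \<Lambda> x) - ereal (\<Lambda> 0)"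
    then obtain c where c: "z < ereal c" "ereal c < - (INF x\<in>interior A. legendre \<Lambda> x) - ereal (\<Lambda> 0)"
      using ereal_dense2 by blast
    then have "(INF x\<in>interior A. legendre \<Lambda> x) < ereal (- c - \<Lambda> 0)"
      by (cases "INF x\<in>interior A. legendre \<Lambda> x") auto
    then obtain x where x: "x \<in> interior A" "legendre \<Lambda> x < ereal (- c - \<Lambda> 0)" by (auto simp: INF_less_iff)
    then have "ereal c < - legendre \<Lambda> x - ereal (\<Lambda> 0)" by (cases "legendre \<Lambda> x") auto
    from ratio_lower[OF x(1) this A] eventually_gt_at_top[of 0]
    have "\<forall>\<^sub>F n in sequentially. ereal c \<le> log_ratio e A n"
      by eventually_elim (rule scaled_elog_ge)
    then have "ereal c \<le> liminf (log_ratio e A)" by (rule Liminf_bounded)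
    with c(1) show "z \<le> liminf (log_ratio e A)" by simp
  qed
qed

end

section \<open>Logarithmic moments of one offspring law\<close>

text \<open>Measurability of the derivative comes from writing it as a limit along the fixed steps 1
  / (i + 1); convexity supplies the domination.\<close>

lemma convex_integral_differentiable:
  fixes f :: "'b \<Rightarrow> real \<Rightarrow> real"
  assumes int: "\<And>t. integrable M (\<lambda>x. f x t)"
    and conv: "AE x in M. convex_on UNIV (f x)"
    and diff: "AE x in M. f x differentiable (at t)"
  shows "(\<lambda>t. \<integral>x. f x t \<partial>M) differentiable (at t)"
proof -
  define h where "h i = inverse (real (Suc i))" for i
  define f' where "f' x = lim (\<lambda>i. (f x (t + h i) - f x t) / h i)" for x
  have "f' \<in> borel_measurable M"
    unfolding f'_def using int
    by (intro borel_measurable_lim_metric borel_measurable_divide borel_measurable_diff borel_measurable_integrable) auto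
  moreover have "AE x in M. (f x has_real_derivative f' x) (at t)"
    using diff
  proof eventually_elim
    case (elim x)
    then obtain D where D: "(f x has_real_derivative D) (at t)" using real_differentiable_def by blast
    then have "((\<lambda>h. (f x (t + h) - f x t) / h) \<longlongrightarrow> D) (at 0)" by (simp add: DERIV_def)
    moreover have "filterlim h (at 0) sequentially"
      unfolding filterlim_at h_def using LIMSEQ_inverse_real_of_nat by (auto simp del: of_nat_Suc)
    ultimately have "(\<lambda>i. (f x (t + h i) - f x t) / h i) \<longlonglongrightarrow> D" by (rule filterlim_compose)
    then have "f' x = D" unfolding f'_def by (rule limI)
    with D show ?case by simp
  qed
  ultimately show ?thesis
    using convex_integral_has_real_derivative[OF int conv] real_differentiable_def by blast
qed

lemma measurable_elog [measurable]: "elog \<in> borel_measurable borel"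
  unfolding elog_def by measurable

lemma real_of_ereal_elog: "real_of_ereal (elog x) = ln (enn2real x)"
  by (auto simp: elog_def)

lemma ennreal_abs_le_elog: "ennreal \<bar>ln (enn2real x)\<bar> \<le> e2ennreal \<bar>elog x\<bar>"
  by (auto simp: elog_def)

lemma elog_finite: "e2ennreal \<bar>elog x\<bar> \<noteq> \<infinity> \<Longrightarrow> 0 < x \<and> x < \<top>"
  by (auto simp: elog_def less_top[symmetric] zero_less_iff_neq_zero split: if_splits)

lemma nn_integral_root:
  assumes e: "offspring_laws e" and g: "g \<in> borel_measurable offspring_space"
  shows "(\<integral>\<^sup>+\<omega>. g (\<omega> []) \<partial>tree_law e) = (\<integral>\<^sup>+x. g x \<partial>e 0)"
proof -
  have d: "distr (tree_law e) (e 0) (\<lambda>\<omega>. \<omega> []) = e 0"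
    using distr_PiM_component[of UNIV "\<lambda>u. e (length u)" "[]"] offspring_laws_prob[OF e] by (simp add: tree_law_def)
  have m: "(\<lambda>\<omega>. \<omega> []) \<in> tree_law e \<rightarrow>\<^sub>M e 0"
    unfolding tree_law_def using measurable_component_singleton[of "[]" UNIV "\<lambda>u. e (length u)"] by simp
  have "g \<in> borel_measurable (e 0)" by (rule measurable_offspring_laws[OF e g])
  with nn_integral_distr[OF m, of g] show ?thesis unfolding d by simp
qed

context
  fixes \<nu> :: "offspring measure"
  assumes prob: "prob_space \<nu>" and sets: "sets \<nu> = sets offspring_space"
    and two: "AE x in \<nu>. 2 \<le> fst x" and fin: "\<And>t. mom \<nu> UNIV t < \<top>"
begin

lemma measurable_offspring: "f \<in> offspring_space \<rightarrow>\<^sub>M N \<Longrightarrow> f \<in> \<nu> \<rightarrow>\<^sub>M N"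
  using measurable_cong_sets[OF sets refl] by blast

lemma mom_integrand_measurable:
  "(\<lambda>x. \<Sum>i<fst x. exp (t * snd x i)) \<in> borel_measurable \<nu>"
  by (rule measurable_offspring, rule measurable_compose_countable[OF _ measurable_fst_offspring,
        of "\<lambda>n x. \<Sum>i<n. exp (t * snd x i)"]) measurable

lemma mom_eq: "mom \<nu> UNIV t = (\<integral>\<^sup>+x. ennreal (\<Sum>i<fst x. exp (t * snd x i)) \<partial>\<nu>)"
  unfolding mom_def by (intro nn_integral_cong) simp

lemma mom_integrable: "integrable \<nu> (\<lambda>x. \<Sum>i<fst x. exp (t * snd x i))"
  using fin[of t] mom_integrand_measurable unfolding mom_eq
  by (intro integrableI_bounded) (auto simp: sum_nonneg)

lemma enn2real_mom: "enn2real (mom \<nu> UNIV t) = (\<integral>x. (\<Sum>i<fst x. exp (t * snd x i)) \<partial>\<nu>)"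
  using nn_integral_eq_integral[OF mom_integrable, of t]
  by (simp add: mom_eq sum_nonneg Bochner_Integration.integral_nonneg)

lemma mom_pos: "0 < mom \<nu> UNIV t"
proof (rule ccontr)
  interpret prob_space \<nu> by (rule prob)
  assume "\<not> 0 < mom \<nu> UNIV t"
  then have "(\<integral>\<^sup>+x. ennreal (\<Sum>i<fst x. exp (t * snd x i)) \<partial>\<nu>) = 0" by (simp add: mom_eq)
  then have "AE x in \<nu>. ennreal (\<Sum>i<fst x. exp (t * snd x i)) = 0"
    using mom_integrand_measurable by (subst (asm) nn_integral_0_iff_AE) auto
  with two have "AE x in \<nu>. False"
  proof eventually_elim
    case (elim x)
    have "0 < (\<Sum>i<fst x. exp (t * snd x i))" using elim(1) by (intro sum_pos) (auto simp: lessThan_empty_iff)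
    with elim(2) show ?case by (simp add: ennreal_eq_0_iff)
  qed
  then show False by simp
qed

text \<open>Hoelder's inequality in the form of Young's: with each moment normalized to 1, convexity
  of exp applies pointwise to every summand and the weights integrate to 1.\<close>

lemma ln_mom_convex: "convex_on UNIV (\<lambda>t. log_mom \<nu> UNIV t)"
proof (rule convex_onI)
  fix a s t :: real assume a: "0 < a" "a < 1"
  let ?G = "\<lambda>t. enn2real (mom \<nu> UNIV t)" and ?u = "(1 - a) * s + a * t"
  have G: "?G t > 0" for t using mom_pos[of t] fin[of t] by (simp add: enn2real_positive_iff)
  define q where "q = (1 - a) * ln (?G s) + a * ln (?G t)"
  let ?S = "\<lambda>t x. \<Sum>i<fst x. exp (t * snd x i)"
  have young: "exp (?u * l) \<le> exp q * ((1 - a) * (exp (s * l) / ?G s) + a * (exp (t * l) / ?G t))" for l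
  proof -
    have "exp ((1 - a) * (s * l - ln (?G s)) + a * (t * l - ln (?G t)))
      \<le> (1 - a) * exp (s * l - ln (?G s)) + a * exp (t * l - ln (?G t))"
      using convex_onD[OF exp_convex, of a "s * l - ln (?G s)" "t * l - ln (?G t)"] a by simp
    also have "\<dots> = (1 - a) * (exp (s * l) / ?G s) + a * (exp (t * l) / ?G t)"
      using G by (simp add: exp_diff)
    finally have "exp q * exp ((1 - a) * (s * l - ln (?G s)) + a * (t * l - ln (?G t)))
      \<le> exp q * ((1 - a) * (exp (s * l) / ?G s) + a * (exp (t * l) / ?G t))" by simp
    moreover have "exp q * exp ((1 - a) * (s * l - ln (?G s)) + a * (t * l - ln (?G t))) = exp (?u * l)"
      by (simp add: mult_exp_exp q_def algebra_simps)
    ultimately show ?thesis by simp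
  qed
  have "?G ?u \<le> (\<integral>x. exp q * ((1 - a) * (?S s x / ?G s) + a * (?S t x / ?G t)) \<partial>\<nu>)"
    unfolding enn2real_mom[of ?u]
  proof (rule integral_mono[OF mom_integrable])
    show "integrable \<nu> (\<lambda>x. exp q * ((1 - a) * (?S s x / ?G s) + a * (?S t x / ?G t)))"
      by (intro integrable_mult_right Bochner_Integration.integrable_add integrable_divide mom_integrable)
    fix x :: offspring
    have "?S ?u x \<le> (\<Sum>i<fst x. exp q * ((1 - a) * (exp (s * snd x i) / ?G s) + a * (exp (t * snd x i) / ?G t)))"
      by (intro sum_mono young)
    also have "\<dots> = exp q * ((1 - a) * (?S s x / ?G s) + a * (?S t x / ?G t))"
      by (simp add: sum_distrib_left sum_divide_distrib sum.distrib distrib_left)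
    finally show "?S ?u x \<le> exp q * ((1 - a) * (?S s x / ?G s) + a * (?S t x / ?G t))" .
  qed
  also have "\<dots> = exp q * ((1 - a) * ((\<integral>x. ?S s x \<partial>\<nu>) / ?G s) + a * ((\<integral>x. ?S t x \<partial>\<nu>) / ?G t))"
    using mom_integrable by simp
  also have "\<dots> = exp q * ((1 - a) * (?G s / ?G s) + a * (?G t / ?G t))"
    unfolding enn2real_mom ..
  also have "\<dots> = exp q" using G[of s] G[of t] by simp
  finally have "ln (?G ?u) \<le> ln (exp q)" using G[of ?u] by (subst ln_le_cancel_iff) auto
  then show "ln (?G ((1 - a) *\<^sub>R s + a *\<^sub>R t)) \<le> (1 - a) * ln (?G s) + a * ln (?G t)"
    by (simp add: q_def)
qed simp

lemma ln_mom_differentiable: "(\<lambda>t. log_mom \<nu> UNIV t) differentiable (at t)"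
proof -
  have conv: "convex_on UNIV (\<lambda>t. \<Sum>i<n. exp (t * l i))" for n :: nat and l :: "nat \<Rightarrow> real"
  proof (rule convex_onI)
    fix a s t :: real assume a: "0 < a" "a < 1"
    have "exp (((1 - a) * s + a * t) * l i) \<le> (1 - a) * exp (s * l i) + a * exp (t * l i)" for i
      using convex_onD[OF exp_convex, of a "s * l i" "t * l i"] a by (simp add: algebra_simps)
    then have "(\<Sum>i<n. exp (((1 - a) * s + a * t) * l i)) \<le> (\<Sum>i<n. (1 - a) * exp (s * l i) + a * exp (t * l i))"
      by (intro sum_mono)
    then show "(\<Sum>i<n. exp (((1 - a) *\<^sub>R s + a *\<^sub>R t) * l i)) \<le> (1 - a) * (\<Sum>i<n. exp (s * l i)) + a * (\<Sum>i<n. exp (t * l i))"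
      by (simp add: sum.distrib sum_distrib_left)
  qed simp
  have "(\<lambda>t. \<Sum>i<n. exp (t * l i)) differentiable (at t)" for n :: nat and l :: "nat \<Rightarrow> real"
    unfolding real_differentiable_def by (rule exI) (auto intro!: derivative_eq_intros)
  then have "(\<lambda>t. \<integral>x. (\<Sum>i<fst x. exp (t * snd x i)) \<partial>\<nu>) differentiable (at t)"
    using conv by (intro convex_integral_differentiable mom_integrable) auto
  then have "(\<lambda>t. enn2real (mom \<nu> UNIV t)) differentiable (at t)" by (simp only: enn2real_mom)
  then obtain D where "((\<lambda>t. enn2real (mom \<nu> UNIV t)) has_real_derivative D) (at t)"
    unfolding real_differentiable_def by blast
  moreover have "0 < enn2real (mom \<nu> UNIV t)"
    using mom_pos[of t] fin[of t] by (simp add: enn2real_positive_iff)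
  ultimately have "((\<lambda>t. log_mom \<nu> UNIV t) has_real_derivative 1 / enn2real (mom \<nu> UNIV t) * D) (at t)"
    by (intro DERIV_chain2[of ln] DERIV_ln_divide)
  then show ?thesis unfolding real_differentiable_def by blast
qed

lemma mom_truncated_tendsto: "(\<lambda>C. mom \<nu> {..C} t) \<longlonglongrightarrow> mom \<nu> UNIV t"
  unfolding mom_def
proof (rule nn_integral_LIMSEQ)
  show "incseq (\<lambda>C x. if fst x \<in> {..C} then \<Sum>i<fst x. ennreal (exp (t * snd x i)) else 0)"
    by (auto simp: incseq_def le_fun_def)
  show "(\<lambda>x. if fst x \<in> {..C} then \<Sum>i<fst x. ennreal (exp (t * snd x i)) else 0) \<in> borel_measurable \<nu>" for C
    by (rule measurable_offspring[OF measurable_mom_integrand])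
  show "(\<lambda>C. if fst x \<in> {..C} then \<Sum>i<fst x. ennreal (exp (t * snd x i)) else 0)
    \<longlonglongrightarrow> (if fst x \<in> UNIV then \<Sum>i<fst x. ennreal (exp (t * snd x i)) else 0)" for x
    by (rule tendsto_eventually) (auto simp: eventually_sequentially intro!: exI[of _ "fst x"])
qed

lemma ln_mom_truncated_tendsto:
  "(\<lambda>C. log_mom \<nu> {..C} t) \<longlonglongrightarrow> log_mom \<nu> UNIV t"
proof (rule tendsto_ln)
  show "(\<lambda>C. enn2real (mom \<nu> {..C} t)) \<longlonglongrightarrow> enn2real (mom \<nu> UNIV t)"
    using mom_truncated_tendsto[of t] fin[of t] by (intro tendsto_enn2real) (auto simp: less_top[symmetric])
  show "enn2real (mom \<nu> UNIV t) \<noteq> 0"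
    using mom_pos[of t] fin[of t] by (auto simp: enn2real_eq_0_iff)
qed

text \<open>With probability at least 1 / 4 both N \<le> C and |L_1| < 4 (l + 1), and then child 0
  alone contributes at least exp (- 4 |t| (l + 1)). The bound does not depend on C, so it can serve
  as a minorant when C tends to infinity.\<close>

lemma mom_truncated_ge:
  assumes C: "emeasure \<nu> {x \<in> space \<nu>. C < fst x} \<le> ennreal (1 / 2)"
    and l: "(\<integral>\<^sup>+x. ennreal \<bar>snd x 0\<bar> \<partial>\<nu>) \<le> ennreal l" "l \<ge> 0"
  shows "ennreal (exp (- (ln 4 + 4 * \<bar>t\<bar> * (l + 1)))) \<le> mom \<nu> {..C} t"
proof -
  interpret prob_space \<nu> by (rule prob)
  have m1: "(\<lambda>x. snd x 0) \<in> borel_measurable \<nu>" by (rule measurable_offspring[OF measurable_snd_offspring])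
  have m2: "fst \<in> \<nu> \<rightarrow>\<^sub>M count_space UNIV" by (rule measurable_offspring[OF measurable_fst_offspring])
  let ?B = "{x \<in> space \<nu>. C < fst x}" and ?D = "{x \<in> space \<nu>. 4 * (l + 1) \<le> \<bar>snd x 0\<bar>}"
  have B: "?B \<in> events" by (rule measurable_sets_Collect[OF m2]) simp
  have D: "?D \<in> events" using m1 by measurable
  have pB: "prob ?B \<le> 1 / 2" using C by (simp add: emeasure_eq_measure del: ennreal_half)
  \<comment> \<open>Markov's inequality at 4 (l + 1); the added 1 keeps the threshold positive when
    l = 0.\<close>
  have pD: "prob ?D \<le> 1 / 4"
  proof -
    have "ennreal (4 * (l + 1)) * emeasure \<nu> ?D = (\<integral>\<^sup>+x. ennreal (4 * (l + 1)) * indicator ?D x \<partial>\<nu>)"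
      using D by (simp add: nn_integral_cmult)
    also have "\<dots> \<le> (\<integral>\<^sup>+x. ennreal \<bar>snd x 0\<bar> \<partial>\<nu>)"
      by (intro nn_integral_mono) (auto simp: indicator_def intro!: ennreal_leI)
    also have "\<dots> \<le> ennreal l" by (rule l)
    finally have "ennreal (4 * (l + 1) * prob ?D) \<le> ennreal l"
      using l by (simp add: emeasure_eq_measure ennreal_mult)
    then have "4 * (l + 1) * prob ?D \<le> l" using l by simp
    then have "(l + 1) * (4 * prob ?D) \<le> (l + 1) * 1" by argo
    then have "4 * prob ?D \<le> 1" using l by (subst (asm) mult_le_cancel_left_pos) auto
    then show ?thesis by simp
  qed
  let ?A = "space \<nu> - (?B \<union> ?D)"
  have A: "?A \<in> events" using B D by auto
  have "1 / 4 \<le> prob ?A"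
    using measure_Un_le[OF B D] pB pD prob_compl[of "?B \<union> ?D"] B D by auto
  note le = this
  have "ennreal (exp (- (ln 4 + 4 * \<bar>t\<bar> * (l + 1)))) \<le> ennreal (exp (- (4 * \<bar>t\<bar> * (l + 1))) * prob ?A)"
  proof (intro ennreal_leI)
    have "exp (- (ln 4 + 4 * \<bar>t\<bar> * (l + 1))) = exp (- (4 * \<bar>t\<bar> * (l + 1))) * (1 / 4 :: real)"
    proof -
      have "exp (- ln 4) = (1 / 4 :: real)" by (simp add: exp_minus)
      then show ?thesis by (simp only: minus_add_distrib exp_add mult.commute)
    qed
    also have "\<dots> \<le> exp (- (4 * \<bar>t\<bar> * (l + 1))) * prob ?A" by (intro mult_left_mono le) simp
    finally show "exp (- (ln 4 + 4 * \<bar>t\<bar> * (l + 1))) \<le> exp (- (4 * \<bar>t\<bar> * (l + 1))) * prob ?A" .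
  qed
  also have "\<dots> = (\<integral>\<^sup>+x. ennreal (exp (- (4 * \<bar>t\<bar> * (l + 1)))) * indicator ?A x \<partial>\<nu>)"
    using A by (simp add: nn_integral_cmult emeasure_eq_measure ennreal_mult)
  also have "\<dots> \<le> mom \<nu> {..C} t"
    unfolding mom_def
  proof (intro nn_integral_mono_AE, use two in eventually_elim)
    fix x :: offspring assume x: "2 \<le> fst x"
    show "ennreal (exp (- (4 * \<bar>t\<bar> * (l + 1)))) * indicator ?A x
      \<le> (if fst x \<in> {..C} then \<Sum>i<fst x. ennreal (exp (t * snd x i)) else 0)"
    proof (cases "x \<in> ?A")
      case True
      then have *: "fst x \<le> C" "\<bar>snd x 0\<bar> \<le> 4 * (l + 1)" by auto
      have "- (t * snd x 0) \<le> \<bar>t\<bar> * \<bar>snd x 0\<bar>" by (metis abs_ge_minus_self abs_mult)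
      also have "\<dots> \<le> \<bar>t\<bar> * (4 * (l + 1))" by (intro mult_left_mono *) simp
      finally have "ennreal (exp (- (4 * \<bar>t\<bar> * (l + 1)))) \<le> ennreal (exp (t * snd x 0))"
        by (intro ennreal_leI) (simp add: algebra_simps)
      also have "\<dots> \<le> (\<Sum>i<fst x. ennreal (exp (t * snd x i)))"
        using x by (intro member_le_sum) auto
      finally show ?thesis using True * by simp
    qed simp
  qed
  finally show ?thesis .
qed

end

text \<open>For |t| < n, exp (t l) is at most exp (n l) + exp (- n l). Countably many parameters,
  hence one null set of environments, thus settle finiteness at every real t.\<close>

lemma mom_finite_all:
  assumes sets: "sets \<nu> = sets offspring_space" and fin: "\<And>t. t \<in> \<rat> \<Longrightarrow> mom \<nu> UNIV t < \<top>"
  shows "mom \<nu> UNIV t < \<top>"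
proof -
  obtain n :: nat where n: "\<bar>t\<bar> < real n" using reals_Archimedean2 by blast
  let ?S = "\<lambda>t x. (if fst x \<in> UNIV then \<Sum>i<fst x. ennreal (exp (t * snd x i)) else 0)"
  have "mom \<nu> UNIV t \<le> (\<integral>\<^sup>+x. ?S (real n) x + ?S (- real n) x \<partial>\<nu>)"
    unfolding mom_def
  proof (intro nn_integral_mono)
    fix x :: offspring
    have "exp (t * l) \<le> exp (real n * l) + exp (- real n * l)" for l
    proof (cases "l \<ge> 0")
      case True
      then have "t * l \<le> real n * l" using n by (intro mult_right_mono) auto
      then have "exp (t * l) \<le> exp (real n * l)" by simp
      then show ?thesis by (simp add: add_increasing2)
    next
      case False
      then have "t * l \<le> - real n * l" using n by (intro mult_right_mono_neg) auto
      then have "exp (t * l) \<le> exp (- real n * l)" by simp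
      then show ?thesis by (simp add: add_increasing)
    qed
    then have "ennreal (exp (t * l)) \<le> ennreal (exp (real n * l)) + ennreal (exp (- real n * l))" for l
      by (simp flip: ennreal_plus)
    then show "?S t x \<le> ?S (real n) x + ?S (- real n) x"
      by (simp add: sum.distrib[symmetric] sum_mono del: sum_ennreal)
  qed
  also have "\<dots> = mom \<nu> UNIV (real n) + mom \<nu> UNIV (- real n)"
    unfolding mom_def using measurable_mom_integrand[of UNIV] measurable_cong_sets[OF sets refl]
    by (intro nn_integral_add) blast+
  also have "\<dots> < \<top>" using fin by (simp add: less_top[symmetric])
  finally show ?thesis .
qed

section \<open>The random environment\<close>

lemma (in branching_random_walk_in_random_environment) space_env:
  "space \<tau> = {\<xi>. \<forall>n. \<xi> n \<in> space \<Theta>}"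
  using sets_eq_imp_space_eq[OF sets_env] by (auto simp: space_PiM)

context branching_random_walk_in_random_environment
begin

interpretation \<tau>: prob_space \<tau> by (rule prob_space_env)

lemma env_offspring_laws: "\<xi> \<in> space \<tau> \<Longrightarrow> offspring_laws (\<lambda>n. \<eta> (\<xi> n))"
  using measurable_space[OF measurable_offspring_law]
  by (auto simp: offspring_laws_def space_env space_prob_algebra)

lemma quenched_eq_tree_law: "quenched \<eta> \<xi> = tree_law (\<lambda>n. \<eta> (\<xi> n))"
  by (simp add: quenched_def tree_law_def)

lemma measurable_coordinate: "(\<lambda>\<xi>. \<xi> n) \<in> \<tau> \<rightarrow>\<^sub>M \<Theta>"
  using measurable_component_singleton[of n UNIV "\<lambda>_. \<Theta>"] measurable_cong_sets[OF sets_env refl] by blast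

lemma measurable_env_law: "(\<lambda>\<xi>. \<eta> (\<xi> n)) \<in> \<tau> \<rightarrow>\<^sub>M subprob_algebra offspring_space"
  by (rule measurable_prob_algebraD[OF measurable_compose[OF measurable_coordinate measurable_offspring_law]])

lemma measurable_nn_integral_env:
  assumes "f \<in> borel_measurable offspring_space"
  shows "(\<lambda>\<xi>. \<integral>\<^sup>+x. f x \<partial>\<eta> (\<xi> 0)) \<in> borel_measurable \<tau>"
  by (rule measurable_compose[OF measurable_env_law nn_integral_measurable_subprob_algebra[OF assms]])

lemma measurable_mom_env: "(\<lambda>\<xi>. mom (\<eta> (\<xi> 0)) G t) \<in> borel_measurable \<tau>"
  unfolding mom_def by (rule measurable_nn_integral_env[OF measurable_mom_integrand])

lemma m0_exp_eq_mom:
  assumes "\<xi> \<in> space \<tau>"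
  shows "m0_exp \<eta> \<xi> t = mom (\<eta> (\<xi> 0)) UNIV t"
proof -
  have "m0_exp \<eta> \<xi> t = (\<integral>\<^sup>+\<omega>. weight UNIV (\<lambda>y. ennreal (exp (t * y))) 1 0 \<omega> \<partial>tree_law (\<lambda>n. \<eta> (\<xi> n)))"
    by (simp add: m0_exp_def quenched_eq_tree_law weight.simps num_children_def displacement_def)
  then show ?thesis using nn_integral_weight_exp[OF env_offspring_laws[OF assms], of UNIV t 1 0] by simp
qed

lemma m0_eq_mom:
  assumes "\<xi> \<in> space \<tau>"
  shows "m0 \<eta> \<xi> = mom (\<eta> (\<xi> 0)) UNIV 0"
  unfolding m0_exp_eq_mom[OF assms, symmetric] by (simp add: m0_def m0_exp_def ennreal_of_nat_eq_real_of_nat)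

lemma Lam_eq: "Lam \<eta> \<tau> t = (\<integral>\<xi>. log_mom (\<eta> (\<xi> 0)) UNIV t \<partial>\<tau>)"
  unfolding Lam_def real_of_ereal_elog
  by (intro Bochner_Integration.integral_cong) (auto simp: m0_exp_eq_mom)

lemma mean_log_m0_eq: "mean_log_m0 \<eta> \<tau> = Lam \<eta> \<tau> 0"
  unfolding mean_log_m0_def Lam_eq real_of_ereal_elog
  by (intro Bochner_Integration.integral_cong) (auto simp: m0_eq_mom)

lemma measurable_shift: "shift \<in> \<tau> \<rightarrow>\<^sub>M \<tau>"
proof -
  have "shift \<in> PiM UNIV (\<lambda>_. \<Theta>) \<rightarrow>\<^sub>M PiM UNIV (\<lambda>_. \<Theta>)"
    unfolding shift_def by (rule measurable_PiM_single') (auto simp: space_PiM)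
  then show ?thesis using measurable_cong_sets[OF sets_env sets_env] by blast
qed

lemma funpow_shift: "(shift ^^ k) \<xi> = (\<lambda>n. \<xi> (k + n))"
  by (induction k arbitrary: \<xi>) (auto simp: shift_def)

text \<open>Stationarity moves the property along the shift, and only countably many null sets are
  united.\<close>

lemma AE_env_all:
  assumes "AE \<xi> in \<tau>. P (\<eta> (\<xi> 0))"
  shows "AE \<xi> in \<tau>. \<forall>k. P (\<eta> (\<xi> k))"
  using AE_funpow_preserving[OF prob_space_env measurable_shift stationary_env[unfolded stationary_def] assms]
  by (simp add: funpow_shift)

lemma birkhoff_env:
  assumes "integrable \<tau> f"
  shows "AE \<xi> in \<tau>. (\<lambda>n. (\<Sum>k<n. f (\<lambda>i. \<xi> (k + i))) / real n) \<longlonglongrightarrow> (\<integral>\<xi>. f \<xi> \<partial>\<tau>)"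
  using birkhoff_ergodic[OF prob_space_env measurable_shift stationary_env[unfolded stationary_def] _ assms]
    ergodic_env unfolding ergodic_def funpow_shift by blast

lemma AE_mom_finite: "AE \<xi> in \<tau>. mom (\<eta> (\<xi> 0)) UNIV t < \<top>"
proof -
  have "AE \<xi> in \<tau>. e2ennreal \<bar>elog (mom (\<eta> (\<xi> 0)) UNIV t)\<bar> \<noteq> \<infinity>"
  proof (rule nn_integral_PInf_AE)
    have [measurable]: "(\<lambda>\<xi>. mom (\<eta> (\<xi> 0)) UNIV t) \<in> borel_measurable \<tau>" by (rule measurable_mom_env)
    show "(\<lambda>\<xi>. e2ennreal \<bar>elog (mom (\<eta> (\<xi> 0)) UNIV t)\<bar>) \<in> borel_measurable \<tau>" by measurable
    have "(\<integral>\<^sup>+\<xi>. e2ennreal \<bar>elog (mom (\<eta> (\<xi> 0)) UNIV t)\<bar> \<partial>\<tau>) = (\<integral>\<^sup>+\<xi>. e2ennreal \<bar>elog (m0_exp \<eta> \<xi> t)\<bar> \<partial>\<tau>)"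
      by (intro nn_integral_cong) (simp add: m0_exp_eq_mom)
    then show "(\<integral>\<^sup>+\<xi>. e2ennreal \<bar>elog (mom (\<eta> (\<xi> 0)) UNIV t)\<bar> \<partial>\<tau>) \<noteq> \<infinity>"
      using log_m0_exp_integrable[of t] by simp
  qed
  then show ?thesis by eventually_elim (use elog_finite in blast)
qed

lemma integrable_ln_mom: "integrable \<tau> (\<lambda>\<xi>. log_mom (\<eta> (\<xi> 0)) UNIV t)"
proof (rule integrableI_bounded)
  have [measurable]: "(\<lambda>\<xi>. mom (\<eta> (\<xi> 0)) UNIV t) \<in> borel_measurable \<tau>" by (rule measurable_mom_env)
  show "(\<lambda>\<xi>. log_mom (\<eta> (\<xi> 0)) UNIV t) \<in> borel_measurable \<tau>" by measurable
  have "(\<integral>\<^sup>+\<xi>. ennreal (norm (log_mom (\<eta> (\<xi> 0)) UNIV t)) \<partial>\<tau>) \<le> (\<integral>\<^sup>+\<xi>. e2ennreal \<bar>elog (m0_exp \<eta> \<xi> t)\<bar> \<partial>\<tau>)"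
    by (intro nn_integral_mono) (simp add: m0_exp_eq_mom ennreal_abs_le_elog)
  then show "(\<integral>\<^sup>+\<xi>. ennreal (norm (log_mom (\<eta> (\<xi> 0)) UNIV t)) \<partial>\<tau>) < \<infinity>"
    using log_m0_exp_integrable[of t] by (rule le_less_trans)
qed

text \<open>\<open>annealed\<close> is a bind, and integrating against it in two stages requires a
  measurable kernel. Cylinders suffice: their quenched probability is a finite product of measurable
  functions of the environment.\<close>

lemma measurable_quenched: "quenched \<eta> \<in> \<tau> \<rightarrow>\<^sub>M subprob_algebra tree_space"
proof (rule measurable_subprob_algebra_generated)
  let ?M = "\<lambda>_ :: nat list. offspring_space"
  show "sets tree_space = sigma_sets (\<Pi>\<^sub>E u\<in>UNIV. space offspring_space) (prod_algebra UNIV ?M)"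
    unfolding tree_space_def by (rule sets_PiM)
  show "Int_stable (prod_algebra UNIV ?M)" by (rule Int_stable_prod_algebra)
  show "prod_algebra UNIV ?M \<subseteq> Pow (\<Pi>\<^sub>E u\<in>UNIV. space offspring_space)" by (rule prod_algebra_sets_into_space)
  show "subprob_space (quenched \<eta> \<xi>)" if "\<xi> \<in> space \<tau>" for \<xi>
    unfolding quenched_eq_tree_law by (rule prob_space_imp_subprob_space[OF prob_space_tree_law[OF env_offspring_laws[OF that]]])
  show "sets (quenched \<eta> \<xi>) = sets tree_space" if "\<xi> \<in> space \<tau>" for \<xi>
    unfolding quenched_eq_tree_law by (rule sets_tree_law[OF env_offspring_laws[OF that]])
  have emb: "(\<lambda>\<xi>. emeasure (quenched \<eta> \<xi>) A) \<in> borel_measurable \<tau>" if A: "A \<in> prod_algebra UNIV ?M" for A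
  proof -
    from A obtain J E where J: "A = prod_emb UNIV ?M J (Pi\<^sub>E J E)" "finite J" "\<And>u. u \<in> J \<Longrightarrow> E u \<in> sets offspring_space"
      by (rule prod_algebraE) auto
    have "emeasure (quenched \<eta> \<xi>) A = (\<Prod>u\<in>J. emeasure (\<eta> (\<xi> (length u))) (E u))" if \<xi>: "\<xi> \<in> space \<tau>" for \<xi>
    proof -
      note e = env_offspring_laws[OF \<xi>]
      have "A = prod_emb UNIV (\<lambda>u. \<eta> (\<xi> (length u))) J (Pi\<^sub>E J E)"
        using sets_eq_imp_space_eq[OF offspring_laws_sets[OF e]] by (simp add: J(1) prod_emb_def)
      then show ?thesis
        unfolding quenched_def
        using emeasure_PiM_emb[of UNIV "\<lambda>u. \<eta> (\<xi> (length u))" J E] J offspring_laws_prob[OF e] offspring_laws_sets[OF e] by simp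
    qed
    then have "(\<lambda>\<xi>. emeasure (quenched \<eta> \<xi>) A) \<in> borel_measurable \<tau>
      \<longleftrightarrow> (\<lambda>\<xi>. \<Prod>u\<in>J. emeasure (\<eta> (\<xi> (length u))) (E u)) \<in> borel_measurable \<tau>"
      by (rule measurable_cong)
    also have "\<dots>"
      by (intro borel_measurable_prod_ennreal measurable_compose[OF measurable_env_law measurable_emeasure_subprob_algebra] J(3))
    finally show ?thesis .
  qed
  then show "(\<lambda>\<xi>. emeasure (quenched \<eta> \<xi>) A) \<in> borel_measurable \<tau>" if "A \<in> prod_algebra UNIV ?M" for A
    using that by blast
  have "(\<lambda>\<xi>. emeasure (quenched \<eta> \<xi>) (\<Pi>\<^sub>E u\<in>UNIV. space offspring_space)) \<in> borel_measurable \<tau> \<longleftrightarrow> (\<lambda>\<xi>. 1 :: ennreal) \<in> borel_measurable \<tau>"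
  proof (rule measurable_cong)
    fix \<xi> assume \<xi>: "\<xi> \<in> space \<tau>"
    interpret prob_space "tree_law (\<lambda>n. \<eta> (\<xi> n))" by (rule prob_space_tree_law[OF env_offspring_laws[OF \<xi>]])
    have "space (tree_law (\<lambda>n. \<eta> (\<xi> n))) = UNIV"
      using sets_eq_imp_space_eq[OF sets_tree_law[OF env_offspring_laws[OF \<xi>]]] by simp
    then show "emeasure (quenched \<eta> \<xi>) (\<Pi>\<^sub>E u\<in>UNIV. space offspring_space) = 1"
      using emeasure_space_1 by (simp add: quenched_eq_tree_law PiE_UNIV_domain)
  qed
  then show "(\<lambda>\<xi>. emeasure (quenched \<eta> \<xi>) (\<Pi>\<^sub>E u\<in>UNIV. space offspring_space)) \<in> borel_measurable \<tau>" by simp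
qed

text \<open>The assumption on L_1 is annealed; read at the root under the quenched law it says that
  the conditional mean of |L_1| is integrable over the environment. This feeds the minorant of the
  truncated logarithms.\<close>

lemma mean_abs_displacement_integrable:
  "(\<integral>\<^sup>+\<xi>. (\<integral>\<^sup>+x. ennreal \<bar>snd x 0\<bar> \<partial>\<eta> (\<xi> 0)) \<partial>\<tau>) < \<infinity>"
proof -
  have f: "(\<lambda>(\<xi> :: nat \<Rightarrow> 'a, \<omega>). ennreal \<bar>displacement \<omega> [] 0\<bar>) \<in> borel_measurable (\<tau> \<Otimes>\<^sub>M tree_space)"
  proof -
    have "(\<lambda>z. snd (snd z []) 0) \<in> borel_measurable (\<tau> \<Otimes>\<^sub>M tree_space)"
      by (rule measurable_compose[OF measurable_compose[OF measurable_snd measurable_eval_tree] measurable_snd_offspring])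
    then show ?thesis by (simp add: displacement_def split_beta')
  qed
  have ker: "(\<lambda>\<xi>. distr (quenched \<eta> \<xi>) (\<tau> \<Otimes>\<^sub>M tree_space) (\<lambda>\<omega>. (\<xi>, \<omega>))) \<in> \<tau> \<rightarrow>\<^sub>M subprob_algebra (\<tau> \<Otimes>\<^sub>M tree_space)"
    by (rule measurable_distr2[OF _ measurable_quenched]) simp
  have g: "(\<lambda>x. ennreal \<bar>snd x 0\<bar>) \<in> borel_measurable offspring_space"
    using measurable_snd_offspring[of 0] by measurable
  let ?f = "\<lambda>z. case z of (\<xi> :: nat \<Rightarrow> 'a, \<omega>) \<Rightarrow> ennreal \<bar>displacement \<omega> [] 0\<bar>"
  let ?D = "\<lambda>\<xi>. distr (quenched \<eta> \<xi>) (\<tau> \<Otimes>\<^sub>M tree_space) (\<lambda>\<omega>. (\<xi>, \<omega>))"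
  let ?L = "\<lambda>\<xi>. \<integral>\<^sup>+x. ennreal \<bar>snd x 0\<bar> \<partial>\<eta> (\<xi> 0)"
  have "(\<integral>\<^sup>+z. ?f z \<partial>annealed \<eta> \<tau>)
    = (\<integral>\<^sup>+\<xi>. \<integral>\<^sup>+z. ?f z \<partial>?D \<xi> \<partial>\<tau>)"
    unfolding annealed_def by (rule nn_integral_bind[OF f ker])
  also have "\<dots> = (\<integral>\<^sup>+\<xi>. ?L \<xi> \<partial>\<tau>)"
  proof (intro nn_integral_cong)
    fix \<xi> assume \<xi>: "\<xi> \<in> space \<tau>"
    have "(\<lambda>\<omega>. (\<xi>, \<omega>)) \<in> tree_space \<rightarrow>\<^sub>M \<tau> \<Otimes>\<^sub>M tree_space" by (rule measurable_Pair1'[OF \<xi>])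
    then have pair: "(\<lambda>\<omega>. (\<xi>, \<omega>)) \<in> quenched \<eta> \<xi> \<rightarrow>\<^sub>M \<tau> \<Otimes>\<^sub>M tree_space"
      unfolding quenched_eq_tree_law by (subst measurable_cong_sets[OF sets_tree_law[OF env_offspring_laws[OF \<xi>]] refl])
    have "(\<integral>\<^sup>+z. ?f z \<partial>?D \<xi>)
      = (\<integral>\<^sup>+\<omega>. ennreal \<bar>snd (\<omega> []) 0\<bar> \<partial>tree_law (\<lambda>n. \<eta> (\<xi> n)))"
      by (subst nn_integral_distr[OF pair]) (use f in \<open>auto simp: quenched_eq_tree_law displacement_def\<close>)
    also have "\<dots> = ?L \<xi>"
      by (rule nn_integral_root[OF env_offspring_laws[OF \<xi>] g])
    finally show "(\<integral>\<^sup>+z. ?f z \<partial>?D \<xi>)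
      = ?L \<xi>" .
  qed
  finally show ?thesis using L1_integrable by simp
qed

end

section \<open>Linear continuation of a convex function along rays\<close>

lemma convex_derivative_mono:
  fixes f f' :: "real \<Rightarrow> real"
  assumes conv: "convex_on UNIV f" and D: "\<And>t. (f has_real_derivative f' t) (at t)" and "r \<le> s"
  shows "f' r \<le> f' s"
proof (cases "r = s")
  case False
  with assms(3) have "r < s" by simp
  have "f r + f' r * (s - r) \<le> f s" "f s + f' s * (r - s) \<le> f r"
    using convex_on_above_tangent[OF conv D] by blast+
  then have "f' r * (s - r) \<le> f' s * (s - r)" by (simp add: algebra_simps)
  with \<open>r < s\<close> show ?thesis by simp
qed simp

text \<open>If s f' s \<le> f s, the tangent at s is nonnegative at 0, so the ray of slope f' s lies
  below this tangent, hence below f. Monotone slopes extend this to every r < p, and p itself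
  follows from mean value slopes to its left, without continuity of the derivative.\<close>

lemma ray_below_convex:
  fixes f f' :: "real \<Rightarrow> real"
  assumes conv: "convex_on UNIV f" and D: "\<And>t. (f has_real_derivative f' t) (at t)"
    and t: "0 \<le> t" and S: "\<And>r. r < p \<Longrightarrow> \<exists>s. r < s \<and> s \<le> t \<and> s * f' s - f s \<le> 0"
  shows "t * f' p \<le> f t"
proof -
  have below: "t * f' r \<le> f t" if r: "r < p" for r
  proof -
    from S[OF r] obtain s where s: "r < s" "s \<le> t" "s * f' s - f s \<le> 0" by blast
    have "t * f' r \<le> t * f' s"
      using convex_derivative_mono[OF conv D, of r s] s t by (intro mult_left_mono) auto
    also have "\<dots> \<le> f s + f' s * (t - s)" using s(3) by (simp add: algebra_simps)
    also have "\<dots> \<le> f t" by (rule convex_on_above_tangent[OF conv D])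
    finally show ?thesis .
  qed
  have lim: "((\<lambda>h. t * ((f (p + h) - f p) / h)) \<longlongrightarrow> t * f' p) (at_left 0)"
    using D[of p] by (intro tendsto_mult tendsto_const) (simp add: DERIV_def filterlim_at_split)
  have "\<forall>\<^sub>F h in at_left 0. t * ((f (p + h) - f p) / h) \<le> f t"
    unfolding eventually_at_left_field
  proof (intro exI[of _ "-1"] conjI allI impI)
    fix h :: real assume h: "-1 < h" "h < 0"
    then have "p + h < p" by simp
    from MVT2[OF this, of f f'] D obtain z where z: "p + h < z" "z < p" "f p - f (p + h) = (p - (p + h)) * f' z" by blast
    then have "(f (p + h) - f p) / h = f' z" using h by (simp add: field_simps)
    then show "t * ((f (p + h) - f p) / h) \<le> f t" using below[OF z(2)] by simp
  qed simp
  from tendsto_upperbound[OF lim this] show ?thesis by simp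
qed

lemma legendre_antimono: "(\<And>t. f t \<le> g t) \<Longrightarrow> legendre g x \<le> legendre f x"
  unfolding legendre_def by (intro SUP_mono') simp

context branching_random_walk_in_random_environment
begin

interpretation \<tau>: prob_space \<tau> by (rule prob_space_env)

lemma Lam_tilde_le_Lam:
  assumes conv: "convex_on UNIV (Lam \<eta> \<tau>)" and D: "\<And>t. (Lam \<eta> \<tau> has_real_derivative f' t) (at t)"
  shows "Lam_tilde \<eta> \<tau> t \<le> Lam \<eta> \<tau> t"
proof -
  let ?f = "Lam \<eta> \<tau>"
  have deriv: "deriv ?f t = f' t" for t by (rule DERIV_imp_deriv[OF D])
  define S where "S = {t. t * f' t - ?f t \<le> 0}"
  \<comment> \<open>Supercriticality says \<Lambda> 0 > 0, so the defining set contains 0 and both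
    thresholds have the right sign.\<close>
  have 0: "0 \<in> S" using supercritical by (simp add: S_def mean_log_m0_eq)
  have tp: "t_plus \<eta> \<tau> = Sup (ereal ` S)" and tm: "t_minus \<eta> \<tau> = Inf (ereal ` S)"
    by (simp_all add: t_plus_def t_minus_def deriv S_def)
  have tp0: "0 \<le> t_plus \<eta> \<tau>" unfolding tp using 0 by (metis SUP_upper zero_ereal_def)
  have tm0: "t_minus \<eta> \<tau> \<le> 0" unfolding tm using 0 by (metis INF_lower zero_ereal_def)
  consider "t_minus \<eta> \<tau> < ereal t \<and> ereal t < t_plus \<eta> \<tau>" | "t_plus \<eta> \<tau> \<le> ereal t"
    | "ereal t < t_plus \<eta> \<tau>" "ereal t \<le> t_minus \<eta> \<tau>" by (meson not_less)
  then show ?thesis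
  proof cases
    case 1
    then show ?thesis by (simp add: Lam_tilde_def)
  next
    case 2
    \<comment> \<open>A threshold between 0 and the real number t is finite, so
      \<open>real_of_ereal\<close> in \<open>Lam_tilde\<close> returns its true value.\<close>
    then obtain p where p: "t_plus \<eta> \<tau> = ereal p" using tp0 by (cases "t_plus \<eta> \<tau>") auto
    have "t * f' p \<le> ?f t"
    proof (rule ray_below_convex[OF conv D])
      show "0 \<le> t" using tp0 2 by (metis ereal_less_eq(3) order_trans zero_ereal_def)
      fix r assume "r < p"
      then have "ereal r < t_plus \<eta> \<tau>" using p by simp
      then have "ereal r < Sup (ereal ` S)" unfolding tp .
      then obtain s where s: "s \<in> S" "r < s" by (auto simp: less_Sup_iff)
      then have "ereal s \<le> t_plus \<eta> \<tau>" unfolding tp by (intro SUP_upper)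
      with 2 have "s \<le> t" by (metis ereal_less_eq(3) order_trans)
      with s show "\<exists>s. r < s \<and> s \<le> t \<and> s * f' s - ?f s \<le> 0" by (auto simp: S_def)
    qed
    then show ?thesis using 2 p by (auto simp: Lam_tilde_def deriv)
  next
    case 3
    then obtain q where q: "t_minus \<eta> \<tau> = ereal q" using tm0 by (cases "t_minus \<eta> \<tau>") auto
    \<comment> \<open>The left ray is the right ray of the reflected function, with threshold
      -q.\<close>
    have "(- t) * (- f' (- (- q))) \<le> ?f (- (- t))"
    proof (rule ray_below_convex[where f="\<lambda>t. ?f (- t)" and f'="\<lambda>t. - f' (- t)"])
      show "convex_on UNIV (\<lambda>t. ?f (- t))"
      proof (rule convex_onI)
        fix a x y :: real assume "0 < a" "a < 1"
        then show "?f (- ((1 - a) *\<^sub>R x + a *\<^sub>R y)) \<le> (1 - a) * ?f (- x) + a * ?f (- y)"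
          using convex_onD[OF conv, of a "- x" "- y"] by simp
      qed simp
      show "((\<lambda>t. ?f (- t)) has_real_derivative - f' (- t)) (at t)" for t
      proof -
        have "(uminus has_real_derivative - 1) (at t)" by (auto intro!: derivative_eq_intros)
        from DERIV_chain2[OF D this] show ?thesis by simp
      qed
      show "0 \<le> - t" using tm0 3 by (metis ereal_less_eq(3) neg_0_le_iff_le order_trans zero_ereal_def)
      fix r assume "r < - q"
      then have "t_minus \<eta> \<tau> < ereal (- r)" using q by simp
      then have "Inf (ereal ` S) < ereal (- r)" unfolding tm .
      then obtain s where s: "s \<in> S" "s < - r" by (auto simp: Inf_less_iff)
      then have "t_minus \<eta> \<tau> \<le> ereal s" unfolding tm by (intro INF_lower)
      with 3 have "t \<le> s" by (metis ereal_less_eq(3) order_trans)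
      with s show "\<exists>s. r < s \<and> s \<le> - t \<and> s * - f' (- s) - ?f (- s) \<le> 0"
        by (intro exI[of _ "- s"]) (auto simp: S_def)
    qed
    then show ?thesis using 3 q by (auto simp: Lam_tilde_def deriv not_less)
  qed
qed

section \<open>Almost sure hypotheses and conclusion\<close>

context
  fixes \<delta> K :: real
  assumes no_small: "AE \<xi> in \<tau>. measure (quenched \<eta> \<xi>)
      {\<omega> \<in> space (quenched \<eta> \<xi>). num_children \<omega> [] \<le> 1} = 0"
    and pos: "\<delta> > 0" "K > 0"
    and moment: "AE \<xi> in \<tau>. (\<integral>\<^sup>+\<omega>. ennreal (real (num_children \<omega> []) powr (1 + \<delta>)) \<partial>quenched \<eta> \<xi>)
      \<le> ennreal K"
begin

lemma AE_two: "AE \<xi> in \<tau>. AE x in \<eta> (\<xi> 0). 2 \<le> fst x"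
  using no_small AE_space
proof eventually_elim
  case (elim \<xi>)
  note e = env_offspring_laws[OF elim(2)]
  let ?T = "tree_law (\<lambda>n. \<eta> (\<xi> n))"
  interpret T: prob_space ?T by (rule prob_space_tree_law[OF e])
  have m: "(\<lambda>x. indicator {..1} (fst x) :: ennreal) \<in> borel_measurable offspring_space"
    by (rule measurable_compose[OF measurable_fst_offspring]) simp
  have m': "{\<omega> \<in> space ?T. num_children \<omega> [] \<le> 1} \<in> sets ?T"
  proof -
    have "(\<lambda>\<omega>. fst (\<omega> [])) \<in> ?T \<rightarrow>\<^sub>M count_space UNIV"
      using measurable_compose[OF measurable_eval_tree measurable_fst_offspring, of "[]"]
        measurable_cong_sets[OF sets_tree_law[OF e] refl] by blast
    then show ?thesis unfolding num_children_def by (rule measurable_sets_Collect) simp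
  qed
  have "(\<integral>\<^sup>+x. indicator {..1} (fst x) \<partial>\<eta> (\<xi> 0)) = (\<integral>\<^sup>+\<omega>. indicator {..1} (fst (\<omega> [])) \<partial>?T)"
    by (rule nn_integral_root[OF e m, symmetric])
  also have "\<dots> = (\<integral>\<^sup>+\<omega>. indicator {\<omega> \<in> space ?T. num_children \<omega> [] \<le> 1} \<omega> \<partial>?T)"
    by (intro nn_integral_cong) (auto simp: indicator_def num_children_def)
  also have "\<dots> = 0"
    using m' elim(1) by (simp add: T.emeasure_eq_measure quenched_eq_tree_law)
  finally have "AE x in \<eta> (\<xi> 0). (indicator {..1} (fst x) :: ennreal) = 0"
    using measurable_offspring_laws[OF e m, of 0] by (subst (asm) nn_integral_0_iff_AE) auto
  then show ?case by eventually_elim (auto simp: indicator_def split: if_splits)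
qed

lemma AE_moment: "AE \<xi> in \<tau>. (\<integral>\<^sup>+x. ennreal (real (fst x) powr (1 + \<delta>)) \<partial>\<eta> (\<xi> 0)) \<le> ennreal K"
  using moment AE_space
proof eventually_elim
  case (elim \<xi>)
  have "(\<lambda>x. ennreal (real (fst x) powr (1 + \<delta>))) \<in> borel_measurable offspring_space"
    by (rule measurable_compose[OF measurable_fst_offspring]) simp
  from nn_integral_root[OF env_offspring_laws[OF elim(2)] this] elim(1) show ?case
    by (simp add: quenched_eq_tree_law num_children_def)
qed

lemma AE_regular_laws: "AE \<xi> in \<tau>. regular_laws \<delta> K (\<lambda>n. \<eta> (\<xi> n))"
proof -
  have "AE \<xi> in \<tau>. (AE x in \<eta> (\<xi> 0). 2 \<le> fst x) \<and> (\<integral>\<^sup>+x. ennreal (real (fst x) powr (1 + \<delta>)) \<partial>\<eta> (\<xi> 0)) \<le> ennreal K"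
    using AE_two AE_moment by eventually_elim simp
  from AE_env_all[OF this] AE_space show ?thesis
    by eventually_elim (auto simp: regular_laws_def env_offspring_laws)
qed

lemma AE_mom_finite_all: "AE \<xi> in \<tau>. \<forall>t. mom (\<eta> (\<xi> 0)) UNIV t < \<top>"
proof -
  have "AE \<xi> in \<tau>. \<forall>t\<in>\<rat>. mom (\<eta> (\<xi> 0)) UNIV t < \<top>"
    using AE_mom_finite by (subst AE_ball_countable[OF countable_rat]) auto
  then show ?thesis using AE_space
  proof eventually_elim
    case (elim \<xi>)
    then show ?case
      using mom_finite_all[OF offspring_laws_sets[OF env_offspring_laws[OF elim(2)], of 0]] by blast
  qed
qed

lemma AE_ln_mom:
  "AE \<xi> in \<tau>. convex_on UNIV (\<lambda>t. log_mom (\<eta> (\<xi> 0)) UNIV t)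
    \<and> (\<forall>t. (\<lambda>t. log_mom (\<eta> (\<xi> 0)) UNIV t) differentiable (at t))
    \<and> (\<forall>t. 0 < mom (\<eta> (\<xi> 0)) UNIV t \<and> mom (\<eta> (\<xi> 0)) UNIV t < \<top>)
    \<and> (\<forall>t. (\<lambda>C. log_mom (\<eta> (\<xi> 0)) {..C} t) \<longlonglongrightarrow> log_mom (\<eta> (\<xi> 0)) UNIV t)"
  using AE_two AE_mom_finite_all AE_space
proof eventually_elim
  case (elim \<xi>)
  note e = env_offspring_laws[OF elim(3)]
  note h = offspring_laws_prob[OF e, of 0] offspring_laws_sets[OF e, of 0] elim(1) elim(2)[rule_format]
  from ln_mom_convex[OF h] ln_mom_differentiable[OF h] mom_pos[OF h] ln_mom_truncated_tendsto[OF h] elim(2)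
  show ?case by blast
qed

lemma Lam_convex: "convex_on UNIV (Lam \<eta> \<tau>)"
proof -
  have "convex_on UNIV (\<lambda>t. \<integral>\<xi>. log_mom (\<eta> (\<xi> 0)) UNIV t \<partial>\<tau>)"
    by (rule convex_on_integral[OF integrable_ln_mom]) (use AE_ln_mom in eventually_elim, blast)
  then show ?thesis by (simp only: Lam_eq[abs_def])
qed

lemma Lam_differentiable: "Lam \<eta> \<tau> differentiable (at t)"
proof -
  have "(\<lambda>t. \<integral>\<xi>. log_mom (\<eta> (\<xi> 0)) UNIV t \<partial>\<tau>) differentiable (at t)"
    by (rule convex_integral_differentiable[OF integrable_ln_mom])
       (use AE_ln_mom in eventually_elim, blast)+
  then show ?thesis by (simp only: Lam_eq[abs_def])
qed

text \<open>The function l is the conditional mean of |L_1|, and \<open>C0\<close> makes the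
  probability of more than C children at most 1 / 2. The minorant is the same for all C \<ge>
  C0.\<close>

lemma truncation_AE:
  "\<exists>C0 l. integrable \<tau> l \<and> (\<forall>C\<ge>C0. AE \<xi> in \<tau>. \<forall>t.
    ennreal (exp (- (ln 4 + 4 * \<bar>t\<bar> * (l \<xi> + 1)))) \<le> mom (\<eta> (\<xi> 0)) {..C} t)"
proof -
  obtain C0 where C0: "\<And>C. C \<ge> C0 \<Longrightarrow> C \<ge> 1 \<and> K * real C powr (- \<delta>) \<le> 1 / 2"
    using exists_truncation[OF pos(1), of "1 / 2" K] by auto
  define d where "d \<xi> = (\<integral>\<^sup>+x. ennreal \<bar>snd x 0\<bar> \<partial>\<eta> (\<xi> 0))" for \<xi> :: "nat \<Rightarrow> 'a"
  have g: "(\<lambda>x. ennreal \<bar>snd x 0\<bar>) \<in> borel_measurable offspring_space"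
    using measurable_snd_offspring[of 0] by measurable
  have d [measurable]: "d \<in> borel_measurable \<tau>"
    unfolding d_def by (rule measurable_nn_integral_env[OF g])
  have d_int: "(\<integral>\<^sup>+\<xi>. d \<xi> \<partial>\<tau>) < \<infinity>" unfolding d_def by (rule mean_abs_displacement_integrable)
  have "AE \<xi> in \<tau>. d \<xi> \<noteq> \<infinity>" by (rule nn_integral_PInf_AE[OF d]) (use d_int in simp)
  then have fin: "AE \<xi> in \<tau>. d \<xi> = ennreal (enn2real (d \<xi>))"
    by eventually_elim (simp add: less_top[symmetric])
  have int: "integrable \<tau> (\<lambda>\<xi>. enn2real (d \<xi>))"
  proof (rule integrableI_bounded)
    have "(\<integral>\<^sup>+\<xi>. ennreal (norm (enn2real (d \<xi>))) \<partial>\<tau>) \<le> (\<integral>\<^sup>+\<xi>. d \<xi> \<partial>\<tau>)"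
      by (rule nn_integral_mono_AE) (use fin in eventually_elim, simp)
    then show "(\<integral>\<^sup>+\<xi>. ennreal (norm (enn2real (d \<xi>))) \<partial>\<tau>) < \<infinity>" using d_int by (rule le_less_trans)
  qed measurable
  have "AE \<xi> in \<tau>. \<forall>t. ennreal (exp (- (ln 4 + 4 * \<bar>t\<bar> * (enn2real (d \<xi>) + 1)))) \<le> mom (\<eta> (\<xi> 0)) {..C} t"
    if C: "C \<ge> C0" for C
    using fin AE_regular_laws AE_mom_finite_all AE_space
  proof eventually_elim
    case (elim \<xi>)
    note e = env_offspring_laws[OF elim(4)]
    have two: "AE x in \<eta> (\<xi> 0). 2 \<le> fst x" by (rule reg_two[OF pos elim(2), of 0])
    note h = offspring_laws_prob[OF e, of 0] offspring_laws_sets[OF e, of 0] two elim(3)[rule_format]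
    have p: "emeasure (\<eta> (\<xi> 0)) {x \<in> space (\<eta> (\<xi> 0)). C < fst x} \<le> ennreal (1 / 2)"
      using prob_exceeds_le[OF pos elim(2), of C "1 / 2" 0] C0[OF C] by simp
    show ?case
      using mom_truncated_ge[OF h p, of "enn2real (d \<xi>)"] elim(1) by (simp add: d_def)
  qed
  with int show ?thesis by blast
qed

text \<open>\<open>\<Lambda>\<^sub>C\<close> is the environment mean of the truncated logarithmic
  moment. The full moment bounds it from above and a minorant independent of C from below, so
  dominated convergence yields \<Lambda>. The claims are only eventual in C since below
  \<open>C0\<close> the truncated moment may vanish.\<close>

lemma large_deviation_hypotheses:
  "\<exists>\<Lambda>\<^sub>C. (\<forall>t. (\<lambda>C. \<Lambda>\<^sub>C C t) \<longlonglongrightarrow> Lam \<eta> \<tau> t) \<and> (AE \<xi> in \<tau>. \<forall>t\<in>\<rat>.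
    (\<forall>\<^sub>F C in sequentially. \<forall>k. 0 < mom (\<eta> (\<xi> k)) {..C} t) \<and>
    (\<forall>\<^sub>F C in sequentially. (\<lambda>n. (\<Sum>k<n. log_mom (\<eta> (\<xi> k)) {..C} t) / real n) \<longlonglongrightarrow> \<Lambda>\<^sub>C C t))"
proof -
  from truncation_AE obtain C0 l where l: "integrable \<tau> l" and tr: "\<And>C. C \<ge> C0 \<Longrightarrow> AE \<xi> in \<tau>. \<forall>t.
    ennreal (exp (- (ln 4 + 4 * \<bar>t\<bar> * (l \<xi> + 1)))) \<le> mom (\<eta> (\<xi> 0)) {..C} t" by blast
  define F where "F C t \<xi> = log_mom (\<eta> (\<xi> 0)) {..C} t" for C t and \<xi> :: "nat \<Rightarrow> 'a"
  define G where "G t \<xi> = log_mom (\<eta> (\<xi> 0)) UNIV t" for t and \<xi> :: "nat \<Rightarrow> 'a"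
  define w where "w t \<xi> = \<bar>G t \<xi>\<bar> + \<bar>ln 4 + 4 * \<bar>t\<bar> * (l \<xi> + 1)\<bar>" for t \<xi>
  have w: "integrable \<tau> (w t)" for t
    unfolding w_def using integrable_ln_mom l by (auto simp: G_def)
  have F: "F C t \<in> borel_measurable \<tau>" for C t
  proof -
    have [measurable]: "(\<lambda>\<xi>. mom (\<eta> (\<xi> 0)) {..C} t) \<in> borel_measurable \<tau>" by (rule measurable_mom_env)
    show ?thesis unfolding F_def by measurable
  qed
  have bound: "AE \<xi> in \<tau>. norm (F C t \<xi>) \<le> w t \<xi>" if C: "C \<ge> C0" for C t
    using tr[OF C] AE_ln_mom
  proof eventually_elim
    case (elim \<xi>)
    let ?x = "mom (\<eta> (\<xi> 0)) {..C} t" and ?y = "mom (\<eta> (\<xi> 0)) UNIV t" and ?b = "ln 4 + 4 * \<bar>t\<bar> * (l \<xi> + 1)"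
    have xy: "?x \<le> ?y" by (rule mom_mono) simp
    have y: "?y < \<top>" using elim(2) by blast
    have x: "?x < \<top>" using xy y by (rule le_less_trans)
    have b: "ennreal (exp (- ?b)) \<le> ?x" using elim(1) by blast
    have "exp (- ?b) \<le> enn2real ?x" using enn2real_mono[OF b x] by simp
    then have 1: "- ?b \<le> F C t \<xi>" unfolding F_def by (subst ln_ge_iff) (auto intro: less_le_trans[OF exp_gt_zero])
    have "0 < enn2real ?x" using \<open>exp (- ?b) \<le> enn2real ?x\<close> by (rule less_le_trans[OF exp_gt_zero])
    moreover have "enn2real ?x \<le> enn2real ?y" by (rule enn2real_mono[OF xy y])
    ultimately have 2: "F C t \<xi> \<le> G t \<xi>" unfolding F_def G_def by (subst ln_le_cancel_iff) auto
    show ?case using 1 2 unfolding w_def by auto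
  qed
  have int: "integrable \<tau> (F C t)" if C: "C \<ge> C0" for C t
    by (rule Bochner_Integration.integrable_bound[OF w F]) (use bound[OF C, of t] in \<open>eventually_elim, auto simp: w_def\<close>)
  have conv: "(\<lambda>C. \<integral>\<xi>. F C t \<xi> \<partial>\<tau>) \<longlonglongrightarrow> Lam \<eta> \<tau> t" for t
  proof (rule LIMSEQ_offset[where k=C0])
    show "(\<lambda>C. \<integral>\<xi>. F (C + C0) t \<xi> \<partial>\<tau>) \<longlonglongrightarrow> Lam \<eta> \<tau> t"
      unfolding Lam_eq
    proof (rule integral_dominated_convergence[OF _ F w])
      show "(\<lambda>\<xi>. log_mom (\<eta> (\<xi> 0)) UNIV t) \<in> borel_measurable \<tau>"
        using integrable_ln_mom by (rule borel_measurable_integrable)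
      show "AE \<xi> in \<tau>. (\<lambda>C. F (C + C0) t \<xi>) \<longlonglongrightarrow> log_mom (\<eta> (\<xi> 0)) UNIV t"
        using AE_ln_mom
      proof eventually_elim
        case (elim \<xi>)
        then have "(\<lambda>C. F C t \<xi>) \<longlonglongrightarrow> log_mom (\<eta> (\<xi> 0)) UNIV t" unfolding F_def by blast
        then show ?case by (rule LIMSEQ_ignore_initial_segment)
      qed
      show "AE \<xi> in \<tau>. norm (F (C + C0) t \<xi>) \<le> w t \<xi>" for C by (rule bound) simp
    qed
  qed
  \<comment> \<open>Birkhoff's theorem is applied for each rational t and each natural C, hence
    countably many exceptional sets.\<close>
  have "AE \<xi> in \<tau>. \<forall>t\<in>\<rat>. \<forall>C. C \<ge> C0 \<longrightarrow> (\<forall>k. 0 < mom (\<eta> (\<xi> k)) {..C} t)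
    \<and> (\<lambda>n. (\<Sum>k<n. log_mom (\<eta> (\<xi> k)) {..C} t) / real n) \<longlonglongrightarrow> (\<integral>\<xi>. F C t \<xi> \<partial>\<tau>)"
    unfolding AE_ball_countable[OF countable_rat] AE_all_countable
  proof (intro ballI allI)
    fix t :: real and C
    show "AE \<xi> in \<tau>. C \<ge> C0 \<longrightarrow> (\<forall>k. 0 < mom (\<eta> (\<xi> k)) {..C} t)
      \<and> (\<lambda>n. (\<Sum>k<n. log_mom (\<eta> (\<xi> k)) {..C} t) / real n) \<longlonglongrightarrow> (\<integral>\<xi>. F C t \<xi> \<partial>\<tau>)"
    proof (cases "C \<ge> C0")
      case True
      have "AE \<xi> in \<tau>. 0 < mom (\<eta> (\<xi> 0)) {..C} t"
        using tr[OF True]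
      proof eventually_elim
        case (elim \<xi>)
        have "0 < ennreal (exp (- (ln 4 + 4 * \<bar>t\<bar> * (l \<xi> + 1))))" by simp
        with elim show ?case by (meson less_le_trans)
      qed
      from AE_env_all[OF this] birkhoff_env[OF int[OF True, of t]] show ?thesis
        by eventually_elim (simp add: F_def)
    qed simp
  qed
  then have "AE \<xi> in \<tau>. \<forall>t\<in>\<rat>.
    (\<forall>\<^sub>F C in sequentially. \<forall>k. 0 < mom (\<eta> (\<xi> k)) {..C} t) \<and>
    (\<forall>\<^sub>F C in sequentially. (\<lambda>n. (\<Sum>k<n. log_mom (\<eta> (\<xi> k)) {..C} t) / real n) \<longlonglongrightarrow> (\<integral>\<xi>. F C t \<xi> \<partial>\<tau>))"
    by eventually_elim (auto simp: eventually_sequentially)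
  with conv show ?thesis by (intro exI[of _ "\<lambda>C t. \<integral>\<xi>. F C t \<xi> \<partial>\<tau>"]) auto
qed

text \<open>All almost sure inputs are free of A, so one null set serves the uncountably many Borel
  sets.\<close>

lemma AE_ratio_large_deviations:
  "AE \<xi> in \<tau>. \<forall>A\<in>sets borel.
    - (INF x\<in>interior A. legendre (Lam \<eta> \<tau>) x) - ereal (Lam \<eta> \<tau> 0)
      \<le> liminf (log_ratio (\<lambda>n. \<eta> (\<xi> n)) A) \<and>
    limsup (log_ratio (\<lambda>n. \<eta> (\<xi> n)) A)
      \<le> - (INF x\<in>closure A. legendre (Lam \<eta> \<tau>) x) - ereal (Lam \<eta> \<tau> 0)"
proof -
  from large_deviation_hypotheses obtain \<Lambda>\<^sub>C where
    trunc: "\<And>t. (\<lambda>C. \<Lambda>\<^sub>C C t) \<longlonglongrightarrow> Lam \<eta> \<tau> t" and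
    tr: "AE \<xi> in \<tau>. \<forall>t\<in>\<rat>. (\<forall>\<^sub>F C in sequentially. \<forall>k. 0 < mom (\<eta> (\<xi> k)) {..C} t) \<and>
      (\<forall>\<^sub>F C in sequentially. (\<lambda>n. (\<Sum>k<n. log_mom (\<eta> (\<xi> k)) {..C} t) / real n) \<longlonglongrightarrow> \<Lambda>\<^sub>C C t)"
    by blast
  obtain \<Lambda>' where D: "\<And>t. (Lam \<eta> \<tau> has_real_derivative \<Lambda>' t) (at t)"
    using Lam_differentiable unfolding real_differentiable_def by metis
  have "AE \<xi> in \<tau>. \<forall>t. 0 < mom (\<eta> (\<xi> 0)) UNIV t \<and> mom (\<eta> (\<xi> 0)) UNIV t < \<top>"
    using AE_ln_mom by eventually_elim blast
  then have fin: "AE \<xi> in \<tau>. \<forall>k t. 0 < mom (\<eta> (\<xi> k)) UNIV t \<and> mom (\<eta> (\<xi> k)) UNIV t < \<top>"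
    by (rule AE_env_all)
  have lim: "AE \<xi> in \<tau>. \<forall>t\<in>\<rat>. (\<lambda>n. (\<Sum>k<n. log_mom (\<eta> (\<xi> k)) UNIV t) / real n) \<longlonglongrightarrow> Lam \<eta> \<tau> t"
    unfolding AE_ball_countable[OF countable_rat]
    using birkhoff_env[OF integrable_ln_mom] by (simp add: Lam_eq)
  show ?thesis
    using AE_regular_laws tr fin lim
  proof eventually_elim
    case (elim \<xi>)
    note h = pos elim(1) elim(3)[rule_format] elim(4)[rule_format] trunc conjunct1[OF elim(2)[rule_format]]
      conjunct2[OF elim(2)[rule_format]] Lam_convex D
    show ?case
    proof (intro ballI conjI)
      fix A :: "real set" assume A: "A \<in> sets borel"
      show "- (INF x\<in>interior A. legendre (Lam \<eta> \<tau>) x) - ereal (Lam \<eta> \<tau> 0)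
          \<le> liminf (log_ratio (\<lambda>n. \<eta> (\<xi> n)) A)"
        by (rule ratio_large_deviations(1)[where \<Lambda>'=\<Lambda>' and \<Lambda>\<^sub>C=\<Lambda>\<^sub>C and \<delta>=\<delta> and K=K]) (use h A in blast)+
      show "limsup (log_ratio (\<lambda>n. \<eta> (\<xi> n)) A)
          \<le> - (INF x\<in>closure A. legendre (Lam \<eta> \<tau>) x) - ereal (Lam \<eta> \<tau> 0)"
        by (rule ratio_large_deviations(2)[where \<Lambda>'=\<Lambda>' and \<Lambda>\<^sub>C=\<Lambda>\<^sub>C and \<delta>=\<delta> and K=K]) (use h A in blast)+
    qed
  qed
qed

lemma AE_large_deviations:
  "AE \<xi> in \<tau>. \<forall>A\<in>sets borel.
    - (INF x\<in>interior A. legendre (Lam_tilde \<eta> \<tau>) x) - ereal (mean_log_m0 \<eta> \<tau>)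
      \<le> liminf (log_ratio (\<lambda>n. \<eta> (\<xi> n)) A) \<and>
    limsup (log_ratio (\<lambda>n. \<eta> (\<xi> n)) A)
      \<le> - (INF x\<in>closure A. legendre (Lam \<eta> \<tau>) x) - ereal (mean_log_m0 \<eta> \<tau>)"
  using AE_ratio_large_deviations
proof eventually_elim
  case (elim \<xi>)
  obtain \<Lambda>' where D: "\<And>t. (Lam \<eta> \<tau> has_real_derivative \<Lambda>' t) (at t)"
    using Lam_differentiable unfolding real_differentiable_def by metis
  \<comment> \<open>A smaller function has a larger conjugate, so the lower bound with
    \<open>Lam\<close> is the stronger one.\<close>
  have "(INF x\<in>interior A. legendre (Lam \<eta> \<tau>) x) \<le> (INF x\<in>interior A. legendre (Lam_tilde \<eta> \<tau>) x)" for A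
    by (intro INF_mono' legendre_antimono Lam_tilde_le_Lam[OF Lam_convex D])
  then have "- (INF x\<in>interior A. legendre (Lam_tilde \<eta> \<tau>) x) - ereal (Lam \<eta> \<tau> 0)
    \<le> - (INF x\<in>interior A. legendre (Lam \<eta> \<tau>) x) - ereal (Lam \<eta> \<tau> 0)" for A
    by (intro ereal_minus_mono) auto
  with elim show ?case unfolding mean_log_m0_eq by (meson order_trans)
qed

end

end

theorem theorem5p1:
  fixes \<Theta> :: "'a measure"
    and \<eta> :: "'a \<Rightarrow> offspring measure"
    and \<tau> :: "(nat \<Rightarrow> 'a) measure"
    and \<delta> K :: real
  assumes "branching_random_walk_in_random_environment \<Theta> \<eta> \<tau>"
    and "AE \<xi> in \<tau>. measure (quenched \<eta> \<xi>)
           {\<omega> \<in> space (quenched \<eta> \<xi>). num_children \<omega> [] \<le> 1} = 0"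
    and "\<delta> > 0" and "K > 0"
    and "AE \<xi> in \<tau>. (\<integral>\<^sup>+\<omega>. ennreal (real (num_children \<omega> []) powr (1 + \<delta>)) \<partial>quenched \<eta> \<xi>)
           \<le> ennreal K"
  defines "R \<equiv> \<lambda>\<xi> A n. ereal (1 / real n) *
             elog (\<integral>\<^sup>+\<omega>. ennreal (Z \<omega> n ((\<lambda>x. real n * x) ` A) / Z \<omega> n UNIV) \<partial>quenched \<eta> \<xi>)"
  shows "AE \<xi> in \<tau>. \<forall>A\<in>sets (borel :: real measure).
     - (INF x\<in>interior A. legendre (Lam_tilde \<eta> \<tau>) x) - ereal (mean_log_m0 \<eta> \<tau>)
       \<le> liminf (R \<xi> A) \<and>
     liminf (R \<xi> A) \<le> limsup (R \<xi> A) \<and>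
     limsup (R \<xi> A)
       \<le> - (INF x\<in>closure A. legendre (Lam \<eta> \<tau>) x) - ereal (mean_log_m0 \<eta> \<tau>)"
proof -
  interpret branching_random_walk_in_random_environment \<Theta> \<eta> \<tau> by (rule assms(1))
  have R: "R \<xi> A = (log_ratio (\<lambda>n. \<eta> (\<xi> n)) A)" for \<xi> A
    by (simp add: R_def ratio_def ennreal_Z_ratio quenched_eq_tree_law)
  show ?thesis
    unfolding R using AE_large_deviations[OF assms(2-5)]
    by eventually_elim (simp add: Liminf_le_Limsup)
qed

end
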